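(* Let $K$ be a valued field of characteristic zero, considered as a structure in some language $\mathcal{L}\supseteq\mathcal{L}_{\mathrm{val}}=\{+,\cdot,\mathcal{O}\}$, and assume that the complete $\mathcal{L}$-theory $\mathrm{Th}_{\mathcal{L}}(K)$ is $1$-h-minimal. Then every definable set $X\subseteq K^n$ is Borel.
   Context: $\mathcal{O}$ is a unary predicate for the valuation ring. Definable means $\mathcal{L}$-definable with parameters from $K$. Borel means belonging to the $\sigma$-algebra generated by the open sets of $K^n$, where $K$ carries the valuation topology and $K^n$ the product topology. $1$-h-minimality (Hensel minimality, in the sense of Cluckers–Halupczok–Rideau-Kikuchi, and Cluckers–Halupczok–Rideau-Kikuchi–Vermeulen in mixed characteristic) is the following notion. Let $K'$ be a non-trivially valued field of characteristic $0$ with value group $\Gamma^\times$ written multiplicatively and $|\cdot|\colon K'\to\Gamma^\times\cup\{0\}$ the valuation, so $\mathcal{O}=\{x:|x|\le 1\}$. For $\lambda\le 1$ in $\Gamma^\times$, let $I_\lambda=\{x\in K':|x|<\lambda\}$ and $\mathrm{RV}_\lambda=(K'^\times/(1+I_\lambda))\cup\{0\}$, with $\mathrm{rv}_\lambda\colon K'\to\mathrm{RV}_\lambda$ the natural map extended by $\mathrm{rv}_\lambda(0)=0$. Thus $\mathrm{rv}_\lambda(x)=\mathrm{rv}_\lambda(x')$ iff $x=x'=0$ or $|x-x'|<\lambda|x|$. The sets $\mathrm{RV}_\lambda$ are treated as imaginary sorts, whose elements may be used as parameters. A finite set $C\subseteq K'$ is said to $\lambda$-prepare a set $X\subseteq K'$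 if for all $x,x'\in K'$ with $\mathrm{rv}_\lambda(x-c)=\mathrm{rv}_\lambda(x'-c)$ for every $c\in C$, one has $x\in X\iff x'\in X$. The theory $\mathrm{Th}_{\mathcal{L}}(K)$ is $1$-h-minimal if $K$ is non-trivially valued and for every model $K'$ of $\mathrm{Th}_{\mathcal{L}}(K)$ the following holds: for every integer $r\ge 1$, every $\lambda\le 1$ in $\Gamma^\times$, every $A\subseteq K'$, every $A'\subseteq\mathrm{RV}_\lambda$ of cardinality at most $1$, and every $(A\cup\mathrm{RV}_{|r|}\cup A')$-definable set $X\subseteq K'$, there exist an integer $m\ge 1$ and a finite $A$-definable set $C\subseteq K'$ such that $X$ is $(|m|\cdot\lambda)$-prepared by $C$. (If the residue characteristic is $0$, then $|r|=|m|=1$, so these integers play no role.) *)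

theory Defs
  imports "HOL-Analysis.Function_Topology" "HOL-Analysis.Sigma_Algebra" "HOL-Algebra.Subrings"
begin

section \<open>Languages extending $\{+, \cdot, \mathcal O\}$\<close>

text \<open>
  The symbols of $\mathcal L_{val}$ are constructors of the syntax below; a language lists its
  further function and relation symbols, which are the elements of the domains of the two
  (partial) arity functions.
\<close>

record ('f, 'r) language =
  fun_ar :: "'f \<Rightarrow> nat option"
  rel_ar :: "'r \<Rightarrow> nat option"

datatype 'f tm = Var nat | Plus "'f tm" "'f tm" | Times "'f tm" "'f tm" | Fn 'f "'f tm list"

text \<open>De Bruijn indices: in \<open>Ex \<phi>\<close> the bound variable is \<open>Var 0\<close> and \<open>Var (Suc i)\<close> stands for the
  outer variable \<open>i\<close>.\<close>

datatype ('f, 'r) fm =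
    Eq "'f tm" "'f tm"
  | InO "'f tm"
  | Rel 'r "'f tm list"
  | Neg "('f, 'r) fm"
  | And "('f, 'r) fm" "('f, 'r) fm"
  | Ex "('f, 'r) fm"

primrec fv_tm :: "'f tm \<Rightarrow> nat set" where
  "fv_tm (Var i) = {i}"
| "fv_tm (Plus s t) = fv_tm s \<union> fv_tm t"
| "fv_tm (Times s t) = fv_tm s \<union> fv_tm t"
| "fv_tm (Fn f ts) = \<Union> (set (map fv_tm ts))"

primrec fv :: "('f, 'r) fm \<Rightarrow> nat set" where
  "fv (Eq s t) = fv_tm s \<union> fv_tm t"
| "fv (InO t) = fv_tm t"
| "fv (Rel R ts) = \<Union> (set (map fv_tm ts))"
| "fv (Neg \<phi>) = fv \<phi>"
| "fv (And \<phi> \<psi>) = fv \<phi> \<union> fv \<psi>"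
| "fv (Ex \<phi>) = {i. Suc i \<in> fv \<phi>}"

primrec wf_tm :: "('f, 'r) language \<Rightarrow> 'f tm \<Rightarrow> bool" where
  "wf_tm L (Var i) \<longleftrightarrow> True"
| "wf_tm L (Plus s t) \<longleftrightarrow> wf_tm L s \<and> wf_tm L t"
| "wf_tm L (Times s t) \<longleftrightarrow> wf_tm L s \<and> wf_tm L t"
| "wf_tm L (Fn f ts) \<longleftrightarrow> fun_ar L f = Some (length ts) \<and> list_all (wf_tm L) ts"

primrec wf_fm :: "('f, 'r) language \<Rightarrow> ('f, 'r) fm \<Rightarrow> bool" where
  "wf_fm L (Eq s t) \<longleftrightarrow> wf_tm L s \<and> wf_tm L t"
| "wf_fm L (InO t) \<longleftrightarrow> wf_tm L t"
| "wf_fm L (Rel R ts) \<longleftrightarrow> rel_ar L R = Some (length ts) \<and> list_all (wf_tm L) ts"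
| "wf_fm L (Neg \<phi>) \<longleftrightarrow> wf_fm L \<phi>"
| "wf_fm L (And \<phi> \<psi>) \<longleftrightarrow> wf_fm L \<phi> \<and> wf_fm L \<psi>"
| "wf_fm L (Ex \<phi>) \<longleftrightarrow> wf_fm L \<phi>"


section \<open>Valued fields as structures\<close>

text \<open>The components \<open>zero\<close> and \<open>one\<close> inherited from \<open>ring\<close> are not symbols of the language; in a
  field they are determined by addition and multiplication.\<close>

record ('a, 'f, 'r) vstruct = "'a ring" +
  valring :: "'a set"
  fun_int :: "'f \<Rightarrow> 'a list \<Rightarrow> 'a"
  rel_int :: "'r \<Rightarrow> 'a list \<Rightarrow> bool"

definition valued_field :: "('a, 'f, 'r) vstruct \<Rightarrow> bool" where
  "valued_field M \<longleftrightarrow> field M \<and> subring (valring M) M \<and>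
     (\<forall>x \<in> carrier M - {\<zero>\<^bsub>M\<^esub>}. x \<in> valring M \<or> inv\<^bsub>M\<^esub> x \<in> valring M)"

definition nontrivially_valued :: "('a, 'f, 'r) vstruct \<Rightarrow> bool" where
  "nontrivially_valued M \<longleftrightarrow> valring M \<noteq> carrier M"

definition char_zero :: "('a, 'f, 'r) vstruct \<Rightarrow> bool" where
  "char_zero M \<longleftrightarrow> (\<forall>k::nat. k \<ge> 1 \<longrightarrow> [k] \<cdot>\<^bsub>M\<^esub> \<one>\<^bsub>M\<^esub> \<noteq> \<zero>\<^bsub>M\<^esub>)"

definition valued_structure :: "('f, 'r) language \<Rightarrow> ('a, 'f, 'r) vstruct \<Rightarrow> bool" where
  "valued_structure L M \<longleftrightarrow> valued_field M \<and>
     (\<forall>f xs. fun_ar L f = Some (length xs) \<and> set xs \<subseteq> carrier M \<longrightarrow> fun_int M f xs \<in> carrier M)"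

primrec eval_tm :: "('a, 'f, 'r) vstruct \<Rightarrow> (nat \<Rightarrow> 'a) \<Rightarrow> 'f tm \<Rightarrow> 'a" where
  "eval_tm M e (Var i) = e i"
| "eval_tm M e (Plus s t) = eval_tm M e s \<oplus>\<^bsub>M\<^esub> eval_tm M e t"
| "eval_tm M e (Times s t) = eval_tm M e s \<otimes>\<^bsub>M\<^esub> eval_tm M e t"
| "eval_tm M e (Fn f ts) = fun_int M f (map (eval_tm M e) ts)"

primrec sat :: "('a, 'f, 'r) vstruct \<Rightarrow> (nat \<Rightarrow> 'a) \<Rightarrow> ('f, 'r) fm \<Rightarrow> bool" where
  "sat M e (Eq s t) \<longleftrightarrow> eval_tm M e s = eval_tm M e t"
| "sat M e (InO t) \<longleftrightarrow> eval_tm M e t \<in> valring M"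
| "sat M e (Rel R ts) \<longleftrightarrow> rel_int M R (map (eval_tm M e) ts)"
| "sat M e (Neg \<phi>) \<longleftrightarrow> \<not> sat M e \<phi>"
| "sat M e (And \<phi> \<psi>) \<longleftrightarrow> sat M e \<phi> \<and> sat M e \<psi>"
| "sat M e (Ex \<phi>) \<longleftrightarrow> (\<exists>a \<in> carrier M. sat M (case_nat a e) \<phi>)"

definition Th :: "('f, 'r) language \<Rightarrow> ('a, 'f, 'r) vstruct \<Rightarrow> ('f, 'r) fm set" where
  "Th L M = {\<phi>. wf_fm L \<phi> \<and> fv \<phi> = {} \<and> (\<forall>e. sat M e \<phi>)}"

text \<open>Every model of the theory of a valued field is a valued field, so \<open>valued_structure\<close> restricts
  models only by fixing the components \<open>zero\<close> and \<open>one\<close>.\<close>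

definition model_of :: "('f, 'r) language \<Rightarrow> ('a, 'f, 'r) vstruct \<Rightarrow> ('f, 'r) fm set \<Rightarrow> bool" where
  "model_of L M T \<longleftrightarrow> valued_structure L M \<and> (\<forall>\<phi> \<in> T. \<forall>e. sat M e \<phi>)"


section \<open>Definable sets\<close>

definition definable ::
  "('f, 'r) language \<Rightarrow> ('a, 'f, 'r) vstruct \<Rightarrow> 'a set \<Rightarrow> nat \<Rightarrow> (nat \<Rightarrow> 'a) set \<Rightarrow> bool" where
  "definable L M A n X \<longleftrightarrow>
     (\<exists>\<phi> as. wf_fm L \<phi> \<and> set as \<subseteq> A \<and> fv \<phi> \<subseteq> {..<n + length as} \<and>
        X = {x \<in> {..<n} \<rightarrow>\<^sub>E carrier M. sat M ((!) (map x [0..<n] @ as)) \<phi>})"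

text \<open>
  Definability of a unary set over elements \<open>A\<close> of the field and over imaginary elements. The
  imaginaries are given as a set \<open>S\<close> of equivalence classes contained in the field; a formula may
  use representatives of finitely many of them, provided the set it defines does not depend on
  which representatives are taken (the usual translation of formulas with imaginary variables
  into the language of the home sort).
\<close>

definition definable1 ::
  "('f, 'r) language \<Rightarrow> ('a, 'f, 'r) vstruct \<Rightarrow> 'a set \<Rightarrow> 'a set set \<Rightarrow> 'a set \<Rightarrow> bool" where
  "definable1 L M A S X \<longleftrightarrow>
     (\<exists>\<phi> as cs. wf_fm L \<phi> \<and> set as \<subseteq> A \<and> set cs \<subseteq> S \<and> fv \<phi> \<subseteq> {..<1 + length as + length cs} \<and>
        (\<forall>bs. list_all2 (\<in>) bs cs \<longrightarrow>
           X = {x \<in> carrier M. sat M ((!) (x # as @ bs)) \<phi>}))"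


section \<open>The valuation and the sets \<open>RV\<close>\<close>

definition vunits :: "('a, 'f, 'r) vstruct \<Rightarrow> 'a set" where
  "vunits M = {u \<in> valring M. \<exists>v \<in> valring M. u \<otimes>\<^bsub>M\<^esub> v = \<one>\<^bsub>M\<^esub>}"

text \<open>The value group is $K^\times/\mathcal O^\times$, with cosets represented as sets, so that its
  multiplication is \<open><#>\<close>. The value of zero is \<open>{\<zero>}\<close>.\<close>

definition absval :: "('a, 'f, 'r) vstruct \<Rightarrow> 'a \<Rightarrow> 'a set" where
  "absval M x = x <#\<^bsub>M\<^esub> vunits M"

definition value_group :: "('a, 'f, 'r) vstruct \<Rightarrow> 'a set set" where
  "value_group M = absval M ` (carrier M - {\<zero>\<^bsub>M\<^esub>})"

definition vle :: "('a, 'f, 'r) vstruct \<Rightarrow> 'a set \<Rightarrow> 'a set \<Rightarrow> bool" where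
  "vle M \<gamma> \<delta> \<longleftrightarrow> (\<exists>x \<in> \<gamma>. \<exists>y \<in> \<delta>. \<exists>c \<in> valring M. x = c \<otimes>\<^bsub>M\<^esub> y)"

definition vless :: "('a, 'f, 'r) vstruct \<Rightarrow> 'a set \<Rightarrow> 'a set \<Rightarrow> bool" where
  "vless M \<gamma> \<delta> \<longleftrightarrow> vle M \<gamma> \<delta> \<and> \<gamma> \<noteq> \<delta>"

definition nat_absval :: "('a, 'f, 'r) vstruct \<Rightarrow> nat \<Rightarrow> 'a set" where
  "nat_absval M k = absval M ([k] \<cdot>\<^bsub>M\<^esub> \<one>\<^bsub>M\<^esub>)"

definition vball :: "('a, 'f, 'r) vstruct \<Rightarrow> 'a \<Rightarrow> 'a set \<Rightarrow> 'a set" where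
  "vball M a \<gamma> = {x \<in> carrier M. vless M (absval M (x \<ominus>\<^bsub>M\<^esub> a)) \<gamma>}"

definition I_ideal :: "('a, 'f, 'r) vstruct \<Rightarrow> 'a set \<Rightarrow> 'a set" where
  "I_ideal M \<gamma> = {x \<in> carrier M. vless M (absval M x) \<gamma>}"

text \<open>The coset of \<open>x\<close> modulo $1 + I_\gamma$; for \<open>x = \<zero>\<close> this is \<open>{\<zero>}\<close>, the extra element of
  \<open>RV\<close>.\<close>

definition rv :: "('a, 'f, 'r) vstruct \<Rightarrow> 'a set \<Rightarrow> 'a \<Rightarrow> 'a set" where
  "rv M \<gamma> x = x <#\<^bsub>M\<^esub> (\<one>\<^bsub>M\<^esub> <+\<^bsub>M\<^esub> I_ideal M \<gamma>)"

definition RV :: "('a, 'f, 'r) vstruct \<Rightarrow> 'a set \<Rightarrow> 'a set set" where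
  "RV M \<gamma> = rv M \<gamma> ` carrier M"

definition prepares :: "('a, 'f, 'r) vstruct \<Rightarrow> 'a set \<Rightarrow> 'a set \<Rightarrow> 'a set \<Rightarrow> bool" where
  "prepares M \<gamma> C X \<longleftrightarrow>
     (\<forall>x \<in> carrier M. \<forall>x' \<in> carrier M.
        (\<forall>c \<in> C. rv M \<gamma> (x \<ominus>\<^bsub>M\<^esub> c) = rv M \<gamma> (x' \<ominus>\<^bsub>M\<^esub> c)) \<longrightarrow> (x \<in> X \<longleftrightarrow> x' \<in> X))"


section \<open>1-h-minimality\<close>

text \<open>
  An element of $\mathrm{RV}_\gamma$, as an element of an imaginary sort defined without
  parameters, is a pair of a coset \<open>\<xi>\<close> and the value \<open>\<gamma>\<close>, which is why \<open>\<gamma>\<close> accompanies the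
  elements of \<open>A'\<close> below. For \<open>RV\<close> at the value of an integer the value is itself definable
  without parameters.
\<close>

definition h_min_condition :: "('f, 'r) language \<Rightarrow> ('a, 'f, 'r) vstruct \<Rightarrow> bool" where
  "h_min_condition L M \<longleftrightarrow>
     (\<forall>(r::nat) \<gamma> A A' X.
        r \<ge> 1 \<and> \<gamma> \<in> value_group M \<and> vle M \<gamma> (absval M \<one>\<^bsub>M\<^esub>) \<and>
        A \<subseteq> carrier M \<and> A' \<subseteq> RV M \<gamma> \<and> finite A' \<and> card A' \<le> 1 \<and>
        definable1 L M A (RV M (nat_absval M r) \<union> (\<Union>\<xi> \<in> A'. {\<gamma>, \<xi>})) X \<longrightarrow>
        (\<exists>(m::nat) C. m \<ge> 1 \<and> C \<subseteq> carrier M \<and> finite C \<and> definable1 L M A {} C \<and>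
           prepares M (nat_absval M m <#>\<^bsub>M\<^esub> \<gamma>) C X))"

text \<open>
  HOL cannot quantify over models on all types, so models are taken with carrier a subset of the
  type below. It has at least $2^\kappa$ elements, where $\kappa$ is the number of
  formulas with parameters from \<open>K\<close>; in particular it contains copies of \<open>K\<close>, of its
  ultrapowers indexed by finite sets of such formulas, and of a model of \<open>Th L K\<close> of
  cardinality $|\mathcal L| + \aleph_0$. This loses nothing: a counterexample to
  \<open>h_min_condition\<close> in any model involves finitely many parameters (the condition for \<open>A\<close>
  follows from the one for the finite part of \<open>A\<close> that occurs in the definition of \<open>X\<close>), so by
  Loewenheim-Skolem it is found in an elementary submodel of cardinality at most
  $|\mathcal L| + \aleph_0$.
\<close>

type_synonym ('f, 'r, 'k) model_univ = "(('f, 'r) fm \<times> 'k list) set \<Rightarrow> 'k"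

definition one_h_minimal :: "('f, 'r) language \<Rightarrow> ('k, 'f, 'r) vstruct \<Rightarrow> bool" where
  "one_h_minimal L K \<longleftrightarrow> nontrivially_valued K \<and>
     (\<forall>K' :: (('f, 'r, 'k) model_univ, 'f, 'r) vstruct.
        model_of L K' (Th L K) \<longrightarrow> h_min_condition L K')"


section \<open>Borel sets\<close>

definition valuation_topology :: "('a, 'f, 'r) vstruct \<Rightarrow> 'a topology" where
  "valuation_topology M =
     topology_generated_by {vball M a \<gamma> |a \<gamma>. a \<in> carrier M \<and> \<gamma> \<in> value_group M}"

definition power_topology :: "('a, 'f, 'r) vstruct \<Rightarrow> nat \<Rightarrow> (nat \<Rightarrow> 'a) topology" where
  "power_topology M n = product_topology (\<lambda>_. valuation_topology M) {..<n}"

definition borel_sets :: "'b topology \<Rightarrow> 'b set set" where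
  "borel_sets T = sigma_sets (topspace T) {U. openin T U}"

end

theory Submission
  imports Defs
begin

text \<open>
  The proof is an induction on dimension. Let \<open>X\<close> be a definable subset of \<open>K\<^sup>n\<close> whose fibres over
  the coordinates in a set \<open>I\<close> are finite; for \<open>I = {..<n}\<close> this is every definable set, for
  \<open>I = {}\<close> every finite one. Let \<open>D\<close> be the set of base points in \<open>K\<^sup>I\<close> over which the closure of
  \<open>X\<close> has a point outside \<open>X\<close>. Then \<open>X\<close> is the union of its closure without the part over \<open>cl D\<close>,
  which is Borel, and of its own part over \<open>cl D\<close>. If \<open>D\<close> has empty interior, then so has \<open>cl D\<close>, and
  \<open>cl D\<close> is a finite union of definable sets each of which has finite fibres in the direction of
  some coordinate \<open>j \<in> I\<close>. The part of \<open>X\<close> over such a piece has finite fibres over the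
  coordinates in \<open>I - {j}\<close>, and the induction applies (\<open>borel_finite_fibres\<close>).

  That \<open>D\<close> has empty interior (\<open>boundary_small\<close>) rests on a selection principle: if a
  definable family of subsets of \<open>K\<close> is indexed by balls of a fixed radius, or by values, and
  its union is infinite, then some member is infinite, and even contains a ball
  (\<open>family_ball\<close>, \<open>selects_near\<close>, \<open>selects_units\<close>). Reading "contains a ball" as "is infinite"
  one coordinate after the other gives a largeness notion \<open>big\<close> for subsets of \<open>K\<^sup>I\<close> to which the
  principle extends by a trivial induction, and which is equivalent to having nonempty interior
  (\<open>big_box\<close> is the direction that is not obvious): the radius of a ball and then the ball itself
  can be chosen uniformly. If now \<open>D\<close> were large, one could choose uniformly, over an open box of base points, one ball which avoids the
  fibre of \<open>X\<close> but contains a point of the closure; this is absurd.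

  The selection principle is where 1-h-minimality enters, by compactness. If the union \<open>V\<close> of the
  family is infinite, then in a suitable ultrapower of \<open>K\<close> it has a point \<open>v\<close> outside all finite
  sets definable over \<open>K\<close>. This point lies in the member \<open>V\<^sub>\<xi>\<close> for some \<open>\<xi> \<in> RV\<^sub>\<lambda>\<close>
  of the ultrapower. By 1-h-minimality \<open>V\<^sub>\<xi>\<close> is prepared by a finite set \<open>C\<close> definable over \<open>K\<close>
  alone, not over \<open>\<xi>\<close>. So \<open>v \<notin> C\<close>, and therefore a ball around \<open>v\<close> is contained in \<open>V\<^sub>\<xi>\<close>. By
  the theorem of Los some member of the original family contains a ball.
\<close>

section \<open>Valued fields\<close>

definition vmax :: "('a, 'f, 'r) vstruct \<Rightarrow> 'a set" where
  "vmax M = valring M - vunits M"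

text \<open>
  The ball around \<open>y\<close> with radius the value of \<open>d\<close>. Balls are closed and their radius is given by
  a field element, so that the relation is existential over \<open>valring\<close> and no cosets occur in
  formulas. If the valuation is nontrivial, these balls for \<open>d \<noteq> \<zero>\<close> are a base of its topology.
\<close>

definition near :: "('a, 'f, 'r) vstruct \<Rightarrow> 'a \<Rightarrow> 'a \<Rightarrow> 'a \<Rightarrow> bool" where
  "near M d x y \<longleftrightarrow> (\<exists>c \<in> valring M. x = y \<oplus>\<^bsub>M\<^esub> d \<otimes>\<^bsub>M\<^esub> c)"

locale vfield =
  fixes M :: "('a, 'f, 'r) vstruct" (structure)
  assumes vf: "valued_field M"

sublocale vfield \<subseteq> field M
  using vf by (simp add: valued_field_def)

context vfield
begin

lemma subring_valring: "subring (valring M) M"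
  using vf by (simp add: valued_field_def)

lemma valring_closed [simp]: "c \<in> valring M \<Longrightarrow> c \<in> carrier M"
  using subringE(1)[OF subring_valring] by auto

lemma valring_one [simp]: "\<one> \<in> valring M"
  and valring_zero [simp]: "\<zero> \<in> valring M"
  and valring_add [simp]: "a \<in> valring M \<Longrightarrow> b \<in> valring M \<Longrightarrow> a \<oplus> b \<in> valring M"
  and valring_mult [simp]: "a \<in> valring M \<Longrightarrow> b \<in> valring M \<Longrightarrow> a \<otimes> b \<in> valring M"
  and valring_neg [simp]: "a \<in> valring M \<Longrightarrow> \<ominus> a \<in> valring M"
  using subringE[OF subring_valring] by auto

lemma valring_total: "x \<in> carrier M \<Longrightarrow> x \<noteq> \<zero> \<Longrightarrow> x \<in> valring M \<or> inv x \<in> valring M"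
  using vf by (simp add: valued_field_def)

lemma inv_simps [simp]:
  assumes "x \<in> carrier M" "x \<noteq> \<zero>"
  shows "inv x \<in> carrier M" "x \<otimes> inv x = \<one>" "inv x \<otimes> x = \<one>" "inv x \<noteq> \<zero>"
proof -
  have u: "x \<in> Units M" using assms field_Units by simp
  then show 1: "inv x \<in> carrier M" "x \<otimes> inv x = \<one>" "inv x \<otimes> x = \<one>" by auto
  show "inv x \<noteq> \<zero>" using 1(2) assms by (metis r_null zero_not_one)
qed

lemma inv_inv [simp]: "x \<in> carrier M \<Longrightarrow> x \<noteq> \<zero> \<Longrightarrow> inv (inv x) = x"
  using comm_inv_char[of "inv x" x] by simp

lemma mult_nonzero [simp]: "x \<in> carrier M \<Longrightarrow> y \<in> carrier M \<Longrightarrow> x \<otimes> y = \<zero> \<longleftrightarrow> x = \<zero> \<or> y = \<zero>"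
  using integral_iff by blast

lemma div_exists:
  assumes "x \<in> carrier M" "d \<in> carrier M" "d \<noteq> \<zero>"
  obtains q where "q \<in> carrier M" "x = q \<otimes> d"
proof
  show "x \<otimes> inv d \<in> carrier M" using assms by simp
  show "x = (x \<otimes> inv d) \<otimes> d" using assms by (simp add: m_assoc)
qed

lemma div_total:
  assumes "x \<in> carrier M" "d \<in> carrier M"
  shows "(\<exists>c \<in> valring M. x = c \<otimes> d) \<or> (\<exists>c \<in> valring M. d = c \<otimes> x)"
proof (cases "d = \<zero>")
  case True
  then show ?thesis using assms by (intro disjI2 bexI[of _ \<zero>]) auto
next
  case False
  then obtain q where q: "q \<in> carrier M" "x = q \<otimes> d" using div_exists assms by blast
  show ?thesis
  proof (cases "q \<in> valring M")
    case False
    then have "q \<noteq> \<zero>" by auto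
    then have "inv q \<in> valring M" using False q valring_total by blast
    moreover have "d = inv q \<otimes> x" using q assms \<open>q \<noteq> \<zero>\<close> by (simp add: m_assoc[symmetric])
    ultimately show ?thesis by blast
  qed (use q in blast)
qed

lemma vunits_iff: "u \<in> vunits M \<longleftrightarrow> u \<in> valring M \<and> u \<noteq> \<zero> \<and> inv u \<in> valring M"
proof
  assume "u \<in> vunits M"
  then obtain v where v: "u \<in> valring M" "v \<in> valring M" "u \<otimes> v = \<one>"
    unfolding vunits_def by auto
  then have "u \<noteq> \<zero>" by (metis l_null valring_closed zero_not_one)
  moreover have "inv u = v" using v by (simp add: comm_inv_char)
  ultimately show "u \<in> valring M \<and> u \<noteq> \<zero> \<and> inv u \<in> valring M" using v by simp
next
  assume "u \<in> valring M \<and> u \<noteq> \<zero> \<and> inv u \<in> valring M"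
  then show "u \<in> vunits M" unfolding vunits_def by (auto intro!: bexI[of _ "inv u"])
qed

lemma vunits_mult: "u \<in> vunits M \<Longrightarrow> v \<in> vunits M \<Longrightarrow> u \<otimes> v \<in> vunits M"
proof -
  assume "u \<in> vunits M" "v \<in> vunits M"
  then obtain u' v' where "u \<in> valring M" "v \<in> valring M" "u' \<in> valring M" "v' \<in> valring M"
      "u \<otimes> u' = \<one>" "v \<otimes> v' = \<one>" unfolding vunits_def by auto
  moreover from this have "(u \<otimes> v) \<otimes> (u' \<otimes> v') = (u \<otimes> u') \<otimes> (v \<otimes> v')"
    using m_ac by simp
  ultimately show ?thesis unfolding vunits_def by (auto intro!: bexI[of _ "u' \<otimes> v'"])
qed

lemma vunits_inv: "u \<in> vunits M \<Longrightarrow> inv u \<in> vunits M"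
  by (auto simp: vunits_iff)

lemma one_vunits [simp]: "\<one> \<in> vunits M"
  by (auto simp: vunits_iff)

lemma vunits_valring: "u \<in> vunits M \<Longrightarrow> u \<in> valring M"
  by (auto simp: vunits_iff)

lemma vmax_valring: "c \<in> vmax M \<Longrightarrow> c \<in> valring M"
  by (simp add: vmax_def)

lemma zero_vmax [simp]: "\<zero> \<in> vmax M"
  by (simp add: vmax_def vunits_iff)

lemma vmax_mult: assumes "c \<in> vmax M" "y \<in> valring M" shows "c \<otimes> y \<in> vmax M"
proof -
  have c: "c \<in> valring M" "c \<notin> vunits M" using assms by (auto simp: vmax_def)
  have "c \<otimes> y \<notin> vunits M"
  proof
    assume "c \<otimes> y \<in> vunits M"
    then obtain v where "v \<in> valring M" "c \<otimes> y \<otimes> v = \<one>" unfolding vunits_def by auto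
    then have "y \<otimes> v \<in> valring M" "c \<otimes> (y \<otimes> v) = \<one>" using assms c by (auto simp: m_assoc)
    then show False using c unfolding vunits_def by auto
  qed
  then show ?thesis using c assms by (simp add: vmax_def)
qed

text \<open>
  One of the two summands divides the other in the valuation ring.
\<close>

lemma vmax_add: assumes c: "c \<in> vmax M" and d: "d \<in> vmax M" shows "c \<oplus> d \<in> vmax M"
proof -
  have *: "c \<oplus> d \<in> vmax M" if c: "c \<in> vmax M" and d: "d \<in> vmax M" and "q \<in> valring M" "c = q \<otimes> d" for c d q
  proof -
    have "c \<oplus> d = d \<otimes> (q \<oplus> \<one>)" using that vmax_valring[OF d] by (simp add: r_distr m_comm)
    then show ?thesis using vmax_mult[OF d, of "q \<oplus> \<one>"] that by simp
  qed
  have cd: "c \<in> carrier M" "d \<in> carrier M" using c d vmax_valring valring_closed by blast+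
  show ?thesis using div_total[OF cd] *[OF c d] *[OF d c] a_comm[OF cd] by metis
qed

lemma vmax_neg: "c \<in> vmax M \<Longrightarrow> \<ominus> c \<in> vmax M"
  using vmax_mult[of c "\<ominus> \<one>"] vmax_valring[of c] by (simp add: r_minus)

text \<open>
  The valuation ring is local: otherwise \<open>1 = (1 + c) - c\<close> would be a sum of non-units.
\<close>

lemma one_plus_vmax: assumes "c \<in> vmax M" shows "\<one> \<oplus> c \<in> vunits M"
proof (rule ccontr)
  have c: "c \<in> valring M" using assms vmax_valring by blast
  assume "\<one> \<oplus> c \<notin> vunits M"
  then have "\<one> \<oplus> c \<in> vmax M" using c by (simp add: vmax_def)
  then have "(\<one> \<oplus> c) \<oplus> \<ominus> c \<in> vmax M" using vmax_add vmax_neg assms by blast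
  moreover have "(\<one> \<oplus> c) \<oplus> \<ominus> c = \<one>" using c by (simp add: a_assoc r_neg)
  ultimately show False by (simp add: vmax_def)
qed

lemma absval_alt: "absval M x = {x \<otimes> u |u. u \<in> vunits M}"
  unfolding absval_def l_coset_def by auto

lemma mem_absval: "x \<in> carrier M \<Longrightarrow> x \<in> absval M x"
  unfolding absval_alt by (metis (mono_tags, lifting) mem_Collect_eq one_vunits r_one)

lemma absval_mult:
  assumes "x \<in> carrier M" "y \<in> carrier M"
  shows "absval M x <#>\<^bsub>M\<^esub> absval M y = absval M (x \<otimes> y)"
proof -
  show ?thesis
  proof
    show "absval M x <#>\<^bsub>M\<^esub> absval M y \<subseteq> absval M (x \<otimes> y)"
    proof
      fix z assume "z \<in> absval M x <#>\<^bsub>M\<^esub> absval M y"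
      then obtain u v where uv: "u \<in> vunits M" "v \<in> vunits M" "z = x \<otimes> u \<otimes> (y \<otimes> v)"
        unfolding absval_alt set_mult_def by blast
      then have "z = x \<otimes> y \<otimes> (u \<otimes> v)" using assms vunits_valring by (simp add: m_ac)
      then show "z \<in> absval M (x \<otimes> y)" unfolding absval_alt using vunits_mult uv by blast
    qed
    show "absval M (x \<otimes> y) \<subseteq> absval M x <#>\<^bsub>M\<^esub> absval M y"
    proof
      fix z assume "z \<in> absval M (x \<otimes> y)"
      then obtain u where u: "u \<in> vunits M" "z = x \<otimes> y \<otimes> u" unfolding absval_alt by blast
      then have "z = (x \<otimes> u) \<otimes> y" using assms vunits_valring by (simp add: m_ac)
      moreover have "x \<otimes> u \<in> absval M x" unfolding absval_alt using u by blast
      ultimately show "z \<in> absval M x <#>\<^bsub>M\<^esub> absval M y"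
        unfolding set_mult_def using mem_absval assms by blast
    qed
  qed
qed

lemma vle_absval:
  assumes "x \<in> carrier M" "g \<in> carrier M"
  shows "vle M (absval M x) (absval M g) \<longleftrightarrow> (\<exists>c \<in> valring M. x = c \<otimes> g)"
proof
  assume "vle M (absval M x) (absval M g)"
  then obtain u v c where u: "u \<in> vunits M" and v: "v \<in> vunits M" and c: "c \<in> valring M"
    and eq: "x \<otimes> u = c \<otimes> (g \<otimes> v)"
    unfolding vle_def absval_alt by auto
  have uv: "u \<in> carrier M" "u \<noteq> \<zero>" "inv u \<in> valring M" "v \<in> valring M" using u v by (auto simp: vunits_iff)
  have "x = (x \<otimes> u) \<otimes> inv u" using assms uv by (simp add: m_assoc)
  also have "\<dots> = (c \<otimes> v \<otimes> inv u) \<otimes> g" unfolding eq using assms uv c by (simp add: m_ac)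
  finally have "x = (c \<otimes> v \<otimes> inv u) \<otimes> g" .
  moreover have "c \<otimes> v \<otimes> inv u \<in> valring M" using c uv by simp
  ultimately show "\<exists>c \<in> valring M. x = c \<otimes> g" by blast
next
  assume "\<exists>c \<in> valring M. x = c \<otimes> g"
  then obtain c where "c \<in> valring M" "x = c \<otimes> g" by blast
  then show "vle M (absval M x) (absval M g)"
    unfolding vle_def using assms mem_absval by blast
qed

lemma absval_eq:
  assumes "x \<in> carrier M" "g \<in> carrier M"
  shows "absval M x = absval M g \<longleftrightarrow> (\<exists>u \<in> vunits M. x = u \<otimes> g)"
proof
  assume "absval M x = absval M g"
  moreover have "x \<in> absval M x" using assms mem_absval by blast
  ultimately have "x \<in> absval M g" by simp
  then obtain u where "u \<in> vunits M" "x = g \<otimes> u" unfolding absval_alt by blast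
  moreover from this have "x = u \<otimes> g" using assms m_comm vunits_valring by simp
  ultimately show "\<exists>u \<in> vunits M. x = u \<otimes> g" by blast
next
  assume "\<exists>u \<in> vunits M. x = u \<otimes> g"
  then obtain u where u: "u \<in> vunits M" "x = u \<otimes> g" by blast
  have 1: "x \<otimes> v = g \<otimes> (u \<otimes> v)" if "v \<in> vunits M" for v
    using that u assms vunits_valring by (simp add: m_ac)
  have 2: "g \<otimes> v = x \<otimes> (inv u \<otimes> v)" if "v \<in> vunits M" for v
  proof -
    have i: "inv u \<in> carrier M" "u \<otimes> inv u = \<one>" using u vunits_iff by auto
    have c: "u \<in> carrier M" "v \<in> carrier M" using u that vunits_valring by auto
    have "x \<otimes> (inv u \<otimes> v) = (u \<otimes> inv u) \<otimes> (g \<otimes> v)" using i c assms u by (simp add: m_ac)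
    then show ?thesis using i c assms by simp
  qed
  show "absval M x = absval M g"
  proof
    show "absval M x \<subseteq> absval M g" unfolding absval_alt
      using 1 vunits_mult[OF u(1)] by blast
    show "absval M g \<subseteq> absval M x" unfolding absval_alt
      using 2 vunits_mult[OF vunits_inv[OF u(1)]] by blast
  qed
qed

lemma vless_absval:
  assumes "x \<in> carrier M" "g \<in> carrier M" "g \<noteq> \<zero>"
  shows "vless M (absval M x) (absval M g) \<longleftrightarrow> (\<exists>c \<in> vmax M. x = c \<otimes> g)"
proof -
  have "c = c'" if "c \<in> valring M" "c' \<in> valring M" "c \<otimes> g = c' \<otimes> g" for c c'
    using that assms m_rcancel by auto
  then show ?thesis
    unfolding vless_def vle_absval[OF assms(1,2)] absval_eq[OF assms(1,2)] vmax_def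
    using vunits_valring by blast
qed

lemma I_ideal_absval:
  assumes "g \<in> carrier M" "g \<noteq> \<zero>"
  shows "I_ideal M (absval M g) = {c \<otimes> g |c. c \<in> vmax M}"
  unfolding I_ideal_def using vless_absval[OF _ assms] assms vmax_valring by auto

lemma rv_absval:
  assumes "g \<in> carrier M" "g \<noteq> \<zero>"
  shows "rv M (absval M g) x = {x \<otimes> (\<one> \<oplus> c \<otimes> g) |c. c \<in> vmax M}"
  unfolding rv_def I_ideal_absval[OF assms] l_coset_def a_l_coset_def by auto

text \<open>
  The set \<open>1 + I\<^sub>g\<close> is a multiplicative group when \<open>g\<close> is integral, so multiplying \<open>w\<close> by one of its
  elements does not change the coset of \<open>w\<close>.
\<close>

lemma rv_absorb:
  assumes g: "g \<in> valring M" "g \<noteq> \<zero>" and w: "w \<in> carrier M" and c: "c \<in> vmax M"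
  shows "rv M (absval M g) (w \<otimes> (\<one> \<oplus> c \<otimes> g)) = rv M (absval M g) w" (is "?L = ?R")
proof -
  have gc: "g \<in> carrier M" using g by simp
  have cc: "c \<in> valring M" using c vmax_valring by blast
  define a where "a = \<one> \<oplus> c \<otimes> g"
  have cg: "c \<otimes> g \<in> vmax M" using vmax_mult c g by blast
  then have au: "a \<in> vunits M" unfolding a_def by (rule one_plus_vmax)
  then have a: "a \<in> valring M" "a \<noteq> \<zero>" "inv a \<in> valring M" by (auto simp: vunits_iff)
  show ?thesis
  proof
    show "?L \<subseteq> ?R"
    proof
      fix z assume "z \<in> ?L"
      then obtain e where e: "e \<in> vmax M" "z = w \<otimes> a \<otimes> (\<one> \<oplus> e \<otimes> g)"
        unfolding rv_absval[OF gc g(2)] a_def by auto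
      have ec: "e \<in> valring M" using e vmax_valring by blast
      have "a \<otimes> (\<one> \<oplus> e \<otimes> g) = \<one> \<oplus> (c \<oplus> e \<otimes> a) \<otimes> g"
        unfolding a_def using valring_closed[OF cc] valring_closed[OF ec] gc by algebra
      then have "z = w \<otimes> (\<one> \<oplus> (c \<oplus> e \<otimes> a) \<otimes> g)" using e w a ec gc by (simp add: m_assoc)
      moreover have "c \<oplus> e \<otimes> a \<in> vmax M" using vmax_add vmax_mult c e a by blast
      ultimately show "z \<in> ?R" unfolding rv_absval[OF gc g(2)] by blast
    qed
    show "?R \<subseteq> ?L"
    proof
      fix z assume "z \<in> ?R"
      then obtain e where e: "e \<in> vmax M" "z = w \<otimes> (\<one> \<oplus> e \<otimes> g)"
        unfolding rv_absval[OF gc g(2)] by auto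
      have ec: "e \<in> valring M" using e vmax_valring by blast
      define f where "f = (e \<ominus> c) \<otimes> inv a"
      have f: "f \<in> vmax M" unfolding f_def minus_eq using vmax_add vmax_mult vmax_neg c e a by blast
      have fc: "f \<in> valring M" using f vmax_valring by blast
      have fa: "f \<otimes> a = e \<ominus> c" unfolding f_def using a ec cc by (simp add: m_assoc)
      have "a \<otimes> (\<one> \<oplus> f \<otimes> g) = a \<oplus> (f \<otimes> a) \<otimes> g" using fc a gc by (simp add: r_distr m_ac)
      also have "\<dots> = a \<oplus> (e \<ominus> c) \<otimes> g" unfolding fa ..
      also have "\<dots> = \<one> \<oplus> e \<otimes> g" unfolding a_def using valring_closed[OF cc] valring_closed[OF ec] gc by algebra
      finally have "z = w \<otimes> a \<otimes> (\<one> \<oplus> f \<otimes> g)" using e w a fc gc by (simp add: m_assoc)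
      then show "z \<in> ?L" unfolding rv_absval[OF gc g(2)] a_def using f by blast
    qed
  qed
qed

lemma near_closed: "near M d x y \<Longrightarrow> d \<in> carrier M \<Longrightarrow> y \<in> carrier M \<Longrightarrow> x \<in> carrier M"
  unfolding near_def by auto

lemma near_refl [simp]: "d \<in> carrier M \<Longrightarrow> y \<in> carrier M \<Longrightarrow> near M d y y"
  unfolding near_def by (auto intro!: bexI[of _ \<zero>])

lemma near_sym: assumes "d \<in> carrier M" "y \<in> carrier M" "near M d x y" shows "near M d y x"
proof -
  obtain c where c: "c \<in> valring M" "x = y \<oplus> d \<otimes> c" using assms unfolding near_def by auto
  have "y = x \<oplus> d \<otimes> \<ominus> c" unfolding c(2) using assms valring_closed[OF c(1)] by algebra
  then show ?thesis unfolding near_def using c by (intro bexI[of _ "\<ominus> c"]) auto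
qed

lemma near_trans: assumes "d \<in> carrier M" "z \<in> carrier M" "near M d x y" "near M d y z"
  shows "near M d x z"
proof -
  obtain c where c: "c \<in> valring M" "x = y \<oplus> d \<otimes> c" using assms unfolding near_def by auto
  obtain e where e: "e \<in> valring M" "y = z \<oplus> d \<otimes> e" using assms unfolding near_def by auto
  have "x = z \<oplus> d \<otimes> (e \<oplus> c)" unfolding c(2) e(2) using assms valring_closed[OF c(1)] valring_closed[OF e(1)]
    by algebra
  then show ?thesis unfolding near_def using c e by (intro bexI[of _ "e \<oplus> c"]) auto
qed

lemma near_mono: assumes "near M d x y" "d = c \<otimes> d'" "c \<in> valring M" "d' \<in> carrier M"
  shows "near M d' x y"
proof -
  obtain e where e: "e \<in> valring M" "x = y \<oplus> d \<otimes> e" using assms unfolding near_def by auto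
  have "d \<otimes> e = d' \<otimes> (c \<otimes> e)" unfolding assms(2) using assms e by (simp add: m_ac)
  then show ?thesis unfolding near_def e(2) using assms(3) e(1) by (intro bexI[of _ "c \<otimes> e"]) auto
qed

lemma near_min2:
  assumes "d \<in> carrier M" "d \<noteq> \<zero>" "d' \<in> carrier M" "d' \<noteq> \<zero>"
  obtains e where "e \<in> carrier M" "e \<noteq> \<zero>"
    "\<And>x y. near M e x y \<Longrightarrow> near M d x y" "\<And>x y. near M e x y \<Longrightarrow> near M d' x y"
proof (cases "\<exists>c \<in> valring M. d = c \<otimes> d'")
  case True
  then show ?thesis using that[of d] near_mono assms by blast
next
  case False
  then obtain c where "c \<in> valring M" "d' = c \<otimes> d" using div_total[OF assms(1,3)] by blast
  then show ?thesis using that[of d'] near_mono assms by blast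
qed

lemma near_min:
  assumes "finite A" "\<And>a. a \<in> A \<Longrightarrow> D a \<in> carrier M \<and> D a \<noteq> \<zero>"
  shows "\<exists>e. e \<in> carrier M \<and> e \<noteq> \<zero> \<and> (\<forall>a \<in> A. \<forall>x y. near M e x y \<longrightarrow> near M (D a) x y)"
  using assms
proof (induction A)
  case empty
  then show ?case by (intro exI[of _ \<one>]) auto
next
  case (insert a A)
  then obtain e where e: "e \<in> carrier M" "e \<noteq> \<zero>" "\<forall>a \<in> A. \<forall>x y. near M e x y \<longrightarrow> near M (D a) x y" by auto
  obtain e' where "e' \<in> carrier M" "e' \<noteq> \<zero>"
    "\<And>x y. near M e' x y \<Longrightarrow> near M e x y" "\<And>x y. near M e' x y \<Longrightarrow> near M (D a) x y"
    using near_min2[OF e(1,2), of "D a"] insert.prems by auto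
  then show ?case using e by (intro exI[of _ e']) auto
qed

lemma nonunit_exists:
  assumes "nontrivially_valued M"
  obtains p where "p \<in> vmax M" "p \<noteq> \<zero>"
proof -
  obtain x where x: "x \<in> carrier M" "x \<notin> valring M"
    using assms subringE(1)[OF subring_valring] unfolding nontrivially_valued_def by blast
  then have x0: "x \<noteq> \<zero>" by auto
  then have i: "inv x \<in> valring M" using x valring_total by blast
  then have "inv x \<in> vmax M" using i x x0 by (simp add: vmax_def vunits_iff)
  then show ?thesis using that x x0 inv_simps by blast
qed

text \<open>
  The topology is Hausdorff because the valuation is nontrivial: a radius strictly smaller than
  the value of \<open>x - y\<close> separates the two points.
\<close>

lemma near_separated:
  assumes p: "p \<in> vmax M" "p \<noteq> \<zero>" and xy: "x \<in> carrier M" "y \<in> carrier M" "x \<noteq> y"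
  shows "\<exists>d. d \<in> carrier M \<and> d \<noteq> \<zero> \<and> \<not> near M d x y"
proof (intro exI conjI)
  have pc: "p \<in> valring M" using p vmax_valring by blast
  have n: "x \<ominus> y \<noteq> \<zero>" using xy by (simp add: r_right_minus_eq)
  show "(x \<ominus> y) \<otimes> p \<in> carrier M" "(x \<ominus> y) \<otimes> p \<noteq> \<zero>" using xy pc p n by auto
  show "\<not> near M ((x \<ominus> y) \<otimes> p) x y"
  proof
    assume "near M ((x \<ominus> y) \<otimes> p) x y"
    then obtain c where c: "c \<in> valring M" "x = y \<oplus> (x \<ominus> y) \<otimes> p \<otimes> c" unfolding near_def by auto
    have "(x \<ominus> y) \<otimes> \<one> = (y \<oplus> (x \<ominus> y) \<otimes> p \<otimes> c) \<ominus> y" using c(2) xy by simp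
    also have "\<dots> = (x \<ominus> y) \<otimes> (p \<otimes> c)" using xy valring_closed[OF pc] valring_closed[OF c(1)] by algebra
    finally have "(x \<ominus> y) \<otimes> \<one> = (x \<ominus> y) \<otimes> (p \<otimes> c)" .
    then have "\<one> = p \<otimes> c"
      using m_lcancel[OF n, of \<one> "p \<otimes> c"] xy valring_closed[OF pc] valring_closed[OF c(1)] by blast
    moreover have "p \<otimes> c \<in> vmax M" using vmax_mult p c by blast
    ultimately show False by (metis DiffD2 one_vunits vmax_def)
  qed
qed

lemma a_left_cancel:
  "a \<in> carrier M \<Longrightarrow> x \<in> carrier M \<Longrightarrow> y \<in> carrier M \<Longrightarrow> a \<oplus> x = a \<oplus> y \<longleftrightarrow> x = y"
  using add.right_cancel[of x a y] a_comm[of a x] a_comm[of a y] by simp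

lemma add_pow_plus: "x \<in> carrier M \<Longrightarrow> [(m + n :: nat)] \<cdot> x = [m] \<cdot> x \<oplus> [n] \<cdot> x"
  by (rule add.nat_pow_mult[symmetric])

lemma nat_valring: "[(n :: nat)] \<cdot> \<one> \<in> valring M"
proof (induction n)
  case 0
  show ?case by (metis add.nat_pow_0 valring_zero)
next
  case (Suc n)
  then show ?case by (metis add.nat_pow_Suc valring_add valring_one)
qed

text \<open>
  The multiples of \<open>1\<close> lie in the valuation ring and are distinct in characteristic zero.
\<close>

lemma infinite_ball:
  assumes c0: "char_zero M" and d: "d \<in> carrier M" "d \<noteq> \<zero>" "y \<in> carrier M"
  shows "infinite {x. near M d x y}"
proof -
  note v = nat_valring and vc = valring_closed[OF nat_valring]
  have "inj (\<lambda>n::nat. y \<oplus> d \<otimes> ([n] \<cdot> \<one>))"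
  proof (rule injI)
    fix a b :: nat
    assume "y \<oplus> d \<otimes> ([a] \<cdot> \<one>) = y \<oplus> d \<otimes> ([b] \<cdot> \<one>)"
    then have "d \<otimes> ([a] \<cdot> \<one>) = d \<otimes> ([b] \<cdot> \<one>)"
      using a_left_cancel[of y] d vc m_closed by blast
    then have *: "[a] \<cdot> \<one> = [b] \<cdot> \<one>" using d m_lcancel vc by blast
    have "a = b" if "a \<le> b" "[a] \<cdot> \<one> = [b] \<cdot> \<one>" for a b :: nat
    proof -
      have "[a] \<cdot> \<one> \<oplus> [(b - a)] \<cdot> \<one> = [a] \<cdot> \<one> \<oplus> \<zero>" 
        using add_pow_plus[of \<one> a "b - a"] that one_closed r_zero vc by (metis le_add_diff_inverse)
      then have "[(b - a)] \<cdot> \<one> = \<zero>" using a_left_cancel vc zero_closed by blast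
      then show "a = b" using c0 that unfolding char_zero_def
        by (metis One_nat_def diff_is_0_eq le_antisym not_less_eq_eq zero_less_iff_neq_zero less_eq_Suc_le)
    qed
    then show "a = b" using * by (metis nat_le_linear)
  qed
  then have "infinite (range (\<lambda>n::nat. y \<oplus> d \<otimes> ([n] \<cdot> \<one>)))" by (rule range_inj_infinite)
  moreover have "range (\<lambda>n::nat. y \<oplus> d \<otimes> ([n] \<cdot> \<one>)) \<subseteq> {x. near M d x y}"
    using v unfolding near_def by auto
  ultimately show ?thesis using infinite_super by blast
qed

end

section \<open>Renaming the variables of a formula\<close>

primrec ren_tm :: "'f tm \<Rightarrow> (nat \<Rightarrow> nat) \<Rightarrow> 'f tm" where
  "ren_tm (Var i) \<rho> = Var (\<rho> i)"
| "ren_tm (Plus s t) \<rho> = Plus (ren_tm s \<rho>) (ren_tm t \<rho>)"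
| "ren_tm (Times s t) \<rho> = Times (ren_tm s \<rho>) (ren_tm t \<rho>)"
| "ren_tm (Fn f ts) \<rho> = Fn f (map (\<lambda>t. ren_tm t \<rho>) ts)"

primrec ren :: "('f, 'r) fm \<Rightarrow> (nat \<Rightarrow> nat) \<Rightarrow> ('f, 'r) fm" where
  "ren (Eq s t) \<rho> = Eq (ren_tm s \<rho>) (ren_tm t \<rho>)"
| "ren (InO t) \<rho> = InO (ren_tm t \<rho>)"
| "ren (Rel R ts) \<rho> = Rel R (map (\<lambda>t. ren_tm t \<rho>) ts)"
| "ren (Neg \<phi>) \<rho> = Neg (ren \<phi> \<rho>)"
| "ren (And \<phi> \<psi>) \<rho> = And (ren \<phi> \<rho>) (ren \<psi> \<rho>)"
| "ren (Ex \<phi>) \<rho> = Ex (ren \<phi> (case_nat 0 (\<lambda>i. Suc (\<rho> i))))"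

lemma eval_ren_tm: "eval_tm M e (ren_tm t \<rho>) = eval_tm M (\<lambda>i. e (\<rho> i)) t"
  by (induction t) (auto cong: map_cong)

lemma sat_ren: "sat M e (ren \<phi> \<rho>) \<longleftrightarrow> sat M (\<lambda>i. e (\<rho> i)) \<phi>"
proof (induction \<phi> arbitrary: e \<rho>)
  case (Ex \<phi>)
  have "(\<lambda>i. case_nat a e (case_nat 0 (\<lambda>i. Suc (\<rho> i)) i)) = case_nat a (\<lambda>i. e (\<rho> i))" for a
    by (auto split: nat.split)
  then show ?case by (simp add: Ex)
qed (auto simp: eval_ren_tm comp_def)

lemma wf_ren_tm: "wf_tm L t \<Longrightarrow> wf_tm L (ren_tm t \<rho>)"
  by (induction t) (auto simp: list_all_iff)

lemma wf_ren: "wf_fm L \<phi> \<Longrightarrow> wf_fm L (ren \<phi> \<rho>)"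
  by (induction \<phi> arbitrary: \<rho>) (auto simp: wf_ren_tm list_all_iff)

lemma fv_ren_tm: "fv_tm (ren_tm t \<rho>) = \<rho> ` fv_tm t"
  by (induction t) auto

lemma fv_ren: "fv (ren \<phi> \<rho>) = \<rho> ` fv \<phi>"
proof (induction \<phi> arbitrary: \<rho>)
  case (Ex \<phi>)
  let ?\<rho> = "case_nat 0 (\<lambda>i. Suc (\<rho> i))"
  have "i \<in> \<rho> ` {i. Suc i \<in> fv \<phi>}" if "Suc i \<in> ?\<rho> ` fv \<phi>" for i
  proof -
    from that obtain j where "j \<in> fv \<phi>" "Suc i = ?\<rho> j" by blast
    then show ?thesis by (cases j) auto
  qed
  moreover have "Suc (\<rho> i) \<in> ?\<rho> ` fv \<phi>" if "Suc i \<in> fv \<phi>" for i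
    using imageI[OF that, of ?\<rho>] by simp
  ultimately have "{i. Suc i \<in> ?\<rho> ` fv \<phi>} = \<rho> ` {i. Suc i \<in> fv \<phi>}" by blast
  then show ?case by (simp add: Ex)
qed (auto simp: fv_ren_tm)

lemma finite_fv_tm: "finite (fv_tm t)"
  by (induction t) auto

lemma finite_fv: "finite (fv \<phi>)"
proof (induction \<phi>)
  case (Ex \<phi>)
  have "{i. Suc i \<in> fv \<phi>} = Suc -` fv \<phi>" by auto
  then show ?case using Ex by (simp add: finite_vimageI)
qed (auto simp: finite_fv_tm)

lemma eval_tm_cong: "(\<And>i. i \<in> fv_tm t \<Longrightarrow> e i = e' i) \<Longrightarrow> eval_tm M e t = eval_tm M e' t"
proof (induction t)
  case (Fn f ts)
  then have "map (eval_tm M e) ts = map (eval_tm M e') ts" by auto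
  then show ?case by (simp only: eval_tm.simps)
qed auto

lemma sat_cong: "(\<And>i. i \<in> fv \<phi> \<Longrightarrow> e i = e' i) \<Longrightarrow> sat M e \<phi> \<longleftrightarrow> sat M e' \<phi>"
proof (induction \<phi> arbitrary: e e')
  case (Eq s t)
  then show ?case using eval_tm_cong[of s e e' M] eval_tm_cong[of t e e' M] by auto
next
  case (InO t)
  then show ?case using eval_tm_cong[of t e e' M] by auto
next
  case (Rel R ts)
  then have "map (eval_tm M e) ts = map (eval_tm M e') ts" by (auto intro!: eval_tm_cong)
  then show ?case by (simp only: sat.simps)
next
  case (Neg \<phi>)
  from Neg.IH[of e e'] Neg.prems show ?case by simp
next
  case (And \<phi> \<psi>)
  from And.IH(1)[of e e'] And.IH(2)[of e e'] And.prems show ?case by simp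
next
  case (Ex \<phi>)
  have "sat M (case_nat a e) \<phi> \<longleftrightarrow> sat M (case_nat a e') \<phi>" for a
    using Ex.prems by (intro Ex.IH) (auto split: nat.split)
  then show ?case by simp
qed

lemma eval_tm_closed:
  assumes L: "valued_structure L M" and e: "\<And>n. e n \<in> carrier M"
  shows "wf_tm L t \<Longrightarrow> eval_tm M e t \<in> carrier M"
proof (induction t)
  case (Plus s t)
  interpret vfield M using L by unfold_locales (simp add: valued_structure_def)
  show ?case using Plus by simp
next
  case (Times s t)
  interpret vfield M using L by unfold_locales (simp add: valued_structure_def)
  show ?case using Times by simp
next
  case (Fn f ts)
  then have "set (map (eval_tm M e) ts) \<subseteq> carrier M" "fun_ar L f = Some (length (map (eval_tm M e) ts))"
    by (auto simp: list_all_iff)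
  then show ?case using L unfolding valued_structure_def by (simp del: set_map length_map)
qed (use e in auto)

section \<open>Ultrapowers\<close>

lemma ultrafilter_exists:
  fixes F :: "'i filter"
  assumes "F \<noteq> bot"
  obtains U where "U \<le> F" "U \<noteq> bot" "\<And>P. eventually P U \<or> eventually (\<lambda>i. \<not> P i) U"
proof -
  define A where "A = {G. G \<le> F \<and> G \<noteq> bot}"
  have "\<exists>m\<in>A. \<forall>a\<in>A. m \<ge> a \<longrightarrow> a = m"
  proof (rule predicate_Zorn)
    show "partial_order_on A (relation_of (\<ge>) A)"
      by (rule partial_order_on_relation_ofI) auto
  next
    fix C assume C: "C \<in> Chains (relation_of (\<ge>) A)"
    then have CA: "C \<subseteq> A" and tot: "\<And>a b. a \<in> C \<Longrightarrow> b \<in> C \<Longrightarrow> a \<ge> b \<or> b \<ge> a"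
      unfolding Chains_def relation_of_def by auto
    show "\<exists>u\<in>A. \<forall>a\<in>C. a \<ge> u"
    proof (cases "C = {}")
      case True
      then show ?thesis using assms unfolding A_def by auto
    next
      case False
      have "eventually P (Inf C) \<longleftrightarrow> (\<exists>b\<in>C. eventually P b)" for P
      proof (rule eventually_Inf_base[OF False])
        fix a b assume "a \<in> C" "b \<in> C"
        with tot show "\<exists>x\<in>C. x \<le> inf a b" by (meson le_inf_iff order_refl)
      qed
      then have "Inf C \<noteq> bot" using CA unfolding A_def trivial_limit_def by auto
      moreover obtain c where "c \<in> C" using False by blast
      then have "Inf C \<le> F" using CA unfolding A_def by (auto intro: Inf_lower2)
      ultimately show ?thesis unfolding A_def by (auto intro!: bexI[of _ "Inf C"] Inf_lower)
    qed
  qed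
  then obtain G where G: "G \<le> F" "G \<noteq> bot" and min: "\<And>H. H \<le> F \<Longrightarrow> H \<noteq> bot \<Longrightarrow> H \<le> G \<Longrightarrow> H = G"
    unfolding A_def by auto
  have "eventually P G \<or> eventually (\<lambda>i. \<not> P i) G" for P
  proof (cases "inf G (principal {i. P i}) = bot")
    case True
    then have "eventually (\<lambda>i. False) (inf G (principal {i. P i}))" by simp
    then show ?thesis by (simp add: eventually_inf_principal)
  next
    case False
    then have "inf G (principal {i. P i}) = G" using G by (intro min) (auto intro: le_infI1)
    moreover have "eventually P (inf G (principal {i. P i}))" by (simp add: eventually_inf_principal)
    ultimately show ?thesis by simp
  qed
  then show ?thesis using that G by blast
qed

locale ultra =
  fixes L :: "('f, 'r) language" and K :: "('k, 'f, 'r) vstruct" and U :: "'i filter"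
  assumes vs: "valued_structure L K"
    and U_proper: "U \<noteq> bot"
    and U_ultra: "eventually P U \<or> eventually (\<lambda>i. \<not> P i) U"

sublocale ultra \<subseteq> K: vfield K
  using vs by unfold_locales (simp add: valued_structure_def)

context ultra
begin

lemma eventually_not: "eventually (\<lambda>i. \<not> P i) U \<longleftrightarrow> \<not> eventually P U"
proof
  assume "eventually (\<lambda>i. \<not> P i) U"
  then show "\<not> eventually P U" using U_proper eventually_conj[of P U "\<lambda>i. \<not> P i"] by auto
qed (use U_ultra in blast)

text \<open>
  The elements of the ultrapower are canonical representatives of functions modulo equality
  almost everywhere, not classes. So the carrier consists of functions on the index set, which is
  the shape of the models over which 1-h-minimality quantifies.
\<close>

definition rep :: "('i \<Rightarrow> 'k) \<Rightarrow> 'i \<Rightarrow> 'k" where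
  "rep f = (SOME g. range g \<subseteq> carrier K \<and> (\<forall>\<^sub>F i in U. g i = f i))"

definition UP :: "('i \<Rightarrow> 'k, 'f, 'r) vstruct" where
  "UP = \<lparr>carrier = rep ` {f. range f \<subseteq> carrier K},
     mult = \<lambda>x y. rep (\<lambda>i. x i \<otimes>\<^bsub>K\<^esub> y i), one = rep (\<lambda>_. \<one>\<^bsub>K\<^esub>),
     zero = rep (\<lambda>_. \<zero>\<^bsub>K\<^esub>), add = \<lambda>x y. rep (\<lambda>i. x i \<oplus>\<^bsub>K\<^esub> y i),
     valring = {x \<in> rep ` {f. range f \<subseteq> carrier K}. \<forall>\<^sub>F i in U. x i \<in> valring K},
     fun_int = \<lambda>f xs. rep (\<lambda>i. fun_int K f (map (\<lambda>x. x i) xs)),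
     rel_int = \<lambda>R xs. \<forall>\<^sub>F i in U. rel_int K R (map (\<lambda>x. x i) xs)\<rparr>"

lemma rep_spec:
  assumes "\<forall>\<^sub>F i in U. f i \<in> carrier K"
  shows "range (rep f) \<subseteq> carrier K \<and> (\<forall>\<^sub>F i in U. rep f i = f i)"
proof -
  let ?P = "\<lambda>g. range g \<subseteq> carrier K \<and> (\<forall>\<^sub>F i in U. g i = f i)"
  have "?P (\<lambda>i. if f i \<in> carrier K then f i else \<zero>\<^bsub>K\<^esub>)"
    using assms by (auto elim: eventually_mono)
  then have "?P (SOME g. ?P g)" by (rule someI[of ?P])
  then show ?thesis unfolding rep_def .
qed

lemma rep_ev: "\<forall>\<^sub>F i in U. f i \<in> carrier K \<Longrightarrow> \<forall>\<^sub>F i in U. rep f i = f i"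
  using rep_spec by blast

lemma rep_cong: assumes "\<forall>\<^sub>F i in U. f i = g i" shows "rep f = rep g"
proof -
  have "(\<forall>\<^sub>F i in U. h i = f i) \<longleftrightarrow> (\<forall>\<^sub>F i in U. h i = g i)" for h
    using assms by (auto elim: eventually_elim2)
  then show ?thesis unfolding rep_def by simp
qed

lemma carrier_UP: "carrier UP = rep ` {f. range f \<subseteq> carrier K}"
  by (simp add: UP_def)

lemma rep_carrier: assumes "\<forall>\<^sub>F i in U. f i \<in> carrier K" shows "rep f \<in> carrier UP"
proof -
  have "rep f = rep (rep f)" using rep_cong rep_ev[OF assms] by (metis (mono_tags, lifting) eventually_mono)
  then show ?thesis unfolding carrier_UP using rep_spec[OF assms] by blast
qed

lemma UP_closed [simp]: assumes "x \<in> carrier UP" shows "x i \<in> carrier K"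
proof -
  obtain f where "range f \<subseteq> carrier K" "x = rep f" using assms unfolding carrier_UP by blast
  then show ?thesis using rep_spec[of f] by (auto simp: image_subset_iff)
qed

lemma rep_id: assumes "x \<in> carrier UP" shows "rep x = x"
proof -
  obtain f where f: "range f \<subseteq> carrier K" "x = rep f" using assms unfolding carrier_UP by blast
  then have "\<forall>\<^sub>F i in U. x i = f i" using rep_ev[of f] by (auto simp: image_subset_iff)
  then show ?thesis using rep_cong f by simp
qed

lemma UP_eq: "x \<in> carrier UP \<Longrightarrow> y \<in> carrier UP \<Longrightarrow> x = y \<longleftrightarrow> (\<forall>\<^sub>F i in U. x i = y i)"
  using rep_cong[of x y] rep_id by auto

lemma UP_simps:
  "x \<oplus>\<^bsub>UP\<^esub> y = rep (\<lambda>i. x i \<oplus>\<^bsub>K\<^esub> y i)"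
  "x \<otimes>\<^bsub>UP\<^esub> y = rep (\<lambda>i. x i \<otimes>\<^bsub>K\<^esub> y i)"
  "\<zero>\<^bsub>UP\<^esub> = rep (\<lambda>_. \<zero>\<^bsub>K\<^esub>)"
  "\<one>\<^bsub>UP\<^esub> = rep (\<lambda>_. \<one>\<^bsub>K\<^esub>)"
  "fun_int UP f xs = rep (\<lambda>i. fun_int K f (map (\<lambda>x. x i) xs))"
  "rel_int UP R xs \<longleftrightarrow> (\<forall>\<^sub>F i in U. rel_int K R (map (\<lambda>x. x i) xs))"
  by (simp_all add: UP_def)

lemma valring_UP: "x \<in> valring UP \<longleftrightarrow> x \<in> carrier UP \<and> (\<forall>\<^sub>F i in U. x i \<in> valring K)"
  by (simp add: UP_def)

lemma UP_op_closed [simp]: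
  "x \<in> carrier UP \<Longrightarrow> y \<in> carrier UP \<Longrightarrow> x \<oplus>\<^bsub>UP\<^esub> y \<in> carrier UP"
  "x \<in> carrier UP \<Longrightarrow> y \<in> carrier UP \<Longrightarrow> x \<otimes>\<^bsub>UP\<^esub> y \<in> carrier UP"
  "\<zero>\<^bsub>UP\<^esub> \<in> carrier UP" "\<one>\<^bsub>UP\<^esub> \<in> carrier UP"
  unfolding UP_simps by (auto intro!: rep_carrier)

lemma UP_ev:
  "x \<in> carrier UP \<Longrightarrow> y \<in> carrier UP \<Longrightarrow> \<forall>\<^sub>F i in U. (x \<oplus>\<^bsub>UP\<^esub> y) i = x i \<oplus>\<^bsub>K\<^esub> y i"
  "x \<in> carrier UP \<Longrightarrow> y \<in> carrier UP \<Longrightarrow> \<forall>\<^sub>F i in U. (x \<otimes>\<^bsub>UP\<^esub> y) i = x i \<otimes>\<^bsub>K\<^esub> y i"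
  "\<forall>\<^sub>F i in U. \<zero>\<^bsub>UP\<^esub> i = \<zero>\<^bsub>K\<^esub>" "\<forall>\<^sub>F i in U. \<one>\<^bsub>UP\<^esub> i = \<one>\<^bsub>K\<^esub>"
  unfolding UP_simps by (auto intro!: rep_ev)

definition cst :: "'k \<Rightarrow> 'i \<Rightarrow> 'k" where "cst a = rep (\<lambda>_. a)"

lemma cst_closed [simp]: "a \<in> carrier K \<Longrightarrow> cst a \<in> carrier UP"
  unfolding cst_def by (rule rep_carrier) auto

lemma cst_ev: "a \<in> carrier K \<Longrightarrow> \<forall>\<^sub>F i in U. cst a i = a"
  unfolding cst_def by (rule rep_ev) auto

lemma cst_inj: "inj_on cst (carrier K)"
proof (rule inj_onI)
  fix a b assume ab: "a \<in> carrier K" "b \<in> carrier K" "cst a = cst b"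
  have "\<forall>\<^sub>F i in U. a = b" using cst_ev[OF ab(1)] cst_ev[OF ab(2)] unfolding ab(3) by eventually_elim simp
  then show "a = b" using U_proper by (auto simp: eventually_const)
qed

lemma cst_zero_one: "\<zero>\<^bsub>UP\<^esub> = cst \<zero>\<^bsub>K\<^esub>" "\<one>\<^bsub>UP\<^esub> = cst \<one>\<^bsub>K\<^esub>"
  by (simp_all add: UP_simps cst_def)

lemma UP_nonzero: assumes "x \<in> carrier UP" shows "x \<noteq> \<zero>\<^bsub>UP\<^esub> \<longleftrightarrow> (\<forall>\<^sub>F i in U. x i \<noteq> \<zero>\<^bsub>K\<^esub>)"
proof -
  have "x = \<zero>\<^bsub>UP\<^esub> \<longleftrightarrow> (\<forall>\<^sub>F i in U. x i = \<zero>\<^bsub>UP\<^esub> i)" using assms by (simp add: UP_eq)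
  also have "\<dots> \<longleftrightarrow> (\<forall>\<^sub>F i in U. x i = \<zero>\<^bsub>K\<^esub>)"
    using UP_ev(3) by (auto elim: eventually_elim2)
  finally show ?thesis by (simp add: eventually_not)
qed

lemma UP_cring: "cring UP"
proof (rule cringI)
  show "abelian_group UP"
  proof (rule abelian_groupI)
    fix x y z assume c: "x \<in> carrier UP" "y \<in> carrier UP" "z \<in> carrier UP"
    have "\<forall>\<^sub>F i in U. ((x \<oplus>\<^bsub>UP\<^esub> y) \<oplus>\<^bsub>UP\<^esub> z) i = (x \<oplus>\<^bsub>UP\<^esub> (y \<oplus>\<^bsub>UP\<^esub> z)) i"
      using UP_ev(1)[OF c(1,2)] UP_ev(1)[OF c(2,3)] UP_ev(1)[OF UP_op_closed(1)[OF c(1,2)] c(3)]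
        UP_ev(1)[OF c(1) UP_op_closed(1)[OF c(2,3)]]
      by eventually_elim (use c in \<open>simp add: K.a_assoc\<close>)
    then show "(x \<oplus>\<^bsub>UP\<^esub> y) \<oplus>\<^bsub>UP\<^esub> z = x \<oplus>\<^bsub>UP\<^esub> (y \<oplus>\<^bsub>UP\<^esub> z)" using c by (simp add: UP_eq)
  next
    fix x y assume c: "x \<in> carrier UP" "y \<in> carrier UP"
    show "x \<oplus>\<^bsub>UP\<^esub> y = y \<oplus>\<^bsub>UP\<^esub> x" unfolding UP_simps using c by (simp add: K.a_comm)
  next
    fix x assume c: "x \<in> carrier UP"
    have "\<forall>\<^sub>F i in U. (\<zero>\<^bsub>UP\<^esub> \<oplus>\<^bsub>UP\<^esub> x) i = x i"
      using UP_ev(1)[OF UP_op_closed(3) c] UP_ev(3) by eventually_elim (use c in simp)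
    then show "\<zero>\<^bsub>UP\<^esub> \<oplus>\<^bsub>UP\<^esub> x = x" using c by (simp add: UP_eq)
    define y where "y = rep (\<lambda>i. \<ominus>\<^bsub>K\<^esub> x i)"
    have y: "y \<in> carrier UP" "\<forall>\<^sub>F i in U. y i = \<ominus>\<^bsub>K\<^esub> x i"
      unfolding y_def using c by (auto intro!: rep_carrier rep_ev)
    have "\<forall>\<^sub>F i in U. (y \<oplus>\<^bsub>UP\<^esub> x) i = \<zero>\<^bsub>UP\<^esub> i"
      using UP_ev(1)[OF y(1) c] y(2) UP_ev(3) by eventually_elim (use c in \<open>simp add: K.l_neg\<close>)
    then have "y \<oplus>\<^bsub>UP\<^esub> x = \<zero>\<^bsub>UP\<^esub>" using c y by (simp add: UP_eq)
    then show "\<exists>y\<in>carrier UP. y \<oplus>\<^bsub>UP\<^esub> x = \<zero>\<^bsub>UP\<^esub>" using y by blast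
  qed auto
  show "comm_monoid UP"
  proof (rule comm_monoidI)
    fix x y z assume c: "x \<in> carrier UP" "y \<in> carrier UP" "z \<in> carrier UP"
    have "\<forall>\<^sub>F i in U. ((x \<otimes>\<^bsub>UP\<^esub> y) \<otimes>\<^bsub>UP\<^esub> z) i = (x \<otimes>\<^bsub>UP\<^esub> (y \<otimes>\<^bsub>UP\<^esub> z)) i"
      using UP_ev(2)[OF c(1,2)] UP_ev(2)[OF c(2,3)] UP_ev(2)[OF UP_op_closed(2)[OF c(1,2)] c(3)]
        UP_ev(2)[OF c(1) UP_op_closed(2)[OF c(2,3)]]
      by eventually_elim (use c in \<open>simp add: K.m_assoc\<close>)
    then show "(x \<otimes>\<^bsub>UP\<^esub> y) \<otimes>\<^bsub>UP\<^esub> z = x \<otimes>\<^bsub>UP\<^esub> (y \<otimes>\<^bsub>UP\<^esub> z)" using c by (simp add: UP_eq)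
  next
    fix x y assume c: "x \<in> carrier UP" "y \<in> carrier UP"
    show "x \<otimes>\<^bsub>UP\<^esub> y = y \<otimes>\<^bsub>UP\<^esub> x" unfolding UP_simps using c by (simp add: K.m_comm)
  next
    fix x assume c: "x \<in> carrier UP"
    have "\<forall>\<^sub>F i in U. (\<one>\<^bsub>UP\<^esub> \<otimes>\<^bsub>UP\<^esub> x) i = x i"
      using UP_ev(2)[OF UP_op_closed(4) c] UP_ev(4) by eventually_elim (use c in simp)
    then show "\<one>\<^bsub>UP\<^esub> \<otimes>\<^bsub>UP\<^esub> x = x" using c by (simp add: UP_eq)
  qed auto
  fix x y z assume c: "x \<in> carrier UP" "y \<in> carrier UP" "z \<in> carrier UP"
  have "\<forall>\<^sub>F i in U. ((x \<oplus>\<^bsub>UP\<^esub> y) \<otimes>\<^bsub>UP\<^esub> z) i = (x \<otimes>\<^bsub>UP\<^esub> z \<oplus>\<^bsub>UP\<^esub> y \<otimes>\<^bsub>UP\<^esub> z) i"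
    using UP_ev(1)[OF c(1,2)] UP_ev(2)[OF c(2,3)] UP_ev(2)[OF c(1,3)]
      UP_ev(2)[OF UP_op_closed(1)[OF c(1,2)] c(3)]
      UP_ev(1)[OF UP_op_closed(2)[OF c(1,3)] UP_op_closed(2)[OF c(2,3)]]
    by eventually_elim (use c in \<open>simp add: K.l_distr\<close>)
  then show "(x \<oplus>\<^bsub>UP\<^esub> y) \<otimes>\<^bsub>UP\<^esub> z = x \<otimes>\<^bsub>UP\<^esub> z \<oplus>\<^bsub>UP\<^esub> y \<otimes>\<^bsub>UP\<^esub> z" using c by (simp add: UP_eq)
qed

lemma UP_inverse:
  assumes "x \<in> carrier UP" "x \<noteq> \<zero>\<^bsub>UP\<^esub>"
  obtains y where "y \<in> carrier UP" "\<forall>\<^sub>F i in U. y i = inv\<^bsub>K\<^esub> x i" "x \<otimes>\<^bsub>UP\<^esub> y = \<one>\<^bsub>UP\<^esub>"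
proof -
  have nz: "\<forall>\<^sub>F i in U. x i \<noteq> \<zero>\<^bsub>K\<^esub>" using assms UP_nonzero by blast
  then have g: "\<forall>\<^sub>F i in U. inv\<^bsub>K\<^esub> x i \<in> carrier K" by eventually_elim (use assms in simp)
  define y where "y = rep (\<lambda>i. inv\<^bsub>K\<^esub> x i)"
  have y: "y \<in> carrier UP" "\<forall>\<^sub>F i in U. y i = inv\<^bsub>K\<^esub> x i"
    unfolding y_def using g by (auto intro!: rep_carrier rep_ev)
  have "\<forall>\<^sub>F i in U. (x \<otimes>\<^bsub>UP\<^esub> y) i = \<one>\<^bsub>UP\<^esub> i"
    using UP_ev(2)[OF assms(1) y(1)] y(2) UP_ev(4) nz by eventually_elim (use assms in simp)
  then have "x \<otimes>\<^bsub>UP\<^esub> y = \<one>\<^bsub>UP\<^esub>" using assms y by (simp add: UP_eq)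
  then show ?thesis using that y by blast
qed

lemma UP_field: "field UP"
proof (rule cring.cring_fieldI2[OF UP_cring])
  show "\<zero>\<^bsub>UP\<^esub> \<noteq> \<one>\<^bsub>UP\<^esub>"
    unfolding cst_zero_one using cst_inj K.zero_not_one by (auto dest: inj_onD)
qed (use UP_inverse in blast)

lemma UP_neg: assumes "x \<in> carrier UP" shows "\<forall>\<^sub>F i in U. (\<ominus>\<^bsub>UP\<^esub> x) i = \<ominus>\<^bsub>K\<^esub> x i"
proof -
  interpret F: field UP by (rule UP_field)
  have c: "\<ominus>\<^bsub>UP\<^esub> x \<in> carrier UP" using assms by simp
  have "x \<oplus>\<^bsub>UP\<^esub> \<ominus>\<^bsub>UP\<^esub> x = \<zero>\<^bsub>UP\<^esub>" using assms by (simp add: F.r_neg)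
  then have "\<forall>\<^sub>F i in U. (x \<oplus>\<^bsub>UP\<^esub> \<ominus>\<^bsub>UP\<^esub> x) i = \<zero>\<^bsub>K\<^esub>" using UP_ev(3) by simp
  then show ?thesis using UP_ev(1)[OF assms c]
  proof eventually_elim
    case (elim i)
    then have "x i \<oplus>\<^bsub>K\<^esub> (\<ominus>\<^bsub>UP\<^esub> x) i = \<zero>\<^bsub>K\<^esub>" by simp
    then show ?case using UP_closed[OF c] UP_closed[OF assms] K.minus_equality K.a_comm by metis
  qed
qed

lemma UP_valued_structure: "valued_structure L UP"
proof -
  interpret F: field UP by (rule UP_field)
  have sub: "subring (valring UP) UP"
  proof (rule F.subringI)
    show "valring UP \<subseteq> carrier UP" using valring_UP by blast
    show "\<one>\<^bsub>UP\<^esub> \<in> valring UP" unfolding valring_UP using UP_ev(4) by (auto elim: eventually_mono)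
  next
    fix h assume h: "h \<in> valring UP"
    then have v: "\<forall>\<^sub>F i in U. h i \<in> valring K" and c: "h \<in> carrier UP" by (auto simp: valring_UP)
    have "\<forall>\<^sub>F i in U. (\<ominus>\<^bsub>UP\<^esub> h) i \<in> valring K" using v UP_neg[OF c] by eventually_elim simp
    then show "\<ominus>\<^bsub>UP\<^esub> h \<in> valring UP" using c by (simp add: valring_UP)
  next
    fix h h' assume "h \<in> valring UP" "h' \<in> valring UP"
    then have v: "\<forall>\<^sub>F i in U. h i \<in> valring K" "\<forall>\<^sub>F i in U. h' i \<in> valring K"
      and c: "h \<in> carrier UP" "h' \<in> carrier UP" by (auto simp: valring_UP)
    have "\<forall>\<^sub>F i in U. (h \<otimes>\<^bsub>UP\<^esub> h') i \<in> valring K" using v UP_ev(2)[OF c] by eventually_elim simp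
    then show "h \<otimes>\<^bsub>UP\<^esub> h' \<in> valring UP" unfolding valring_UP using c by simp
    have "\<forall>\<^sub>F i in U. (h \<oplus>\<^bsub>UP\<^esub> h') i \<in> valring K" using v UP_ev(1)[OF c] by eventually_elim simp
    then show "h \<oplus>\<^bsub>UP\<^esub> h' \<in> valring UP" unfolding valring_UP using c by simp
  qed
  have tot: "x \<in> valring UP \<or> inv\<^bsub>UP\<^esub> x \<in> valring UP" if x: "x \<in> carrier UP - {\<zero>\<^bsub>UP\<^esub>}" for x
  proof (rule disjCI)
    assume nv: "inv\<^bsub>UP\<^esub> x \<notin> valring UP"
    obtain y where y: "y \<in> carrier UP" "\<forall>\<^sub>F i in U. y i = inv\<^bsub>K\<^esub> x i" "x \<otimes>\<^bsub>UP\<^esub> y = \<one>\<^bsub>UP\<^esub>"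
      using UP_inverse x by blast
    have "inv\<^bsub>UP\<^esub> x = y" using x y by (intro F.comm_inv_char) auto
    then have "\<not> (\<forall>\<^sub>F i in U. y i \<in> valring K)" using nv y by (simp add: valring_UP)
    then have n: "\<forall>\<^sub>F i in U. y i \<notin> valring K" by (simp add: eventually_not)
    have nz: "\<forall>\<^sub>F i in U. x i \<noteq> \<zero>\<^bsub>K\<^esub>" using x UP_nonzero by blast
    have "\<forall>\<^sub>F i in U. x i \<in> valring K" using n nz y(2)
    proof eventually_elim
      case (elim i)
      have "x i \<in> carrier K" using x by simp
      then show ?case using elim K.valring_total[of "x i"] by simp
    qed
    then show "x \<in> valring UP" using x by (simp add: valring_UP)
  qed
  have fn: "fun_int UP f xs \<in> carrier UP" if "fun_ar L f = Some (length xs)" "set xs \<subseteq> carrier UP" for f xs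
  proof -
    have "fun_int K f (map (\<lambda>x. x i) xs) \<in> carrier K" for i
    proof -
      have "set (map (\<lambda>x. x i) xs) \<subseteq> carrier K" using that by auto
      then show ?thesis using vs that unfolding valued_structure_def by (simp del: set_map)
    qed
    then show ?thesis unfolding UP_simps by (intro rep_carrier always_eventually allI)
  qed
  show ?thesis unfolding valued_structure_def valued_field_def using UP_field sub tot fn by blast
qed

lemma eval_tm_UP:
  assumes e: "\<And>n. e n \<in> carrier UP"
  shows "wf_tm L t \<Longrightarrow> \<forall>\<^sub>F i in U. eval_tm UP e t i = eval_tm K (\<lambda>n. e n i) t"
proof (induction t)
  case (Plus s t)
  note c = eval_tm_closed[OF UP_valued_structure, of e, OF e]
  have "\<forall>\<^sub>F i in U. eval_tm UP e s i = eval_tm K (\<lambda>n. e n i) s"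
    "\<forall>\<^sub>F i in U. eval_tm UP e t i = eval_tm K (\<lambda>n. e n i) t"
    "\<forall>\<^sub>F i in U. (eval_tm UP e s \<oplus>\<^bsub>UP\<^esub> eval_tm UP e t) i = eval_tm UP e s i \<oplus>\<^bsub>K\<^esub> eval_tm UP e t i"
    using Plus c UP_ev(1) by auto
  then show ?case by eventually_elim simp
next
  case (Times s t)
  note c = eval_tm_closed[OF UP_valued_structure, of e, OF e]
  have "\<forall>\<^sub>F i in U. eval_tm UP e s i = eval_tm K (\<lambda>n. e n i) s"
    "\<forall>\<^sub>F i in U. eval_tm UP e t i = eval_tm K (\<lambda>n. e n i) t"
    "\<forall>\<^sub>F i in U. (eval_tm UP e s \<otimes>\<^bsub>UP\<^esub> eval_tm UP e t) i = eval_tm UP e s i \<otimes>\<^bsub>K\<^esub> eval_tm UP e t i"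
    using Times c UP_ev(2) by auto
  then show ?case by eventually_elim simp
next
  case (Fn f ts)
  have cl: "eval_tm UP e (Fn f ts) \<in> carrier UP" using eval_tm_closed[OF UP_valued_structure, of e, OF e] Fn.prems by blast
  have "\<forall>\<^sub>F i in U. \<forall>t\<in>set ts. eval_tm UP e t i = eval_tm K (\<lambda>n. e n i) t"
    using Fn by (intro eventually_ball_finite) (auto simp: list_all_iff)
  moreover have "\<forall>\<^sub>F i in U. rep (\<lambda>i. fun_int K f (map (\<lambda>x. x i) (map (eval_tm UP e) ts))) i
      = fun_int K f (map (\<lambda>x. x i) (map (eval_tm UP e) ts))"
  proof (rule rep_ev, rule always_eventually, rule allI)
    fix i
    have "set (map (\<lambda>x. x i) (map (eval_tm UP e) ts)) \<subseteq> carrier K"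
      using Fn.prems eval_tm_closed[OF UP_valued_structure, of e, OF e] by (auto simp: list_all_iff)
    then show "fun_int K f (map (\<lambda>x. x i) (map (eval_tm UP e) ts)) \<in> carrier K"
      using vs Fn.prems unfolding valued_structure_def by (simp del: set_map)
  qed
  ultimately show ?case
  proof eventually_elim
    case (elim i)
    have "map (\<lambda>x. x i) (map (eval_tm UP e) ts) = map (eval_tm K (\<lambda>n. e n i)) ts" using elim(1) by simp
    then show ?case using elim(2) by (simp only: UP_simps eval_tm.simps)
  qed
qed auto

text \<open>
  In the existential case the witnesses found in the factors are collected into one element of
  the ultrapower.
\<close>

theorem Los_theorem:
  assumes "wf_fm L \<phi>" "\<And>n. e n \<in> carrier UP"
  shows "sat UP e \<phi> \<longleftrightarrow> (\<forall>\<^sub>F i in U. sat K (\<lambda>n. e n i) \<phi>)"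
  using assms
proof (induction \<phi> arbitrary: e)
  case (Eq s t)
  have c: "eval_tm UP e s \<in> carrier UP" "eval_tm UP e t \<in> carrier UP"
    using Eq eval_tm_closed[OF UP_valued_structure] by auto
  have v: "\<forall>\<^sub>F i in U. eval_tm UP e s i = eval_tm K (\<lambda>n. e n i) s"
    "\<forall>\<^sub>F i in U. eval_tm UP e t i = eval_tm K (\<lambda>n. e n i) t" using Eq eval_tm_UP by auto
  have "(\<forall>\<^sub>F i in U. eval_tm UP e s i = eval_tm UP e t i) \<longleftrightarrow>
    (\<forall>\<^sub>F i in U. eval_tm K (\<lambda>n. e n i) s = eval_tm K (\<lambda>n. e n i) t)"
    by (rule eventually_cong[OF eventually_conj[OF v]]) auto
  then show ?case using UP_eq[OF c] by simp
next
  case (InO t)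
  have c: "eval_tm UP e t \<in> carrier UP"
    using InO eval_tm_closed[OF UP_valued_structure] by auto
  have v: "\<forall>\<^sub>F i in U. eval_tm UP e t i = eval_tm K (\<lambda>n. e n i) t" using InO eval_tm_UP by auto
  have "(\<forall>\<^sub>F i in U. eval_tm UP e t i \<in> valring K) \<longleftrightarrow>
    (\<forall>\<^sub>F i in U. eval_tm K (\<lambda>n. e n i) t \<in> valring K)"
    by (rule eventually_cong[OF v]) auto
  then show ?case using c by (simp add: valring_UP)
next
  case (Rel R ts)
  have v: "\<forall>\<^sub>F i in U. \<forall>t\<in>set ts. eval_tm UP e t i = eval_tm K (\<lambda>n. e n i) t"
    using Rel eval_tm_UP by (intro eventually_ball_finite) (auto simp: list_all_iff)
  have "(\<forall>\<^sub>F i in U. rel_int K R (map (\<lambda>x. x i) (map (eval_tm UP e) ts))) \<longleftrightarrow>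
    (\<forall>\<^sub>F i in U. rel_int K R (map (eval_tm K (\<lambda>n. e n i)) ts))"
    by (rule eventually_cong[OF v]) (auto intro!: arg_cong[where f = "rel_int K R"])
  then show ?case by (simp add: UP_simps)
next
  case (Neg \<phi>)
  then show ?case by (simp add: eventually_not)
next
  case (And \<phi> \<psi>)
  then show ?case by (simp add: eventually_conj_iff)
next
  case (Ex \<phi>)
  have IH: "sat UP (case_nat x e) \<phi> \<longleftrightarrow> (\<forall>\<^sub>F i in U. sat K (case_nat (x i) (\<lambda>n. e n i)) \<phi>)"
    if "x \<in> carrier UP" for x
  proof -
    have "(\<lambda>n. case_nat x e n i) = case_nat (x i) (\<lambda>n. e n i)" for i
      by (auto split: nat.split)
    then show ?thesis using Ex.IH[of "case_nat x e"] Ex.prems that by (auto split: nat.split)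
  qed
  show ?case
  proof
    assume "sat UP e (Ex \<phi>)"
    then obtain x where "x \<in> carrier UP" "\<forall>\<^sub>F i in U. sat K (case_nat (x i) (\<lambda>n. e n i)) \<phi>"
      using IH by auto
    then show "\<forall>\<^sub>F i in U. sat K (\<lambda>n. e n i) (Ex \<phi>)" by (auto elim!: eventually_mono)
  next
    assume ev: "\<forall>\<^sub>F i in U. sat K (\<lambda>n. e n i) (Ex \<phi>)"
    define f where "f i = (SOME a. a \<in> carrier K \<and> sat K (case_nat a (\<lambda>n. e n i)) \<phi>)" for i
    have f: "\<forall>\<^sub>F i in U. f i \<in> carrier K \<and> sat K (case_nat (f i) (\<lambda>n. e n i)) \<phi>"
      using ev
    proof eventually_elim
      case (elim i)
      then have "\<exists>a. a \<in> carrier K \<and> sat K (case_nat a (\<lambda>n. e n i)) \<phi>" by auto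
      then show ?case unfolding f_def by (rule someI_ex)
    qed
    then have g: "\<forall>\<^sub>F i in U. f i \<in> carrier K" by eventually_elim simp
    have "\<forall>\<^sub>F i in U. sat K (case_nat (rep f i) (\<lambda>n. e n i)) \<phi>"
      using f rep_ev[OF g] by eventually_elim simp
    then show "sat UP e (Ex \<phi>)" using IH rep_carrier[OF g] by auto
  qed
qed

lemma UP_model: "model_of L UP (Th L K)"
  unfolding model_of_def
proof (intro conjI ballI allI UP_valued_structure)
  fix \<phi> e assume "\<phi> \<in> Th L K"
  then have \<phi>: "wf_fm L \<phi>" "fv \<phi> = {}" "\<And>e. sat K e \<phi>" by (auto simp: Th_def)
  have "sat UP (\<lambda>_. \<zero>\<^bsub>UP\<^esub>) \<phi>" using \<phi> by (subst Los_theorem) auto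
  then show "sat UP e \<phi>" using sat_cong[of \<phi> e "\<lambda>_. \<zero>\<^bsub>UP\<^esub>" UP] \<phi> by simp
qed

lemma UP_char_zero: assumes "char_zero K" shows "char_zero UP"
proof -
  interpret V: vfield UP using UP_valued_structure by unfold_locales (simp add: valued_structure_def)
  have *: "\<forall>\<^sub>F i in U. ([k] \<cdot>\<^bsub>UP\<^esub> \<one>\<^bsub>UP\<^esub>) i = [k] \<cdot>\<^bsub>K\<^esub> \<one>\<^bsub>K\<^esub>" for k :: nat
  proof (induction k)
    case 0
    show ?case using UP_ev(3) by (simp add: add_pow_def)
  next
    case (Suc k)
    have "[k] \<cdot>\<^bsub>UP\<^esub> \<one>\<^bsub>UP\<^esub> \<in> carrier UP" by (rule V.add.nat_pow_closed) simp
    then have "\<forall>\<^sub>F i in U. ([k] \<cdot>\<^bsub>UP\<^esub> \<one>\<^bsub>UP\<^esub> \<oplus>\<^bsub>UP\<^esub> \<one>\<^bsub>UP\<^esub>) i = ([k] \<cdot>\<^bsub>UP\<^esub> \<one>\<^bsub>UP\<^esub>) i \<oplus>\<^bsub>K\<^esub> \<one>\<^bsub>UP\<^esub> i"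
      using UP_ev(1) by simp
    then show ?case using Suc UP_ev(4)
      by eventually_elim (simp add: V.add.nat_pow_Suc K.add.nat_pow_Suc)
  qed
  show ?thesis unfolding char_zero_def
  proof (intro allI impI)
    fix k :: nat assume k: "k \<ge> 1"
    have c: "[k] \<cdot>\<^bsub>UP\<^esub> \<one>\<^bsub>UP\<^esub> \<in> carrier UP" by (rule V.add.nat_pow_closed) simp
    show "[k] \<cdot>\<^bsub>UP\<^esub> \<one>\<^bsub>UP\<^esub> \<noteq> \<zero>\<^bsub>UP\<^esub>" unfolding UP_nonzero[OF c]
      using *[of k] by eventually_elim (use assms k in \<open>simp add: char_zero_def\<close>)
  qed
qed

end

section \<open>Definable families indexed by leading terms\<close>

context vfield begin

text \<open>
  If \<open>x\<close> is closer to \<open>v\<close> than \<open>\<mu> \<bar>v - c\<bar>\<close> for all \<open>c \<in> C\<close>, where \<open>\<mu> = \<bar>m\<bar> \<bar>l\<bar>\<close> is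
  the precision of the preparation, then \<open>x - c\<close> and \<open>v - c\<close> have the same class in \<open>RV\<^sub>\<mu>\<close> for all
  \<open>c \<in> C\<close>. As \<open>C\<close> is finite and \<open>v \<notin> C\<close>, these conditions define a neighbourhood of \<open>v\<close>.
\<close>

lemma prepares_ball:
  assumes c0: "char_zero M" and nt: "nontrivially_valued M"
    and m: "m \<ge> 1" and l: "l \<in> valring M" "l \<noteq> \<zero>"
    and C: "finite C" "C \<subseteq> carrier M" "prepares M (nat_absval M m <#>\<^bsub>M\<^esub> absval M l) C X"
    and v: "v \<in> carrier M" "v \<in> X" "v \<notin> C"
  shows "\<exists>d. d \<in> carrier M \<and> d \<noteq> \<zero> \<and> (\<forall>x. near M d x v \<longrightarrow> x \<in> X)"
proof -
  obtain p where p: "p \<in> vmax M" "p \<noteq> \<zero>" using nonunit_exists[OF nt] .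
  have pv: "p \<in> valring M" using p vmax_valring by blast
  define g where "g = [m] \<cdot> \<one> \<otimes> l"
  have m0: "[m] \<cdot> \<one> \<noteq> \<zero>" using c0 m unfolding char_zero_def by blast
  have g: "g \<in> valring M" "g \<noteq> \<zero>"
    unfolding g_def
    by (rule valring_mult[OF nat_valring l(1)])
      (use m0 l mult_nonzero[OF valring_closed[OF nat_valring] valring_closed[OF l(1)]] in blast)
  have gc: "g \<in> carrier M" using g by simp
  have \<mu>: "nat_absval M m <#>\<^bsub>M\<^esub> absval M l = absval M g"
    unfolding nat_absval_def g_def
    by (rule absval_mult[OF valring_closed[OF nat_valring] valring_closed[OF l(1)]])
  \<comment> \<open>The factor \<open>p\<close> makes the distance strictly smaller than required.\<close>
  define D where "D c = (v \<ominus> c) \<otimes> (p \<otimes> g)" for c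
  have vc: "v \<ominus> c \<in> carrier M" "v \<ominus> c \<noteq> \<zero>" if "c \<in> C" for c
  proof -
    have c: "c \<in> carrier M" "c \<noteq> v" using that v C by blast+
    show "v \<ominus> c \<in> carrier M" using c v(1) by simp
    show "v \<ominus> c \<noteq> \<zero>" using c v(1) r_right_minus_eq[of v c] by blast
  qed
  have D: "D c \<in> carrier M \<and> D c \<noteq> \<zero>" if "c \<in> C" for c
  proof -
    have "p \<otimes> g \<in> carrier M" "p \<otimes> g \<noteq> \<zero>" using valring_closed[OF pv] gc g p by simp_all
    then show ?thesis unfolding D_def using vc[OF that] m_closed mult_nonzero by blast
  qed
  obtain d where d: "d \<in> carrier M" "d \<noteq> \<zero>" "\<forall>c\<in>C. \<forall>x y. near M d x y \<longrightarrow> near M (D c) x y"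
    using near_min[of C D, OF C(1)] D by auto
  have "x \<in> X" if x: "near M d x v" for x
  proof -
    have xc: "x \<in> carrier M" by (rule near_closed[OF x d(1) v(1)])
    have "rv M (absval M g) (x \<ominus> c) = rv M (absval M g) (v \<ominus> c)" if c: "c \<in> C" for c
    proof -
      have "near M (D c) x v" using d x c by blast
      then obtain e where e: "e \<in> valring M" "x = v \<oplus> D c \<otimes> e" unfolding near_def by blast
      have cc: "c \<in> carrier M" using c C by blast
      have "x \<ominus> c = (v \<ominus> c) \<otimes> (\<one> \<oplus> (p \<otimes> e) \<otimes> g)"
        unfolding e(2) D_def using v(1) cc valring_closed[OF pv] valring_closed[OF e(1)] gc by algebra
      then show ?thesis using rv_absorb[OF g vc(1)[OF c] vmax_mult[OF p(1) e(1)]] by simp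
    qed
    then show "x \<in> X" using C(3) v xc unfolding prepares_def \<mu> by blast
  qed
  then show ?thesis using d by blast
qed

end

context ultra begin

lemma Los_list:
  assumes "wf_fm L \<phi>" "fv \<phi> \<subseteq> {..<length xs}" "set xs \<subseteq> carrier UP"
  shows "sat UP ((!) xs) \<phi> \<longleftrightarrow> (\<forall>\<^sub>F i in U. sat K ((!) (map (\<lambda>x. x i) xs)) \<phi>)"
proof -
  define e where "e n = (if n < length xs then xs ! n else \<zero>\<^bsub>UP\<^esub>)" for n
  have "sat UP ((!) xs) \<phi> \<longleftrightarrow> sat UP e \<phi>" using assms(2) by (intro sat_cong) (auto simp: e_def)
  also have "\<dots> \<longleftrightarrow> (\<forall>\<^sub>F i in U. sat K (\<lambda>n. e n i) \<phi>)"
    using assms by (intro Los_theorem) (auto simp: e_def)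
  also have "\<dots> \<longleftrightarrow> (\<forall>\<^sub>F i in U. sat K ((!) (map (\<lambda>x. x i) xs)) \<phi>)"
  proof -
    have "sat K (\<lambda>n. e n i) \<phi> \<longleftrightarrow> sat K ((!) (map (\<lambda>x. x i) xs)) \<phi>" for i
      using assms(2) by (intro sat_cong) (auto simp: e_def)
    then show ?thesis by simp
  qed
  finally show ?thesis .
qed

lemma Los_params:
  assumes "wf_fm L \<phi>" "fv \<phi> \<subseteq> {..<1 + length as + length ts}" "set as \<subseteq> carrier K"
    "x \<in> carrier UP" "set ts \<subseteq> carrier UP"
  shows "sat UP ((!) (x # map cst as @ ts)) \<phi> \<longleftrightarrow>
    (\<forall>\<^sub>F i in U. sat K ((!) (x i # as @ map (\<lambda>t. t i) ts)) \<phi>)"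
proof -
  have "\<forall>\<^sub>F i in U. \<forall>a\<in>set as. cst a i = a"
    using assms cst_ev by (intro eventually_ball_finite) auto
  then have "\<forall>\<^sub>F i in U. map (\<lambda>x. x i) (x # map cst as @ ts) = x i # as @ map (\<lambda>t. t i) ts"
    by eventually_elim (simp add: map_idI)
  then have "(\<forall>\<^sub>F i in U. sat K ((!) (map (\<lambda>x. x i) (x # map cst as @ ts))) \<phi>) \<longleftrightarrow>
    (\<forall>\<^sub>F i in U. sat K ((!) (x i # as @ map (\<lambda>t. t i) ts)) \<phi>)"
    by (rule eventually_cong) simp
  moreover have "set (x # map cst as @ ts) \<subseteq> carrier UP" using assms by auto
  moreover have "fv \<phi> \<subseteq> {..<length (x # map cst as @ ts)}" using assms by simp
  ultimately show ?thesis using Los_list[OF assms(1)] by blast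
qed

lemma UP_vmax: assumes c: "c \<in> vmax UP" shows "c \<in> carrier UP" "\<forall>\<^sub>F i in U. c i \<in> vmax K"
proof -
  have v: "c \<in> valring UP" "c \<notin> vunits UP" using c by (auto simp: vmax_def)
  then have ev: "\<forall>\<^sub>F i in U. c i \<in> valring K" and cc: "c \<in> carrier UP" by (auto simp: valring_UP)
  have "\<not> (\<forall>\<^sub>F i in U. c i \<in> vunits K)"
  proof
    assume u: "\<forall>\<^sub>F i in U. c i \<in> vunits K"
    have "\<forall>\<^sub>F i in U. c i \<noteq> \<zero>\<^bsub>K\<^esub>" using u by eventually_elim (simp add: K.vunits_iff)
    then have "c \<noteq> \<zero>\<^bsub>UP\<^esub>" using UP_nonzero cc by blast
    then obtain y where y: "y \<in> carrier UP" "\<forall>\<^sub>F i in U. y i = inv\<^bsub>K\<^esub> c i" "c \<otimes>\<^bsub>UP\<^esub> y = \<one>\<^bsub>UP\<^esub>"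
      using UP_inverse cc by blast
    have "\<forall>\<^sub>F i in U. y i \<in> valring K" using y(2) u by eventually_elim (simp add: K.vunits_iff)
    then have "y \<in> valring UP" using y by (simp add: valring_UP)
    then have "c \<in> vunits UP" using y v unfolding vunits_def by blast
    then show False using v by blast
  qed
  then have "\<forall>\<^sub>F i in U. c i \<notin> vunits K" by (simp add: eventually_not)
  then show "\<forall>\<^sub>F i in U. c i \<in> vmax K" using ev by eventually_elim (simp add: vmax_def)
  show "c \<in> carrier UP" by (rule cc)
qed

lemma UP_nontrivial: assumes "nontrivially_valued K" shows "nontrivially_valued UP"
proof -
  obtain x where x: "x \<in> carrier K" "x \<notin> valring K"
    using assms K.valring_closed unfolding nontrivially_valued_def by blast
  have "\<forall>\<^sub>F i in U. cst x i \<notin> valring K" using cst_ev[OF x(1)] by eventually_elim (use x in simp)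
  then have "cst x \<notin> valring UP" by (simp add: valring_UP eventually_not)
  then show ?thesis using cst_closed[OF x(1)] unfolding nontrivially_valued_def by blast
qed

end

text \<open>
  The only use of 1-h-minimality. The invariance assumption says that the member of the family at
  \<open>t\<close> depends only on the class of \<open>t\<close> in \<open>RV\<^sub>\<lambda>\<close>, where \<open>\<lambda> = \<bar>l\<bar> \<le> 1\<close>. The index set of the
  ultrapower consists of the sets of formulas with parameters from \<open>K\<close>, and the ultrafilter
  contains, for every such formula, the family of finite sets to which it belongs. A point \<open>v\<close> whose
  coordinate at a finite set \<open>i\<close> avoids the finite sets defined by the formulas in \<open>i\<close> is then outside
  every finite set that is definable over \<open>K\<close>.
\<close>

theorem family_ball:
  fixes L :: "('f, 'r) language" and K :: "('k, 'f, 'r) vstruct"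
  assumes vs: "valued_structure L K" and c0: "char_zero K" and hm: "one_h_minimal L K"
    and wf: "wf_fm L \<phi>" and as: "set as \<subseteq> carrier K" and fv: "fv \<phi> \<subseteq> {..<2 + length as}"
    and l: "l \<in> valring K" "l \<noteq> \<zero>\<^bsub>K\<^esub>"
    and inv: "\<And>x t c. x \<in> carrier K \<Longrightarrow> t \<in> carrier K \<Longrightarrow> c \<in> vmax K \<Longrightarrow>
      sat K ((!) (x # as @ [t \<otimes>\<^bsub>K\<^esub> (\<one>\<^bsub>K\<^esub> \<oplus>\<^bsub>K\<^esub> c \<otimes>\<^bsub>K\<^esub> l)])) \<phi> \<longleftrightarrow> sat K ((!) (x # as @ [t])) \<phi>"
    and inf: "infinite {x \<in> carrier K. \<exists>t \<in> carrier K. sat K ((!) (x # as @ [t])) \<phi>}"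
  shows "\<exists>t \<in> carrier K. \<exists>v \<in> carrier K. \<exists>d \<in> carrier K. d \<noteq> \<zero>\<^bsub>K\<^esub> \<and>
    (\<forall>x. near K d x v \<longrightarrow> sat K ((!) (x # as @ [t])) \<phi>)"
proof (rule ccontr)
  assume no: "\<not> ?thesis"
  obtain U :: "(('f, 'r) fm \<times> 'k list) set filter"
    where U: "U \<le> finite_subsets_at_top UNIV" "U \<noteq> bot" "\<And>P. eventually P U \<or> eventually (\<lambda>i. \<not> P i) U"
    using ultrafilter_exists[OF finite_subsets_at_top_neq_bot] by blast
  interpret ultra L K U by unfold_locales (use vs U in auto)
  interpret V: vfield UP using UP_valued_structure by unfold_locales (simp add: valued_structure_def)
  have ev: "eventually P U" if "eventually P (finite_subsets_at_top UNIV)" for P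
    using U(1) that filter_leD by blast
  define Fn where "Fn p = {x \<in> carrier K. sat K ((!) (x # snd p)) (fst p)}" for p :: "('f, 'r) fm \<times> 'k list"
  have "\<exists>v t. v \<in> carrier K \<and> t \<in> carrier K \<and> sat K ((!) (v # as @ [t])) \<phi> \<and>
      (finite i \<longrightarrow> (\<forall>p\<in>i. finite (Fn p) \<longrightarrow> v \<notin> Fn p))" for i
  proof -
    let ?S = "{x \<in> carrier K. \<exists>t \<in> carrier K. sat K ((!) (x # as @ [t])) \<phi>}"
    define B where "B = (if finite i then \<Union>p\<in>{p\<in>i. finite (Fn p)}. Fn p else {})"
    have "finite B" unfolding B_def by auto
    then have "?S - B \<noteq> {}" using Diff_infinite_finite[OF _ inf] infinite_imp_nonempty by blast
    then obtain v t where "v \<in> carrier K" "t \<in> carrier K" "sat K ((!) (v # as @ [t])) \<phi>" "v \<notin> B"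
      by blast
    moreover have "finite i \<longrightarrow> (\<forall>p\<in>i. finite (Fn p) \<longrightarrow> v \<notin> Fn p)" using \<open>v \<notin> B\<close> unfolding B_def by auto
    ultimately show ?thesis by blast
  qed
  then obtain vf tf where vf: "\<And>i. vf i \<in> carrier K" and tf: "\<And>i. tf i \<in> carrier K"
    and st: "\<And>i. sat K ((!) (vf i # as @ [tf i])) \<phi>"
    and gen: "\<And>i p. finite i \<Longrightarrow> p \<in> i \<Longrightarrow> finite (Fn p) \<Longrightarrow> vf i \<notin> Fn p"
    by metis
  \<comment> \<open>The point \<open>v\<close> lies in the member at \<open>t\<close> of the family in the ultrapower.\<close>
  define v where "v = rep vf"
  define t where "t = rep tf"
  have v: "v \<in> carrier UP" "\<forall>\<^sub>F i in U. v i = vf i" unfolding v_def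
    using rep_carrier[of vf] rep_ev[of vf] vf by simp_all
  have t: "t \<in> carrier UP" "\<forall>\<^sub>F i in U. t i = tf i" unfolding t_def
    using rep_carrier[of tf] rep_ev[of tf] tf by simp_all
  define X where "X = {x \<in> carrier UP. sat UP ((!) (x # map cst as @ [t])) \<phi>}"
  have X_iff: "sat UP ((!) (x # map cst as @ [b])) \<phi> \<longleftrightarrow> (\<forall>\<^sub>F i in U. sat K ((!) (x i # as @ [b i])) \<phi>)"
    if "x \<in> carrier UP" "b \<in> carrier UP" for x b
    using Los_params[OF wf, of as "[b]" x] fv as that by simp
  define l' where "l' = cst l"
  have lc: "l \<in> carrier K" using l by simp
  have l'c: "l' \<in> carrier UP" unfolding l'_def using lc by simp
  have lev: "\<forall>\<^sub>F i in U. l' i = l" unfolding l'_def using cst_ev lc by blast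
  have l': "l' \<in> valring UP" "l' \<noteq> \<zero>\<^bsub>UP\<^esub>"
    unfolding UP_nonzero[OF l'c] valring_UP using l'c lev l by (auto elim: eventually_mono)
  define \<gamma> where "\<gamma> = absval UP l'"
  define \<xi> where "\<xi> = rv UP \<gamma> t"
  have b_inv: "sat UP ((!) (x # map cst as @ [b])) \<phi> \<longleftrightarrow> sat UP ((!) (x # map cst as @ [t])) \<phi>"
    if x: "x \<in> carrier UP" and b: "b \<in> \<xi>" for x b
  proof -
    obtain c where c: "c \<in> vmax UP" "b = t \<otimes>\<^bsub>UP\<^esub> (\<one>\<^bsub>UP\<^esub> \<oplus>\<^bsub>UP\<^esub> c \<otimes>\<^bsub>UP\<^esub> l')"
      using b unfolding \<xi>_def \<gamma>_def V.rv_absval[OF l'c l'(2)] by blast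
    note cc = UP_vmax(1)[OF c(1)]
    have cl: "c \<otimes>\<^bsub>UP\<^esub> l' \<in> carrier UP" using cc l'c by simp
    have ol: "\<one>\<^bsub>UP\<^esub> \<oplus>\<^bsub>UP\<^esub> c \<otimes>\<^bsub>UP\<^esub> l' \<in> carrier UP" using cl by simp
    have bc: "b \<in> carrier UP" unfolding c(2) using ol t by simp
    have "\<forall>\<^sub>F i in U. b i = t i \<otimes>\<^bsub>K\<^esub> (\<one>\<^bsub>K\<^esub> \<oplus>\<^bsub>K\<^esub> c i \<otimes>\<^bsub>K\<^esub> l)"
      using UP_ev(2)[OF t(1) ol] UP_ev(1)[OF UP_op_closed(4) cl] UP_ev(2)[OF cc l'c] UP_ev(4) lev
      unfolding c(2) by eventually_elim simp
    then have "\<forall>\<^sub>F i in U. sat K ((!) (x i # as @ [b i])) \<phi> \<longleftrightarrow> sat K ((!) (x i # as @ [t i])) \<phi>"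
      using UP_vmax(2)[OF c(1)] by eventually_elim (use inv x t in simp)
    then show ?thesis unfolding X_iff[OF x bc] X_iff[OF x t(1)] by (rule eventually_cong) simp
  qed
  have t\<xi>: "t \<in> \<xi>"
  proof -
    have "t = t \<otimes>\<^bsub>UP\<^esub> (\<one>\<^bsub>UP\<^esub> \<oplus>\<^bsub>UP\<^esub> \<zero>\<^bsub>UP\<^esub> \<otimes>\<^bsub>UP\<^esub> l')" using t l'c by simp
    then show ?thesis unfolding \<xi>_def \<gamma>_def V.rv_absval[OF l'c l'(2)] using V.zero_vmax by blast
  qed
  \<comment> \<open>The member at \<open>t\<close> is definable over \<open>K\<close> and the class \<open>\<xi>\<close> of \<open>t\<close>: any representative of \<open>\<xi>\<close> will do.\<close>
  have def: "definable1 L UP (cst ` carrier K) (RV UP (nat_absval UP 1) \<union> (\<Union>\<xi>\<in>{\<xi>}. {\<gamma>, \<xi>})) X"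
    unfolding definable1_def
  proof (intro exI conjI allI impI)
    show "wf_fm L \<phi>" by (rule wf)
    show "set (map cst as) \<subseteq> cst ` carrier K" using as by auto
    show "set [\<xi>] \<subseteq> RV UP (nat_absval UP 1) \<union> (\<Union>\<xi>\<in>{\<xi>}. {\<gamma>, \<xi>})" by simp
    show "fv \<phi> \<subseteq> {..<1 + length (map cst as) + length [\<xi>]}" using fv by simp
    fix bs assume "list_all2 (\<in>) bs [\<xi>]"
    then obtain b where "bs = [b]" "b \<in> \<xi>" by (auto simp: list_all2_Cons2)
    then show "X = {x \<in> carrier UP. sat UP ((!) (x # map cst as @ bs)) \<phi>}"
      unfolding X_def using b_inv by blast
  qed
  have "h_min_condition L UP" using hm UP_model unfolding one_h_minimal_def by blast
  moreover have "\<gamma> \<in> value_group UP" unfolding \<gamma>_def value_group_def using l' l'c by blast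
  moreover have "vle UP \<gamma> (absval UP \<one>\<^bsub>UP\<^esub>)"
    unfolding \<gamma>_def using l'(1) l'c V.vle_absval[of l' "\<one>\<^bsub>UP\<^esub>"] V.r_one by auto
  moreover have "cst ` carrier K \<subseteq> carrier UP" by auto
  moreover have "{\<xi>} \<subseteq> RV UP \<gamma>" unfolding \<xi>_def RV_def using t by blast
  ultimately obtain m C where m: "m \<ge> 1" and C: "C \<subseteq> carrier UP" "finite C"
    "definable1 L UP (cst ` carrier K) {} C" "prepares UP (nat_absval UP m <#>\<^bsub>UP\<^esub> \<gamma>) C X"
    using def unfolding h_min_condition_def
    by (metis (no_types, lifting) One_nat_def card.empty card.insert empty_iff finite.emptyI finite.insertI order_refl)
  from C(3) obtain \<psi> as' where \<psi>: "wf_fm L \<psi>" "set as' \<subseteq> cst ` carrier K" "fv \<psi> \<subseteq> {..<1 + length as'}"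
    "C = {x \<in> carrier UP. sat UP ((!) (x # as')) \<psi>}"
    unfolding definable1_def by auto
  then have "as' \<in> lists (cst ` carrier K)" by auto
  then obtain bs where bs: "set bs \<subseteq> carrier K" "as' = map cst bs"
    unfolding lists_image by auto
  have C_iff: "x \<in> C \<longleftrightarrow> (\<forall>\<^sub>F i in U. sat K ((!) (x i # bs)) \<psi>)" if "x \<in> carrier UP" for x
    using Los_params[OF \<psi>(1), of bs "[]" x] \<psi> bs that by simp
  \<comment> \<open>The formula that defines \<open>C\<close> in the ultrapower defines a finite set in \<open>K\<close>, so it is avoided by \<open>v\<close>.\<close>
  have "cst ` Fn (\<psi>, bs) \<subseteq> C"
  proof
    fix y assume "y \<in> cst ` Fn (\<psi>, bs)"
    then obtain x where x: "x \<in> carrier K" "sat K ((!) (x # bs)) \<psi>" "y = cst x" unfolding Fn_def by auto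
    have "\<forall>\<^sub>F i in U. sat K ((!) (cst x i # bs)) \<psi>" using cst_ev[OF x(1)] by eventually_elim (use x in simp)
    then show "y \<in> C" using C_iff[of y] x by simp
  qed
  then have "finite (cst ` Fn (\<psi>, bs))" using C(2) finite_subset by blast
  then have fin: "finite (Fn (\<psi>, bs))"
    by (rule finite_imageD) (rule inj_on_subset[OF cst_inj], auto simp: Fn_def)
  have vC: "v \<notin> C"
  proof
    assume "v \<in> C"
    then have "\<forall>\<^sub>F i in U. sat K ((!) (v i # bs)) \<psi>" using C_iff v by blast
    moreover have "\<forall>\<^sub>F i in U. finite i \<and> (\<psi>, bs) \<in> i"
      by (rule ev) (auto simp: eventually_finite_subsets_at_top intro!: exI[of _ "{(\<psi>, bs)}"])
    ultimately have "\<forall>\<^sub>F i in U. False" using v(2)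
    proof eventually_elim
      case (elim i)
      then have "vf i \<in> Fn (\<psi>, bs)" using vf unfolding Fn_def by simp
      then show ?case using gen[of i "(\<psi>, bs)"] fin elim by blast
    qed
    then show False using U_proper by simp
  qed
  have "\<forall>\<^sub>F i in U. sat K ((!) (v i # as @ [t i])) \<phi>"
    using v(2) t(2) by eventually_elim (simp add: st)
  then have vX: "v \<in> X" unfolding X_def mem_Collect_eq X_iff[OF v(1) t(1)] using v by blast
  have "nontrivially_valued UP" using UP_nontrivial hm unfolding one_h_minimal_def by blast
  then obtain d where d: "d \<in> carrier UP" "d \<noteq> \<zero>\<^bsub>UP\<^esub>" and ball: "\<forall>x. near UP d x v \<longrightarrow> x \<in> X"
    using V.prepares_ball[OF UP_char_zero[OF c0] _ m l' C(2,1) C(4)[unfolded \<gamma>_def] v(1) vX vC] by blast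
  \<comment> \<open>If no member of the original family contained a ball, then each factor would have a point in the
    \<open>i\<close>-th ball outside the member at \<open>t i\<close>; together these points would contradict \<open>ball\<close>.\<close>
  have "\<exists>c. c \<in> valring K \<and> (d i \<noteq> \<zero>\<^bsub>K\<^esub> \<longrightarrow>
      \<not> sat K ((!) ((v i \<oplus>\<^bsub>K\<^esub> d i \<otimes>\<^bsub>K\<^esub> c) # as @ [t i])) \<phi>)" for i
  proof (cases "d i = \<zero>\<^bsub>K\<^esub>")
    case True
    then show ?thesis using K.valring_zero by blast
  next
    case False
    then obtain x where "near K (d i) x (v i)" "\<not> sat K ((!) (x # as @ [t i])) \<phi>"
      using no UP_closed[OF t(1)] UP_closed[OF v(1)] UP_closed[OF d(1)] by blast
    then show ?thesis unfolding near_def by blast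
  qed
  then obtain cf where cf: "\<And>i. cf i \<in> valring K" "\<And>i. d i \<noteq> \<zero>\<^bsub>K\<^esub> \<Longrightarrow>
      \<not> sat K ((!) ((v i \<oplus>\<^bsub>K\<^esub> d i \<otimes>\<^bsub>K\<^esub> cf i) # as @ [t i])) \<phi>" by metis
  define c where "c = rep cf"
  have c: "c \<in> carrier UP" "\<forall>\<^sub>F i in U. c i = cf i" unfolding c_def
    using rep_carrier[of cf] rep_ev[of cf] K.valring_closed[OF cf(1)] by simp_all
  have "\<forall>\<^sub>F i in U. c i \<in> valring K" using c(2) by eventually_elim (use cf in simp)
  then have cv: "c \<in> valring UP" using c by (simp add: valring_UP)
  define x where "x = v \<oplus>\<^bsub>UP\<^esub> d \<otimes>\<^bsub>UP\<^esub> c"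
  have dc: "d \<otimes>\<^bsub>UP\<^esub> c \<in> carrier UP" using d c by simp
  have x: "x \<in> carrier UP" unfolding x_def using dc v by simp
  have "near UP d x v" unfolding near_def x_def using cv by blast
  then have "x \<in> X" using ball by blast
  then have "\<forall>\<^sub>F i in U. sat K ((!) (x i # as @ [t i])) \<phi>" unfolding X_def using X_iff x t by blast
  moreover have "\<forall>\<^sub>F i in U. d i \<noteq> \<zero>\<^bsub>K\<^esub>" using UP_nonzero d by blast
  ultimately have "\<forall>\<^sub>F i in U. False"
    using c(2) UP_ev(1)[OF v(1) dc] UP_ev(2)[OF d(1) c(1)]
  proof eventually_elim
    case (elim i)
    then have "x i = v i \<oplus>\<^bsub>K\<^esub> d i \<otimes>\<^bsub>K\<^esub> cf i" unfolding x_def by simp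
    then show ?case using elim cf(2) by simp
  qed
  then show False using U_proper by simp
qed

section \<open>Definable predicates on assignments\<close>

definition mix :: "(nat \<Rightarrow> 'k) \<Rightarrow> (nat \<Rightarrow> 'k) \<Rightarrow> nat \<Rightarrow> 'k" where
  "mix e p i = (if even i then e (i div 2) else p (i div 2))"

lemma mix_simps [simp]: "mix e p (2 * i) = e i" "mix e p (Suc (2 * i)) = p i"
  by (simp_all add: mix_def)

lemma mix_eqI: "(\<And>i. f (2 * i) = e i) \<Longrightarrow> (\<And>i. f (Suc (2 * i)) = p i) \<Longrightarrow> f = mix e p"
proof (rule ext)
  fix n assume "\<And>i. f (2 * i) = e i" "\<And>i. f (Suc (2 * i)) = p i"
  then show "f n = mix e p n" by (cases "even n") (auto simp: mix_def elim!: evenE oddE)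
qed

locale hmin =
  fixes L :: "('f, 'r) language" and K :: "('k, 'f, 'r) vstruct" (structure)
  assumes vs: "valued_structure L K" and c0: "char_zero K" and hm: "one_h_minimal L K"

sublocale hmin \<subseteq> vfield K
  using vs by unfold_locales (simp add: valued_structure_def)

context hmin
begin

definition envs :: "(nat \<Rightarrow> 'k) set" where "envs = {e. \<forall>i. e i \<in> carrier K}"

lemma envs_closed [simp]: "e \<in> envs \<Longrightarrow> e i \<in> carrier K"
  by (simp add: envs_def)

lemma envs_upd [simp]: "e \<in> envs \<Longrightarrow> a \<in> carrier K \<Longrightarrow> e(j := a) \<in> envs"
  by (simp add: envs_def del: envs_closed)

text \<open>
  Definable sets with parameters are treated as predicates on assignments \<open>e\<close> of all variables. A
  formula sees \<open>e\<close> at its even variables and the parameters \<open>p\<close> at its odd ones, so that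
  finitely many predicates with different parameters can be merged by renaming. The variables of the
  same assignment serve as coordinates of points in every \<open>K\<^sup>n\<close> and as indices of families.
\<close>

definition defpred :: "((nat \<Rightarrow> 'k) \<Rightarrow> bool) \<Rightarrow> bool" where
  "defpred P \<longleftrightarrow> (\<exists>\<phi> p. wf_fm L \<phi> \<and> p \<in> envs \<and> (\<forall>e\<in>envs. P e \<longleftrightarrow> sat K (mix e p) \<phi>))"

lemma defpred_cong: "(\<And>e. e \<in> envs \<Longrightarrow> P e \<longleftrightarrow> Q e) \<Longrightarrow> defpred P \<longleftrightarrow> defpred Q"
  unfolding defpred_def by metis

text \<open>
  The maps that may be substituted for a variable in a definable predicate by renaming alone:
  variables and constants.
\<close>

definition simple_tm :: "((nat \<Rightarrow> 'k) \<Rightarrow> 'k) \<Rightarrow> bool" where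
  "simple_tm t \<longleftrightarrow> (\<exists>i. t = (\<lambda>e. e i)) \<or> (\<exists>c\<in>carrier K. t = (\<lambda>_. c))"

lemma simple_tm_var: "simple_tm (\<lambda>e. e i)" and simple_tm_const: "c \<in> carrier K \<Longrightarrow> simple_tm (\<lambda>_. c)"
  unfolding simple_tm_def by auto

lemma simple_tm_if: "simple_tm s \<Longrightarrow> simple_tm t \<Longrightarrow> simple_tm (\<lambda>e. if b then s e else t e)"
  by (cases b) simp_all

lemma simple_tm_upd: "simple_tm (\<lambda>e. s e n) \<Longrightarrow> simple_tm t \<Longrightarrow> simple_tm (\<lambda>e. ((s e)(j := t e)) n)"
  unfolding fun_upd_def by (rule simple_tm_if)

lemma simple_tm_case_nat: "simple_tm t \<Longrightarrow> (\<And>i. simple_tm (s i)) \<Longrightarrow> simple_tm (\<lambda>e. case_nat (t e) (\<lambda>i. s i e) n)"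
  by (cases n) auto

lemma simple_tm_closed: "simple_tm t \<Longrightarrow> e \<in> envs \<Longrightarrow> t e \<in> carrier K"
  unfolding simple_tm_def by auto

lemmas simple_tm_intros = simple_tm_var simple_tm_const simple_tm_if simple_tm_upd simple_tm_case_nat

lemma defpred_neg: assumes "defpred P" shows "defpred (\<lambda>e. \<not> P e)"
proof -
  obtain \<phi> p where "wf_fm L \<phi>" "p \<in> envs" "\<forall>e\<in>envs. P e \<longleftrightarrow> sat K (mix e p) \<phi>"
    using assms unfolding defpred_def by blast
  then show ?thesis unfolding defpred_def by (intro exI[of _ "Neg \<phi>"] exI[of _ p]) simp
qed

text \<open>
  The constants that are substituted become further parameters.
\<close>

lemma defpred_subst:
  assumes "defpred P" "\<And>n. simple_tm (s n)"
  shows "defpred (\<lambda>e. P (\<lambda>n. s n e))"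
proof -
  obtain \<phi> p where \<phi>: "wf_fm L \<phi>" "p \<in> envs" "\<forall>e\<in>envs. P e \<longleftrightarrow> sat K (mix e p) \<phi>"
    using assms unfolding defpred_def by blast
  define var where "var n \<longleftrightarrow> (\<exists>i. s n = (\<lambda>e. e i))" for n
  define ix where "ix n = (SOME i. s n = (\<lambda>e. e i))" for n
  define c where "c n = (if var n then \<zero> else s n (\<lambda>_. \<zero>))" for n
  have ix: "s n = (\<lambda>e. e (ix n))" if "var n" for n
    using that unfolding var_def ix_def by (rule someI_ex)
  have c: "c n \<in> carrier K" "\<not> var n \<Longrightarrow> s n = (\<lambda>_. c n)" for n
    using assms(2)[of n] unfolding simple_tm_def c_def var_def by auto
  define \<rho> where "\<rho> i = (if even i then (if var (i div 2) then 2 * ix (i div 2) else Suc (2 * Suc (2 * (i div 2))))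
     else Suc (2 * (2 * (i div 2))))" for i
  show ?thesis unfolding defpred_def
  proof (intro exI conjI ballI)
    show "wf_fm L (ren \<phi> \<rho>)" using \<phi> wf_ren by blast
    show "mix p c \<in> envs" using \<phi>(2) c(1) by (simp add: envs_def mix_def del: envs_closed)
    fix e assume e: "e \<in> envs"
    have "(\<lambda>n. s n e) \<in> envs" using simple_tm_closed[OF assms(2) e] by (simp add: envs_def del: envs_closed)
    then have "P (\<lambda>n. s n e) \<longleftrightarrow> sat K (mix (\<lambda>n. s n e) p) \<phi>" using \<phi> by blast
    also have "mix (\<lambda>n. s n e) p = (\<lambda>i. mix e (mix p c) (\<rho> i))"
    proof (rule mix_eqI[symmetric])
      fix i
      have r: "\<rho> (2 * i) = (if var i then 2 * ix i else Suc (2 * Suc (2 * i)))"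
        "\<rho> (Suc (2 * i)) = Suc (2 * (2 * i))" by (simp_all add: \<rho>_def)
      show "mix e (mix p c) (\<rho> (Suc (2 * i))) = p i" by (simp only: r mix_simps)
      show "mix e (mix p c) (\<rho> (2 * i)) = s i e"
      proof (cases "var i")
        case True
        then show ?thesis using ix[OF True] by (simp only: r if_True mix_simps)
      next
        case False
        then show ?thesis using c(2)[OF False] by (simp only: r if_False mix_simps)
      qed
    qed
    finally show "P (\<lambda>n. s n e) \<longleftrightarrow> sat K (mix e (mix p c)) (ren \<phi> \<rho>)" by (simp add: sat_ren)
  qed
qed

lemma defpred_and: assumes "defpred P" "defpred Q" shows "defpred (\<lambda>e. P e \<and> Q e)"
proof -
  obtain \<phi> p where \<phi>: "wf_fm L \<phi>" "p \<in> envs" "\<forall>e\<in>envs. P e \<longleftrightarrow> sat K (mix e p) \<phi>"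
    using assms unfolding defpred_def by blast
  obtain \<psi> q where \<psi>: "wf_fm L \<psi>" "q \<in> envs" "\<forall>e\<in>envs. Q e \<longleftrightarrow> sat K (mix e q) \<psi>"
    using assms unfolding defpred_def by blast
  define \<rho> where "\<rho> b i = (if even i then i else Suc (2 * (2 * (i div 2) + b)))" for b i :: nat
  have *: "mix e p = (\<lambda>i. mix e (mix p q) (\<rho> 0 i))" "mix e q = (\<lambda>i. mix e (mix p q) (\<rho> 1 i))" for e
  proof -
    have r: "\<rho> b (2 * i) = 2 * i" "\<rho> 0 (Suc (2 * i)) = Suc (2 * (2 * i))"
      "\<rho> 1 (Suc (2 * i)) = Suc (2 * Suc (2 * i))" for b i by (simp_all add: \<rho>_def)
    show "mix e p = (\<lambda>i. mix e (mix p q) (\<rho> 0 i))" by (rule mix_eqI[symmetric]) (simp_all only: r mix_simps)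
    show "mix e q = (\<lambda>i. mix e (mix p q) (\<rho> 1 i))" by (rule mix_eqI[symmetric]) (simp_all only: r mix_simps)
  qed
  show ?thesis unfolding defpred_def
  proof (intro exI conjI ballI)
    show "wf_fm L (And (ren \<phi> (\<rho> 0)) (ren \<psi> (\<rho> 1)))" using \<phi> \<psi> by (simp add: wf_ren)
    show "mix p q \<in> envs" using \<phi> \<psi> by (simp add: envs_def mix_def del: envs_closed)
    fix e assume "e \<in> envs"
    then show "P e \<and> Q e \<longleftrightarrow> sat K (mix e (mix p q)) (And (ren \<phi> (\<rho> 0)) (ren \<psi> (\<rho> 1)))"
      using \<phi> \<psi> *[of e] by (simp add: sat_ren)
  qed
qed

text \<open>
  The bound variable becomes variable 0 and all others are shifted, as in the formula. Stated in
  this form, the rule can be applied by resolution to predicates that are written with ordinary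
  quantifiers.
\<close>

lemma defpred_ex: assumes "defpred (\<lambda>e. R (\<lambda>i. e (Suc i)) (e 0))"
  shows "defpred (\<lambda>e. \<exists>x\<in>carrier K. R e x)"
proof -
  obtain \<phi> p where \<phi>: "wf_fm L \<phi>" "p \<in> envs" "\<forall>e\<in>envs. R (\<lambda>i. e (Suc i)) (e 0) \<longleftrightarrow> sat K (mix e p) \<phi>"
    using assms unfolding defpred_def by blast
  define \<rho> where "\<rho> i = (if even i then (if i = 0 then 0 else Suc (i - 2)) else Suc i)" for i :: nat
  show ?thesis unfolding defpred_def
  proof (intro exI conjI ballI)
    show "wf_fm L (Ex (ren \<phi> \<rho>))" using \<phi> by (simp add: wf_ren)
    show "p \<in> envs" by (rule \<phi>)
    fix e assume e: "e \<in> envs"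
    have "R e x \<longleftrightarrow> sat K (case_nat x (mix e p)) (ren \<phi> \<rho>)" if x: "x \<in> carrier K" for x
    proof -
      have "case_nat x e \<in> envs" using e x by (auto simp: envs_def simp del: envs_closed split: nat.split)
      then have "R e x \<longleftrightarrow> sat K (mix (case_nat x e) p) \<phi>" using \<phi>(3) by fastforce
      also have "mix (case_nat x e) p = (\<lambda>i. case_nat x (mix e p) (\<rho> i))"
      proof (rule mix_eqI[symmetric])
        fix i
        show "case_nat x (mix e p) (\<rho> (2 * i)) = case_nat x e i" by (cases i) (auto simp: \<rho>_def)
        show "case_nat x (mix e p) (\<rho> (Suc (2 * i))) = p i" by (simp add: \<rho>_def)
      qed
      finally show ?thesis by (simp add: sat_ren)
    qed
    then show "(\<exists>x\<in>carrier K. R e x) \<longleftrightarrow> sat K (mix e p) (Ex (ren \<phi> \<rho>))" by auto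
  qed
qed

lemma defpred_or: "defpred P \<Longrightarrow> defpred Q \<Longrightarrow> defpred (\<lambda>e. P e \<or> Q e)"
  using defpred_neg[OF defpred_and[OF defpred_neg defpred_neg, of P Q]] by simp

lemma defpred_imp: "defpred P \<Longrightarrow> defpred Q \<Longrightarrow> defpred (\<lambda>e. P e \<longrightarrow> Q e)"
  unfolding imp_conv_disj by (rule defpred_or[OF defpred_neg])

lemma defpred_all: assumes "defpred (\<lambda>e. R (\<lambda>i. e (Suc i)) (e 0))"
  shows "defpred (\<lambda>e. \<forall>x\<in>carrier K. R e x)"
  using defpred_neg[OF defpred_ex[OF defpred_neg[OF assms]]] by simp

lemma defpred_near: assumes "simple_tm d" "simple_tm x" "simple_tm y" shows "defpred (\<lambda>e. near K (d e) (x e) (y e))"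
proof -
  define \<phi> :: "('f, 'r) fm" where
    "\<phi> = Ex (And (InO (Var 0)) (Eq (Var 3) (Plus (Var 5) (Times (Var 1) (Var 0)))))"
  have "defpred (\<lambda>e. near K (e 0) (e 1) (e 2))" unfolding defpred_def
  proof (intro exI conjI ballI)
    show "wf_fm L \<phi>" by (simp add: \<phi>_def)
    show "(\<lambda>_. \<zero>) \<in> envs" by (simp add: envs_def del: envs_closed)
    fix e assume "e \<in> envs"
    show "near K (e 0) (e 1) (e 2) \<longleftrightarrow> sat K (mix e (\<lambda>_. \<zero>)) \<phi>"
    proof -
      have m: "mix e (\<lambda>_. \<zero>) 0 = e 0" "mix e (\<lambda>_. \<zero>) 2 = e 1" "mix e (\<lambda>_. \<zero>) 4 = e 2"
        by (simp_all add: mix_def)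
      show ?thesis unfolding near_def \<phi>_def using valring_closed by (auto simp: m)
    qed
  qed
  from defpred_subst[OF this, of "\<lambda>n. case_nat d (\<lambda>n. case_nat x (\<lambda>_. y) n) n"]
  show ?thesis using assms by (simp add: numeral_2_eq_2 split: nat.split)
qed

lemma defpred_eq: assumes "simple_tm x" "simple_tm y" shows "defpred (\<lambda>e. x e = y e)"
proof -
  have "defpred (\<lambda>e. near K ((\<lambda>_. \<zero>) e) (x e) (y e))" using assms by (intro defpred_near simple_tm_const) auto
  moreover have "near K \<zero> (x e) (y e) \<longleftrightarrow> x e = y e" if "e \<in> envs" for e
    using simple_tm_closed[OF assms(1) that] simple_tm_closed[OF assms(2) that] unfolding near_def
    by (auto intro: exI[of _ \<zero>])
  ultimately show ?thesis using defpred_cong[of "\<lambda>e. near K \<zero> (x e) (y e)" "\<lambda>e. x e = y e"] by blast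
qed

lemma defpred_const: "defpred (\<lambda>_. b)"
proof (cases b)
  case True
  show ?thesis using defpred_eq[OF simple_tm_var[of 0] simple_tm_var[of 0]] True by simp
next
  case False
  show ?thesis using defpred_neg[OF defpred_eq[OF simple_tm_var[of 0] simple_tm_var[of 0]]] False by simp
qed

lemma defpred_ball_finite:
  assumes "finite J" "\<And>i. i \<in> J \<Longrightarrow> defpred (P i)" shows "defpred (\<lambda>e. \<forall>i\<in>J. P i e)"
  using assms
proof (induction J)
  case empty
  show ?case using defpred_const[of True] by simp
next
  case (insert j J)
  then show ?case using defpred_and[of "P j" "\<lambda>e. \<forall>i\<in>J. P i e"] by simp
qed

text \<open>
  The assignments that differ from \<open>e\<close> only at \<open>J\<close>: the fibre through \<open>e\<close> over the remaining
  coordinates. Quantifying over \<open>vary J e\<close> is quantifying over a tuple.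
\<close>

definition vary :: "nat set \<Rightarrow> (nat \<Rightarrow> 'k) \<Rightarrow> (nat \<Rightarrow> 'k) set" where
  "vary J e = {h \<in> envs. \<forall>i. i \<notin> J \<longrightarrow> h i = e i}"

lemma defpred_vary1:
  assumes "finite J" "defpred P" shows "defpred (\<lambda>e. \<exists>h\<in>vary J e. P h)"
  using assms
proof (induction J arbitrary: P)
  case empty
  have "(\<exists>h\<in>vary {} e. P h) \<longleftrightarrow> P e" if "e \<in> envs" for e
  proof -
    have "vary {} e = {e}" unfolding vary_def using that by auto
    then show ?thesis by simp
  qed
  then show ?case using empty defpred_cong[of "\<lambda>e. \<exists>h\<in>vary {} e. P h" P] by blast
next
  case (insert j J)
  have 1: "defpred (\<lambda>e. \<exists>h\<in>vary J e. P h)" using insert by blast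
  have 2: "defpred (\<lambda>e. \<exists>x\<in>carrier K. \<exists>h\<in>vary J (e(j := x)). P h)"
    by (intro defpred_ex defpred_subst[OF 1] simple_tm_upd simple_tm_var)
  have "(\<exists>h\<in>vary (insert j J) e. P h) \<longleftrightarrow> (\<exists>x\<in>carrier K. \<exists>h\<in>vary J (e(j := x)). P h)" for e
  proof
    assume "\<exists>h\<in>vary (insert j J) e. P h"
    then obtain h where h: "h \<in> vary (insert j J) e" "P h" by blast
    then have "h \<in> vary J (e(j := h j))" "h j \<in> carrier K" unfolding vary_def by auto
    then show "\<exists>x\<in>carrier K. \<exists>h\<in>vary J (e(j := x)). P h" using h by blast
  next
    assume "\<exists>x\<in>carrier K. \<exists>h\<in>vary J (e(j := x)). P h"
    then obtain x h where h: "h \<in> vary J (e(j := x))" "P h" by blast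
    then have "h \<in> vary (insert j J) e" unfolding vary_def by auto
    then show "\<exists>h\<in>vary (insert j J) e. P h" using h by blast
  qed
  then show ?case using 2 by simp
qed

text \<open>
  A condition that relates two assignments is a predicate on the assignment that carries the first
  one at its even and the second one at its odd positions.
\<close>

lemma defpred_vary:
  assumes "finite J" and Q: "defpred (\<lambda>e. Q (\<lambda>i. e (2 * i)) (\<lambda>i. e (Suc (2 * i))))"
    and s: "\<And>n. simple_tm (s n)"
  shows "defpred (\<lambda>e. \<exists>h\<in>vary J (\<lambda>n. s n e). Q e h)"
proof -
  define J' where "J' = (\<lambda>j. Suc (2 * j)) ` J"
  have 1: "defpred (\<lambda>e. \<exists>h\<in>vary J' e. Q (\<lambda>i. h (2 * i)) (\<lambda>i. h (Suc (2 * i))))"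
    using defpred_vary1[OF _ Q, of J'] assms(1) unfolding J'_def by simp
  have 2: "defpred (\<lambda>e. \<exists>h\<in>vary J' (\<lambda>n. if even n then e (n div 2) else s (n div 2) e).
      Q (\<lambda>i. h (2 * i)) (\<lambda>i. h (Suc (2 * i))))"
    by (rule defpred_subst[OF 1]) (intro simple_tm_if simple_tm_var s)
  have "(\<exists>h\<in>vary J' (\<lambda>n. if even n then e (n div 2) else s (n div 2) e).
      Q (\<lambda>i. h (2 * i)) (\<lambda>i. h (Suc (2 * i)))) \<longleftrightarrow> (\<exists>h\<in>vary J (\<lambda>n. s n e). Q e h)" if e: "e \<in> envs" for e
  proof
    assume "\<exists>h\<in>vary J' (\<lambda>n. if even n then e (n div 2) else s (n div 2) e).
      Q (\<lambda>i. h (2 * i)) (\<lambda>i. h (Suc (2 * i)))"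
    then obtain h where h: "h \<in> envs" "\<And>n. n \<notin> J' \<Longrightarrow> h n = (if even n then e (n div 2) else s (n div 2) e)"
      "Q (\<lambda>i. h (2 * i)) (\<lambda>i. h (Suc (2 * i)))" unfolding vary_def by blast
    have "2 * i \<notin> J'" for i unfolding J'_def by (auto; presburger)
    then have "(\<lambda>i. h (2 * i)) = e" using h(2) by auto
    moreover have "(\<lambda>i. h (Suc (2 * i))) \<in> vary J (\<lambda>n. s n e)"
    proof -
      have "h (Suc (2 * i)) = s i e" if "i \<notin> J" for i
      proof -
        have "Suc (2 * i) \<notin> J'" using that unfolding J'_def by auto
        from h(2)[OF this] show ?thesis by simp
      qed
      moreover have "(\<lambda>i. h (Suc (2 * i))) \<in> envs" using h(1) by (simp add: envs_def del: envs_closed)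
      ultimately show ?thesis unfolding vary_def by blast
    qed
    ultimately show "\<exists>h\<in>vary J (\<lambda>n. s n e). Q e h" using h(3) by auto
  next
    assume "\<exists>h\<in>vary J (\<lambda>n. s n e). Q e h"
    then obtain h where h: "h \<in> vary J (\<lambda>n. s n e)" "Q e h" by blast
    have "mix e h \<in> vary J' (\<lambda>n. if even n then e (n div 2) else s (n div 2) e)"
    proof -
      have hE: "h \<in> envs" "\<And>i. i \<notin> J \<Longrightarrow> h i = s i e" using h(1) unfolding vary_def by auto
      have "mix e h \<in> envs" using hE(1) e by (simp add: envs_def mix_def del: envs_closed)
      moreover have "h (n div 2) = s (n div 2) e" if "n \<notin> J'" "odd n" for n
      proof (rule hE(2))
        have "n = Suc (2 * (n div 2))" using that by simp
        then show "n div 2 \<notin> J" using that(1) unfolding J'_def by blast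
      qed
      ultimately show ?thesis unfolding vary_def by (simp add: mix_def)
    qed
    moreover have "Q (\<lambda>i. mix e h (2 * i)) (\<lambda>i. mix e h (Suc (2 * i)))" using h by simp
    ultimately show "\<exists>h\<in>vary J' (\<lambda>n. if even n then e (n div 2) else s (n div 2) e).
      Q (\<lambda>i. h (2 * i)) (\<lambda>i. h (Suc (2 * i)))" by blast
  qed
  from iffD1[OF defpred_cong[OF this] 2] show ?thesis .
qed

text \<open>
  Definability of a family uniformly in its index, which is put at variable 0.
\<close>

definition deffam :: "((nat \<Rightarrow> 'k) \<Rightarrow> 'k \<Rightarrow> bool) \<Rightarrow> bool" where
  "deffam R \<longleftrightarrow> defpred (\<lambda>e. R (\<lambda>i. e (Suc i)) (e 0))"

lemma deffam_inst: assumes "deffam R" "\<And>n. simple_tm (s n)" "simple_tm t" shows "defpred (\<lambda>e. R (\<lambda>n. s n e) (t e))"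
  using defpred_subst[OF assms(1)[unfolded deffam_def], of "\<lambda>n e. case_nat (t e) (\<lambda>i. s i e) n"] assms(2,3)
  by (simp add: simple_tm_case_nat)

text \<open>
  This is \<open>family_ball\<close> for assignments: all coordinates but \<open>j\<close> and all parameters become the
  parameters \<open>as\<close>. Only finitely many of them occur in the formula.
\<close>

lemma ball_of_infinite_family:
  assumes R: "deffam R" and e: "e \<in> envs" and l: "l \<in> valring K" "l \<noteq> \<zero>"
    and inv: "\<And>x t c. x \<in> carrier K \<Longrightarrow> t \<in> carrier K \<Longrightarrow> c \<in> vmax K \<Longrightarrow>
      R (e(j := x)) (t \<otimes> (\<one> \<oplus> c \<otimes> l)) \<longleftrightarrow> R (e(j := x)) t"
    and inf: "infinite {x \<in> carrier K. \<exists>t\<in>carrier K. R (e(j := x)) t}"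
  shows "\<exists>t\<in>carrier K. \<exists>v\<in>carrier K. \<exists>d\<in>carrier K. d \<noteq> \<zero> \<and> (\<forall>x. near K d x v \<longrightarrow> R (e(j := x)) t)"
proof -
  obtain \<phi> p where \<phi>: "wf_fm L \<phi>" "p \<in> envs"
      "\<And>e. e \<in> envs \<Longrightarrow> R (\<lambda>i. e (Suc i)) (e 0) \<longleftrightarrow> sat K (mix e p) \<phi>"
    using R unfolding deffam_def defpred_def by blast
  obtain N where N: "fv \<phi> \<subseteq> {..<N}"
    using finite_fv[of \<phi>] finite_nat_iff_bounded by blast
  define as where "as = map (mix (case_nat \<zero> e) p) [0..<N]"
  define \<rho> where "\<rho> i = (if i = 0 then Suc N else if i = 2 * Suc j then 0 else Suc i)" for i
  have key: "R (e(j := x)) t \<longleftrightarrow> sat K ((!) (x # as @ [t])) (ren \<phi> \<rho>)"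
    if x: "x \<in> carrier K" and t: "t \<in> carrier K" for x t
  proof -
    have "case_nat t (e(j := x)) \<in> envs" using e x t by (auto simp: envs_def simp del: envs_closed split: nat.split)
    from \<phi>(3)[OF this] have "R (e(j := x)) t \<longleftrightarrow> sat K (mix (case_nat t (e(j := x))) p) \<phi>"
      by (simp del: fun_upd_apply)
    also have "\<dots> \<longleftrightarrow> sat K (\<lambda>i. (x # as @ [t]) ! \<rho> i) \<phi>"
    proof (rule sat_cong)
      fix i assume "i \<in> fv \<phi>"
      then have i: "i < N" using N by auto
      show "mix (case_nat t (e(j := x))) p i = (x # as @ [t]) ! \<rho> i"
      proof (cases "i = 0 \<or> i = 2 * Suc j")
        case True
        then show ?thesis
        proof
          assume "i = 0" then show ?thesis by (simp add: \<rho>_def as_def mix_def nth_append)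
        next
          assume "i = 2 * Suc j" then show ?thesis unfolding \<rho>_def by (simp only: mix_simps) simp
        qed
      next
        case False
        then have "(x # as @ [t]) ! \<rho> i = mix (case_nat \<zero> e) p i"
          using i by (simp add: \<rho>_def as_def nth_append)
        also have "\<dots> = mix (case_nat t (e(j := x))) p i"
          using False by (auto simp: mix_def split: nat.split)
        finally show ?thesis by simp
      qed
    qed
    finally show ?thesis by (simp add: sat_ren)
  qed
  have as: "set as \<subseteq> carrier K" unfolding as_def mix_def using e \<phi>(2) by (auto split: nat.split)
  have fvr: "fv (ren \<phi> \<rho>) \<subseteq> {..<2 + length as}" unfolding fv_ren \<rho>_def as_def using N by auto
  have infr: "infinite {x \<in> carrier K. \<exists>t\<in>carrier K. sat K ((!) (x # as @ [t])) (ren \<phi> \<rho>)}"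
    using inf key by (simp cong: conj_cong)
  have invr: "sat K ((!) (x # as @ [t \<otimes> (\<one> \<oplus> c \<otimes> l)])) (ren \<phi> \<rho>) \<longleftrightarrow> sat K ((!) (x # as @ [t])) (ren \<phi> \<rho>)"
    if "x \<in> carrier K" "t \<in> carrier K" "c \<in> vmax K" for x t c
  proof -
    have "t \<otimes> (\<one> \<oplus> c \<otimes> l) \<in> carrier K" using that vmax_valring l by simp
    from key[OF that(1) this] key[OF that(1,2)] inv[OF that] show ?thesis by blast
  qed
  obtain t v d where tvd: "t \<in> carrier K" "v \<in> carrier K" "d \<in> carrier K" "d \<noteq> \<zero>"
    and ball: "\<And>x. near K d x v \<Longrightarrow> sat K ((!) (x # as @ [t])) (ren \<phi> \<rho>)"
    using family_ball[OF vs c0 hm wf_ren[OF \<phi>(1)] as fvr l invr infr] by auto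
  have "R (e(j := x)) t" if "near K d x v" for x
    using key[OF near_closed[OF that tvd(3,2)] tvd(1)] ball[OF that] by blast
  then show ?thesis using tvd by blast
qed

end

context hmin
begin

section \<open>Large sets in several coordinates\<close>

lemmas defpred_intros = defpred_ex defpred_all defpred_and defpred_or defpred_imp defpred_neg defpred_eq defpred_near

lemma vary_empty: "e \<in> envs \<Longrightarrow> vary {} e = {e}"
  unfolding vary_def by auto

definition inf_many :: "nat \<Rightarrow> ((nat \<Rightarrow> 'k) \<Rightarrow> bool) \<Rightarrow> (nat \<Rightarrow> 'k) \<Rightarrow> bool" where
  "inf_many j P e \<longleftrightarrow> infinite {x \<in> carrier K. P (e(j := x))}"

lemma inf_many_mono:
  assumes "\<And>x. x \<in> carrier K \<Longrightarrow> P (e(j := x)) \<Longrightarrow> Q (e(j := x))" "inf_many j P e"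
  shows "inf_many j Q e"
proof -
  have "{x \<in> carrier K. P (e(j := x))} \<subseteq> {x \<in> carrier K. Q (e(j := x))}" using assms(1) by blast
  then show ?thesis using assms(2) unfolding inf_many_def by (rule infinite_super)
qed

lemma inf_many_ball:
  assumes "d \<in> carrier K" "d \<noteq> \<zero>" "y \<in> carrier K" "\<And>x. near K d x y \<Longrightarrow> P (e(j := x))"
  shows "inf_many j P e"
proof -
  have "{x. near K d x y} \<subseteq> {x \<in> carrier K. P (e(j := x))}" using assms near_closed by blast
  then show ?thesis using infinite_ball[OF c0 assms(1,2,3)] unfolding inf_many_def by (rule infinite_super)
qed

text \<open>
  The quantifier "for infinitely many" is definable, because an infinite definable set contains a
  ball. This is \<open>family_ball\<close> for a constant family.
\<close>

lemma inf_many_iff_ball: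
  assumes P: "defpred P" and e: "e \<in> envs"
  shows "inf_many j P e \<longleftrightarrow>
    (\<exists>y\<in>carrier K. \<exists>d\<in>carrier K. d \<noteq> \<zero> \<and> (\<forall>x\<in>carrier K. near K d x y \<longrightarrow> P (e(j := x))))"
proof
  assume i: "inf_many j P e"
  have "deffam (\<lambda>e _. P e)" unfolding deffam_def by (intro defpred_subst[OF P] simple_tm_var)
  moreover have "infinite {x \<in> carrier K. \<exists>t\<in>carrier K. P (e(j := x))}"
    using i zero_closed unfolding inf_many_def by (auto elim!: infinite_super[rotated])
  ultimately show "\<exists>y\<in>carrier K. \<exists>d\<in>carrier K. d \<noteq> \<zero> \<and> (\<forall>x\<in>carrier K. near K d x y \<longrightarrow> P (e(j := x)))"
    using ball_of_infinite_family[of "\<lambda>e _. P e" e \<one> j] e by auto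
next
  assume "\<exists>y\<in>carrier K. \<exists>d\<in>carrier K. d \<noteq> \<zero> \<and> (\<forall>x\<in>carrier K. near K d x y \<longrightarrow> P (e(j := x)))"
  then show "inf_many j P e" using inf_many_ball near_closed by blast
qed

lemma defpred_inf_many: assumes P: "defpred P" shows "defpred (inf_many j P)"
proof -
  have "defpred (\<lambda>e. \<exists>y\<in>carrier K. \<exists>d\<in>carrier K. d \<noteq> \<zero> \<and>
      (\<forall>x\<in>carrier K. near K d x y \<longrightarrow> P (e(j := x))))"
    by (intro defpred_intros defpred_subst[OF P] simple_tm_intros zero_closed)
  from iffD2[OF defpred_cong[OF inf_many_iff_ball[OF P]] this] show ?thesis .
qed

lemma deffam_inf_many: assumes "deffam R" shows "deffam (\<lambda>e t. inf_many j (\<lambda>e. R e t) e)"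
proof -
  have "(\<lambda>i. (e(Suc j := x)) (Suc i)) = (\<lambda>i. e (Suc i))(j := x)" for e :: "nat \<Rightarrow> 'k" and x by auto
  then have "inf_many j (\<lambda>e'. R e' (e 0)) (\<lambda>i. e (Suc i)) \<longleftrightarrow> inf_many (Suc j) (\<lambda>e. R (\<lambda>i. e (Suc i)) (e 0)) e" for e
    unfolding inf_many_def by simp
  then show ?thesis using defpred_inf_many[OF assms[unfolded deffam_def], of "Suc j"] unfolding deffam_def by simp
qed

text \<open>
  Iterated largeness: "for infinitely many \<open>x\<^sub>k\<close>, \<dots>, for infinitely many \<open>x\<^sub>1\<close>". This is a substitute
  for having dimension \<open>k\<close>, and properties of one-variable sets pass to it by induction.
\<close>

fun big :: "nat list \<Rightarrow> ((nat \<Rightarrow> 'k) \<Rightarrow> bool) \<Rightarrow> (nat \<Rightarrow> 'k) \<Rightarrow> bool" where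
  "big [] P e = P e"
| "big (j # js) P e = big js (inf_many j P) e"

lemma big_mono:
  assumes "\<And>e. e \<in> envs \<Longrightarrow> P e \<Longrightarrow> Q e" "e \<in> envs" "big js P e"
  shows "big js Q e"
  using assms
proof (induction js arbitrary: P Q)
  case (Cons j js)
  have "inf_many j Q f" if "f \<in> envs" "inf_many j P f" for f
    by (rule inf_many_mono[OF _ that(2)]) (rule Cons.prems(1)[OF envs_upd[OF that(1)]])
  then show ?case using Cons.IH[of "inf_many j P" "inf_many j Q"] Cons.prems by simp
qed simp

lemma big_or: "e \<in> envs \<Longrightarrow> big js (\<lambda>e. P e \<or> Q e) e \<Longrightarrow> big js P e \<or> big js Q e"
proof (induction js arbitrary: P Q)
  case (Cons j js)
  have "inf_many j (\<lambda>e. P e \<or> Q e) = (\<lambda>e. inf_many j P e \<or> inf_many j Q e)"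
    unfolding inf_many_def by (auto simp: fun_eq_iff conj_disj_distribL Collect_disj_eq)
  then show ?case using Cons by simp
qed simp

lemma big_nonempty: "e \<in> envs \<Longrightarrow> big js P e \<Longrightarrow> \<exists>f\<in>envs. P f"
proof (induction js arbitrary: P)
  case (Cons j js)
  then obtain f where f: "f \<in> envs" "inf_many j P f" by auto
  then obtain x where "x \<in> carrier K" "P (f(j := x))"
    unfolding inf_many_def using infinite_imp_nonempty by blast
  then show ?case using f by (intro bexI[of _ "f(j := x)"]) (simp_all del: fun_upd_apply)
qed auto

lemma big_upd: "j \<notin> set js \<Longrightarrow> big js (\<lambda>f. P (f(j := x))) e \<longleftrightarrow> big js P (e(j := x))"
proof (induction js arbitrary: P)
  case (Cons i js)
  have "inf_many i (\<lambda>f. P (f(j := x))) = (\<lambda>f. inf_many i P (f(j := x)))"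
    using Cons.prems unfolding inf_many_def by (simp add: fun_upd_twist)
  then show ?case using Cons by (simp del: fun_upd_apply)
qed simp

text \<open>
  The selection principle for families whose members depend on their index only up to the relation
  \<open>r\<close>: if the union of the members is infinite, so is some member.
\<close>

definition selects :: "('k \<Rightarrow> 'k \<Rightarrow> bool) \<Rightarrow> bool" where
  "selects r \<longleftrightarrow> (\<forall>R j e. deffam R \<longrightarrow> e \<in> envs \<longrightarrow>
     (\<forall>f\<in>envs. \<forall>t\<in>carrier K. \<forall>t'\<in>carrier K. r t t' \<longrightarrow> (R f t \<longleftrightarrow> R f t')) \<longrightarrow>
     inf_many j (\<lambda>e. \<exists>t\<in>carrier K. R e t) e \<longrightarrow> (\<exists>t\<in>carrier K. inf_many j (\<lambda>e. R e t) e))"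

lemma selectsD:
  assumes "selects r" "deffam R" "e \<in> envs"
    and "\<And>f t t'. f \<in> envs \<Longrightarrow> t \<in> carrier K \<Longrightarrow> t' \<in> carrier K \<Longrightarrow> r t t' \<Longrightarrow> R f t \<longleftrightarrow> R f t'"
    and "inf_many j (\<lambda>e. \<exists>t\<in>carrier K. R e t) e"
  shows "\<exists>t\<in>carrier K. inf_many j (\<lambda>e. R e t) e"
proof -
  have "\<forall>f\<in>envs. \<forall>t\<in>carrier K. \<forall>t'\<in>carrier K. r t t' \<longrightarrow> (R f t \<longleftrightarrow> R f t')"
    using assms(4) by blast
  with assms(1-3,5) show ?thesis unfolding selects_def by (elim allE impE) assumption+
qed

text \<open>
  Families indexed by values. A value is determined by a class in \<open>RV\<^sub>1\<close>, because
  \<open>1 + c\<close> is a unit for \<open>c\<close> in the maximal ideal.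
\<close>

lemma selects_units: "selects (\<lambda>t t'. \<exists>u\<in>vunits K. t' = t \<otimes> u)"
  unfolding selects_def
proof (intro allI impI)
  fix R j e
  assume R: "deffam R" and e: "e \<in> envs"
    and inv: "\<forall>f\<in>envs. \<forall>t\<in>carrier K. \<forall>t'\<in>carrier K. (\<exists>u\<in>vunits K. t' = t \<otimes> u) \<longrightarrow> (R f t \<longleftrightarrow> R f t')"
    and i: "inf_many j (\<lambda>e. \<exists>t\<in>carrier K. R e t) e"
  have iv: "R (e(j := x)) (t \<otimes> (\<one> \<oplus> c \<otimes> \<one>)) \<longleftrightarrow> R (e(j := x)) t"
    if "x \<in> carrier K" "t \<in> carrier K" "c \<in> vmax K" for x t c
  proof -
    have u: "\<one> \<oplus> c \<otimes> \<one> \<in> vunits K" using one_plus_vmax[OF that(3)] vmax_valring[OF that(3)] by simp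
    have "t \<otimes> (\<one> \<oplus> c \<otimes> \<one>) \<in> carrier K" using that(2) vunits_valring[OF u] by simp
    then show ?thesis using inv[rule_format, OF envs_upd[OF e that(1)] that(2)] u by blast
  qed
  then obtain t v d where "t \<in> carrier K" "v \<in> carrier K" "d \<in> carrier K" "d \<noteq> \<zero>"
    "\<forall>x. near K d x v \<longrightarrow> R (e(j := x)) t"
    using ball_of_infinite_family[OF R e valring_one one_not_zero iv i[unfolded inf_many_def]]
    by (auto simp del: fun_upd_apply)
  then show "\<exists>t\<in>carrier K. inf_many j (\<lambda>e. R e t) e"
    using inf_many_ball[of d v "\<lambda>e. R e t" e j] by blast
qed

lemma near_zero: "s \<in> carrier K \<Longrightarrow> near K s t \<zero> \<longleftrightarrow> (\<exists>y\<in>valring K. t = s \<otimes> y)"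
  unfolding near_def by auto

lemma near_unit: assumes "u \<in> vunits K" "s \<in> carrier K" shows "near K (s \<otimes> u) x y \<longleftrightarrow> near K s x y"
proof -
  have u: "u \<in> valring K" "inv u \<in> valring K" "u \<noteq> \<zero>" using assms by (auto simp: vunits_iff)
  have uc: "u \<in> carrier K" "inv u \<in> carrier K" using u by auto
  have "s = inv u \<otimes> (s \<otimes> u)"
  proof -
    have "inv u \<otimes> (s \<otimes> u) = s \<otimes> (u \<otimes> inv u)" using uc assms(2) by (simp add: m_ac)
    then show ?thesis using u uc assms(2) by simp
  qed
  moreover have "s \<otimes> u = u \<otimes> s" using uc assms(2) by (simp add: m_comm)
  moreover have "s \<otimes> u \<in> carrier K" using uc assms(2) by simp
  ultimately show ?thesis using near_mono u assms(2) by metis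
qed

text \<open>
  Families indexed by balls of radius \<open>\<bar>l\<bar>\<close>. The previous principle bounds the value of the index
  by that of some \<open>s\<close>. Below this bound, \<open>t\<close> and \<open>t (1 + c l')\<close> with \<open>l' = l / s\<close> differ by a multiple of
  \<open>l\<close>, so a ball of radius \<open>\<bar>l\<bar>\<close> is a union of classes in \<open>RV\<close> at the value of \<open>l'\<close>.
\<close>

lemma selects_near:
  assumes l: "l \<in> carrier K" "l \<noteq> \<zero>"
  shows "selects (near K l)"
  unfolding selects_def
proof (intro allI impI)
  fix R j e
  assume R: "deffam R" and e: "e \<in> envs"
    and inv: "\<forall>f\<in>envs. \<forall>t\<in>carrier K. \<forall>t'\<in>carrier K. near K l t t' \<longrightarrow> (R f t \<longleftrightarrow> R f t')"
    and i: "inf_many j (\<lambda>e. \<exists>t\<in>carrier K. R e t) e"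
  define R2 where "R2 f s \<longleftrightarrow> s \<noteq> \<zero> \<and> (\<exists>t\<in>carrier K. near K s t \<zero> \<and> R f t)" for f s
  have R2: "deffam R2" unfolding R2_def deffam_def
    by (intro defpred_intros deffam_inst[OF R] simple_tm_intros zero_closed)
  have inv2: "R2 f s \<longleftrightarrow> R2 f s'"
    if "f \<in> envs" "s \<in> carrier K" "s' \<in> carrier K" and ex: "\<exists>u\<in>vunits K. s' = s \<otimes> u" for f s s'
  proof -
    obtain u where u: "u \<in> vunits K" "s' = s \<otimes> u" using ex by blast
    then have "u \<in> carrier K" "u \<noteq> \<zero>" by (auto simp: vunits_iff)
    then show ?thesis unfolding R2_def u(2) near_unit[OF u(1) that(2)] using that(2) by simp
  qed
  have i2: "inf_many j (\<lambda>e. \<exists>s\<in>carrier K. R2 e s) e"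
  proof (rule inf_many_mono[OF _ i])
    fix x assume "\<exists>t\<in>carrier K. R (e(j := x)) t"
    then obtain t where t: "t \<in> carrier K" "R (e(j := x)) t" by blast
    define s where "s = (if t = \<zero> then \<one> else t)"
    have s: "s \<in> carrier K" "s \<noteq> \<zero>" using t by (auto simp: s_def)
    have "near K s t \<zero>" unfolding near_zero[OF s(1)]
    proof (cases "t = \<zero>")
      case True
      then show "\<exists>y\<in>valring K. t = s \<otimes> y" using s by (intro bexI[of _ \<zero>]) auto
    next
      case False
      then show "\<exists>y\<in>valring K. t = s \<otimes> y" using t by (intro bexI[of _ \<one>]) (auto simp: s_def)
    qed
    then show "\<exists>s\<in>carrier K. R2 (e(j := x)) s" unfolding R2_def using s t by blast
  qed
  obtain s where s: "s \<in> carrier K" "inf_many j (\<lambda>e. R2 e s) e"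
    using selectsD[OF selects_units R2 e inv2 i2] by blast
  then have s0: "s \<noteq> \<zero>" unfolding inf_many_def R2_def using infinite_imp_nonempty by blast
  define R3 where "R3 f t \<longleftrightarrow> near K s t \<zero> \<and> R f t" for f t
  have R3: "deffam R3" unfolding R3_def deffam_def
    by (intro defpred_intros defpred_subst[OF R[unfolded deffam_def]] simple_tm_intros zero_closed s(1))
  have i3: "inf_many j (\<lambda>e. \<exists>t\<in>carrier K. R3 e t) e"
    using s(2) by (rule inf_many_mono[rotated]) (auto simp: R2_def R3_def)
  \<comment> \<open>If \<open>l / s\<close> is not integral, then \<open>s\<close> is a multiple of \<open>l\<close> and \<open>l' = 1\<close> will do.\<close>
  obtain l' c' where l': "l' \<in> valring K" "l' \<noteq> \<zero>" "c' \<in> valring K" "s \<otimes> l' = l \<otimes> c'"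
  proof (cases "\<exists>c\<in>valring K. l = c \<otimes> s")
    case True
    then obtain c where c: "c \<in> valring K" "l = c \<otimes> s" by blast
    then have "c \<noteq> \<zero>" using l s by auto
    moreover have "s \<otimes> c = l \<otimes> \<one>" using c s l by (simp add: m_comm)
    ultimately show ?thesis using that c valring_one by blast
  next
    case False
    then obtain c where c: "c \<in> valring K" "s = c \<otimes> l" using div_total[OF l(1) s(1)] by blast
    then have "s \<otimes> \<one> = l \<otimes> c" using s l by (simp add: m_comm)
    then show ?thesis using that c valring_one one_not_zero by blast
  qed
  have iv: "R3 (e(j := x)) (t \<otimes> (\<one> \<oplus> c \<otimes> l')) \<longleftrightarrow> R3 (e(j := x)) t"
    if x: "x \<in> carrier K" and t: "t \<in> carrier K" and c: "c \<in> vmax K" for x t c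
  proof -
    define w where "w = \<one> \<oplus> c \<otimes> l'"
    have w: "w \<in> vunits K" unfolding w_def using one_plus_vmax vmax_mult c l'(1) by blast
    then have wv: "w \<in> valring K" "inv w \<in> valring K" "w \<noteq> \<zero>" by (auto simp: vunits_iff)
    have cc: "c \<in> valring K" using c vmax_valring by blast
    have tw: "t \<otimes> w \<in> carrier K" using t wv by simp
    have a: "near K s (t \<otimes> w) \<zero>" if nr: "near K s t \<zero>"
    proof -
      obtain y where "y \<in> valring K" "t = s \<otimes> y" using nr unfolding near_zero[OF s(1)] by blast
      then show ?thesis unfolding near_zero[OF s(1)] using wv s
        by (intro bexI[of _ "y \<otimes> w"]) (auto simp: m_assoc)
    qed
    have b: "near K s t \<zero>" if nr: "near K s (t \<otimes> w) \<zero>"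
    proof -
      obtain y where y: "y \<in> valring K" "t \<otimes> w = s \<otimes> y" using nr unfolding near_zero[OF s(1)] by blast
      have "t = t \<otimes> w \<otimes> inv w" using t wv by (simp add: m_assoc)
      also have "\<dots> = s \<otimes> (y \<otimes> inv w)" unfolding y(2) using s y wv by (simp add: m_assoc)
      finally show ?thesis unfolding near_zero[OF s(1)] using y wv by auto
    qed
    have d: "near K l (t \<otimes> w) t" if nr: "near K s t \<zero>"
    proof -
      obtain y where y: "y \<in> valring K" "t = s \<otimes> y" using nr unfolding near_zero[OF s(1)] by blast
      have "t \<otimes> w = t \<oplus> (s \<otimes> l') \<otimes> (y \<otimes> c)" unfolding w_def y(2)
        using s(1) valring_closed[OF y(1)] valring_closed[OF cc] valring_closed[OF l'(1)] by algebra
      also have "\<dots> = t \<oplus> l \<otimes> (c' \<otimes> (y \<otimes> c))" unfolding l'(4)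
        using l(1) valring_closed[OF y(1)] valring_closed[OF cc] valring_closed[OF l'(3)] t by algebra
      finally show ?thesis unfolding near_def using y cc l' by auto
    qed
    have "R (e(j := x)) (t \<otimes> w) \<longleftrightarrow> R (e(j := x)) t" if "near K s t \<zero>"
      using inv e x t tw d[OF that] envs_upd by blast
    then show ?thesis unfolding R3_def w_def[symmetric] using a b by blast
  qed
  then obtain t v d where "t \<in> carrier K" "v \<in> carrier K" "d \<in> carrier K" "d \<noteq> \<zero>"
    "\<forall>x. near K d x v \<longrightarrow> R3 (e(j := x)) t"
    using ball_of_infinite_family[OF R3 e l'(1,2) iv i3[unfolded inf_many_def]]
    by (auto simp del: fun_upd_apply)
  then show "\<exists>t\<in>carrier K. inf_many j (\<lambda>e. R e t) e"
    unfolding R3_def using inf_many_ball[of d v "\<lambda>e. R e t" e j] by blast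
qed

text \<open>
  Selection commutes with the quantifiers "for infinitely many" one at a time: applied to the
  innermost one, it replaces the family by the family of the sets of points over which the member is
  infinite.
\<close>

lemma big_select:
  assumes r: "selects r" and R: "deffam R" and e: "e \<in> envs"
    and inv: "\<And>f t t'. f \<in> envs \<Longrightarrow> t \<in> carrier K \<Longrightarrow> t' \<in> carrier K \<Longrightarrow> r t t' \<Longrightarrow> R f t \<longleftrightarrow> R f t'"
    and B: "big js (\<lambda>e. \<exists>t\<in>carrier K. R e t) e"
  shows "\<exists>t\<in>carrier K. big js (\<lambda>e. R e t) e"
  using R inv B
proof (induction js arbitrary: R)
  case (Cons j js)
  define R' where "R' e t = inf_many j (\<lambda>e. R e t) e" for e t
  have "deffam R'" unfolding R'_def by (rule deffam_inf_many[OF Cons.prems(1)])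
  moreover have "R' f t \<longleftrightarrow> R' f t'" if "f \<in> envs" "t \<in> carrier K" "t' \<in> carrier K" "r t t'" for f t t'
  proof -
    have "R (f(j := x)) t \<longleftrightarrow> R (f(j := x)) t'" if "x \<in> carrier K" for x
      by (rule Cons.prems(2)[OF envs_upd[OF \<open>f \<in> envs\<close> that] \<open>t \<in> _\<close> \<open>t' \<in> _\<close> \<open>r t t'\<close>])
    then have "{x \<in> carrier K. R (f(j := x)) t} = {x \<in> carrier K. R (f(j := x)) t'}" by blast
    then show ?thesis unfolding R'_def inf_many_def by (rule arg_cong)
  qed
  moreover have "big js (\<lambda>e. \<exists>t\<in>carrier K. R' e t) e"
  proof (rule big_mono[OF _ e])
    show "big js (inf_many j (\<lambda>e. \<exists>t\<in>carrier K. R e t)) e" using Cons.prems(3) by simp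
    fix f assume f: "f \<in> envs" "inf_many j (\<lambda>e. \<exists>t\<in>carrier K. R e t) f"
    show "\<exists>t\<in>carrier K. R' f t"
      unfolding R'_def by (rule selectsD[OF r Cons.prems(1) f(1) Cons.prems(2) f(2)])
  qed
  ultimately have "\<exists>t\<in>carrier K. big js (\<lambda>e. R' e t) e" by (rule Cons.IH)
  then show ?case unfolding R'_def by simp
qed simp

text \<open>
  A large set has nonempty interior. Over infinitely many points of the remaining coordinates
  the fibre contains a ball; selecting first its radius and then the ball itself, one may assume that it
  is the same ball over all points of a large set, and this set contains a box by induction.
\<close>

lemma big_box:
  assumes "defpred P" "e \<in> envs" "distinct js" "big js P e"
  shows "\<exists>f\<in>vary (set js) e. \<exists>d\<in>carrier K. d \<noteq> \<zero> \<and>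
    (\<forall>g\<in>vary (set js) e. (\<forall>i\<in>set js. near K d (g i) (f i)) \<longrightarrow> P g)"
  using assms
proof (induction js arbitrary: P)
  case Nil
  then have "vary (set []) e = {e}" unfolding vary_def by auto
  then show ?case using Nil one_not_zero by (intro bexI[of _ e] bexI[of _ \<one>]) auto
next
  case (Cons j js)
  note P = Cons.prems(1) and e = Cons.prems(2)
  define R2 where "R2 d f y \<longleftrightarrow> (\<forall>x\<in>carrier K. near K d x y \<longrightarrow> P (f(j := x)))" for d f y
  define R1 where "R1 f d \<longleftrightarrow> d \<noteq> \<zero> \<and> (\<exists>y\<in>carrier K. R2 d f y)" for f d
  have "deffam R1" unfolding deffam_def R1_def R2_def
    by (intro defpred_intros defpred_subst[OF P] simple_tm_intros zero_closed)
  moreover have "R1 f d \<longleftrightarrow> R1 f d'"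
    if "f \<in> envs" "d \<in> carrier K" "d' \<in> carrier K" and ex: "\<exists>u\<in>vunits K. d' = d \<otimes> u" for f d d'
  proof -
    obtain u where u: "u \<in> vunits K" "d' = d \<otimes> u" using ex by blast
    then have "u \<in> carrier K" "u \<noteq> \<zero>" by (auto simp: vunits_iff)
    then show ?thesis unfolding R1_def R2_def u(2) near_unit[OF u(1) that(2)] using that(2) by simp
  qed
  moreover have "big js (\<lambda>e. \<exists>d\<in>carrier K. R1 e d) e"
  proof (rule big_mono[OF _ e])
    show "big js (inf_many j P) e" using Cons.prems by simp
    fix f assume "f \<in> envs" "inf_many j P f"
    then show "\<exists>d\<in>carrier K. R1 f d" unfolding R1_def R2_def using inf_many_iff_ball[OF P] by blast
  qed
  ultimately have "\<exists>d\<in>carrier K. big js (\<lambda>f. R1 f d) e"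
    by (rule big_select[OF selects_units _ e])
  then obtain d where d: "d \<in> carrier K" "big js (\<lambda>f. R1 f d) e" by blast
  have d0: "d \<noteq> \<zero>" using big_nonempty[OF e d(2)] unfolding R1_def by blast
  have R2: "deffam (R2 d)" unfolding deffam_def R2_def
    by (intro defpred_intros defpred_subst[OF P] simple_tm_intros d(1))
  moreover have "R2 d f y \<longleftrightarrow> R2 d f y'"
    if "f \<in> envs" "y \<in> carrier K" "y' \<in> carrier K" "near K d y y'" for f y y'
  proof -
    have "near K d x y \<longleftrightarrow> near K d x y'" if "x \<in> carrier K" for x
      using near_trans[OF d(1)] near_sym[OF d(1)] that \<open>near K d y y'\<close> \<open>y \<in> _\<close> \<open>y' \<in> _\<close> by blast
    then show ?thesis unfolding R2_def by auto
  qed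
  moreover have "big js (\<lambda>e. \<exists>y\<in>carrier K. R2 d e y) e"
    by (rule big_mono[OF _ e d(2)]) (auto simp: R1_def)
  ultimately have "\<exists>y\<in>carrier K. big js (\<lambda>f. R2 d f y) e"
    by (rule big_select[OF selects_near[OF d(1) d0] _ e])
  then obtain y where y: "y \<in> carrier K" "big js (\<lambda>f. R2 d f y) e" by blast
  have "defpred (\<lambda>f. R2 d f y)" by (rule deffam_inst[OF R2 simple_tm_var simple_tm_const[OF y(1)]])
  then obtain f' d' where f': "f' \<in> vary (set js) e" and d': "d' \<in> carrier K" "d' \<noteq> \<zero>"
    and box: "\<forall>g\<in>vary (set js) e. (\<forall>i\<in>set js. near K d' (g i) (f' i)) \<longrightarrow> R2 d g y"
    using Cons.IH[OF _ e _ y(2)] Cons.prems(3) by auto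
  obtain b where b: "b \<in> carrier K" "b \<noteq> \<zero>"
    "\<And>x z. near K b x z \<Longrightarrow> near K d x z" "\<And>x z. near K b x z \<Longrightarrow> near K d' x z"
    using near_min2[OF d(1) d0 d'] by blast
  show ?case
  proof (intro bexI[of _ "f'(j := y)"] bexI[of _ b] conjI ballI impI)
    show "f'(j := y) \<in> vary (set (j # js)) e" using f' y unfolding vary_def by auto
    show "b \<in> carrier K" "b \<noteq> \<zero>" by (rule b)+
    fix g assume g: "g \<in> vary (set (j # js)) e" and nr: "\<forall>i\<in>set (j # js). near K b (g i) ((f'(j := y)) i)"
    have gE: "g \<in> envs" using g unfolding vary_def by blast
    have "g(j := e j) \<in> vary (set js) e" using g e unfolding vary_def by auto
    moreover have "near K d' ((g(j := e j)) i) (f' i)" if "i \<in> set js" for i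
    proof -
      have "i \<noteq> j" using that Cons.prems(3) by auto
      then show ?thesis using nr that b(4) by auto
    qed
    ultimately have "R2 d (g(j := e j)) y" using box by blast
    moreover have "near K d (g j) y" using nr b(3) by auto
    ultimately show "P g" unfolding R2_def using envs_closed[OF gE, of j] by auto
  qed
qed

text \<open>
  If over each point of a large set there is a point satisfying \<open>S\<close>, and \<open>S\<close> does not change within
  balls of radius \<open>\<bar>l\<bar>\<close> in the coordinates \<open>J\<close>, then a fixed choice of the coordinates in \<open>J\<close> works on
  a large set. The coordinates in \<open>J\<close> are selected one by one.
\<close>

lemma big_vary:
  assumes "finite J" "set js \<inter> J = {}" "defpred S" "z \<in> envs" and l: "l \<in> carrier K" "l \<noteq> \<zero>"
    and inv: "\<And>g j x. g \<in> envs \<Longrightarrow> j \<in> J \<Longrightarrow> x \<in> carrier K \<Longrightarrow> near K l (g j) x \<Longrightarrow> S (g(j := x)) \<longleftrightarrow> S g"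
    and B: "big js (\<lambda>f. \<exists>g\<in>vary J f. S g) z"
  shows "\<exists>z'\<in>vary J z. big js S z'"
  using assms(1,2,4) inv B
proof (induction J arbitrary: z)
  case empty
  have "big js S z"
    by (rule big_mono[OF _ empty.prems(2,4)]) (simp add: vary_empty)
  then show ?case using empty.prems unfolding vary_def by auto
next
  case (insert j J)
  note S = \<open>defpred S\<close>
  define R where "R f x \<longleftrightarrow> (\<exists>g\<in>vary J (f(j := x)). S g)" for f x
  have "deffam R" unfolding deffam_def R_def
    by (intro defpred_subst[OF defpred_vary1[OF insert.hyps(1) S]] simple_tm_intros)
  moreover have "R f x \<longleftrightarrow> R f x'"
    if f: "f \<in> envs" and x: "x \<in> carrier K" "x' \<in> carrier K" and nr: "near K l x x'" for f x x'
  proof -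
    have *: "R f x'" if "R f x" and x: "x \<in> carrier K" "x' \<in> carrier K" and nr: "near K l x x'" for x x'
    proof -
      obtain g where g: "g \<in> envs" "\<And>i. i \<notin> J \<Longrightarrow> g i = (f(j := x)) i" "S g"
        using \<open>R f x\<close> unfolding R_def vary_def by blast
      have "g j = x" using g(2)[of j] insert.hyps by simp
      then have "S (g(j := x'))" using insert.prems(3)[of g j x'] g x nr by blast
      moreover have "g(j := x') \<in> vary J (f(j := x'))" unfolding vary_def using g x by auto
      ultimately show ?thesis unfolding R_def by blast
    qed
    show ?thesis using *[of x x'] *[of x' x] x nr near_sym[OF l(1)] by blast
  qed
  moreover have "big js (\<lambda>f. \<exists>x\<in>carrier K. R f x) z"
  proof (rule big_mono[OF _ insert.prems(2,4)])
    fix f assume "f \<in> envs" "\<exists>g\<in>vary (insert j J) f. S g"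
    then obtain g where g: "g \<in> envs" "\<And>i. i \<notin> insert j J \<Longrightarrow> g i = f i" "S g" unfolding vary_def by blast
    then have "g \<in> vary J (f(j := g j))" unfolding vary_def by auto
    then show "\<exists>x\<in>carrier K. R f x" unfolding R_def using g by (intro bexI[of _ "g j"]) auto
  qed
  ultimately have "\<exists>x\<in>carrier K. big js (\<lambda>f. R f x) z"
    by (rule big_select[OF selects_near[OF l] _ insert.prems(2)])
  then obtain x where x: "x \<in> carrier K" "big js (\<lambda>f. R f x) z" by blast
  have "big js (\<lambda>f. \<exists>g\<in>vary J f. S g) (z(j := x))"
    using x(2) big_upd[of j js "\<lambda>f. \<exists>g\<in>vary J f. S g" x z] insert.prems(1) unfolding R_def
    by blast
  then obtain z' where "z' \<in> vary J (z(j := x))" "big js S z'"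
    using insert.IH[of "z(j := x)", OF _ envs_upd[OF insert.prems(2) x(1)] insert.prems(3)] insert.prems(1)
    by blast
  moreover from this have "z' \<in> vary (insert j J) z" unfolding vary_def by auto
  ultimately show ?case by blast
qed

end

context hmin
begin

section \<open>Closures of definable sets\<close>

text \<open>
  Membership in the closure with respect to the first \<open>n\<close> coordinates.
\<close>

definition adherent :: "nat \<Rightarrow> ((nat \<Rightarrow> 'k) \<Rightarrow> bool) \<Rightarrow> (nat \<Rightarrow> 'k) \<Rightarrow> bool" where
  "adherent n P g \<longleftrightarrow> (\<forall>d\<in>carrier K. d \<noteq> \<zero> \<longrightarrow>
     (\<exists>h\<in>vary {..<n} g. (\<forall>i\<in>{..<n}. near K d (h i) (g i)) \<and> P h))"

lemma vary_envs: "h \<in> vary J e \<Longrightarrow> h \<in> envs"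
  by (simp add: vary_def)

lemma vary_out: "h \<in> vary J e \<Longrightarrow> i \<notin> J \<Longrightarrow> h i = e i"
  by (simp add: vary_def)

lemma varyI: "h \<in> envs \<Longrightarrow> (\<And>i. i \<notin> J \<Longrightarrow> h i = e i) \<Longrightarrow> h \<in> vary J e"
  by (simp add: vary_def)

lemma defpred_adherent: assumes P: "defpred P" shows "defpred (adherent n P)"
proof -
  have "defpred (\<lambda>g. \<forall>d\<in>carrier K. d \<noteq> \<zero> \<longrightarrow>
     (\<exists>h\<in>vary {..<n} g. (\<forall>i\<in>{..<n}. near K d (h i) (g i)) \<and> P h))"
    by (intro defpred_intros defpred_vary defpred_ball_finite defpred_subst[OF P] simple_tm_intros zero_closed finite_lessThan)
  then show ?thesis unfolding adherent_def .
qed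

lemma adherent_superset: "g \<in> envs \<Longrightarrow> P g \<Longrightarrow> adherent n P g"
  unfolding adherent_def by (auto intro!: bexI[of _ g] simp: vary_def)

text \<open>
  Suppose that over a large set of base points \<open>f\<close> the closure of \<open>P\<close> has a point \<open>g\<close> outside \<open>P\<close>. The fibre
  is finite, so a ball of some radius \<open>\<bar>l\<bar>\<close> around \<open>g\<close> in the fibre misses \<open>P\<close>; this is condition \<open>S l\<close>. Select
  \<open>l\<close>, then the ball, independently of \<open>f\<close>: the condition then holds for all \<open>f\<close> in a box. One of
  the balls has an adherent point, so a point \<open>h\<close> of \<open>P\<close> near it lies in the same ball and over the
  same box. But the ball over the base point of \<open>h\<close> misses \<open>P\<close>.
\<close>

lemma boundary_small:
  assumes P: "defpred P" and js: "distinct js" "set js \<subseteq> {..<n}" and J: "J = {..<n} - set js"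
    and fin: "\<And>e. e \<in> envs \<Longrightarrow> finite {f \<in> vary J e. P f}" and z: "z \<in> envs"
  shows "\<not> big js (\<lambda>f. \<exists>g\<in>vary J f. adherent n P g \<and> \<not> P g) z"
proof
  assume B: "big js (\<lambda>f. \<exists>g\<in>vary J f. adherent n P g \<and> \<not> P g) z"
  obtain p where p: "p \<in> vmax K" "p \<noteq> \<zero>"
    using nonunit_exists hm unfolding one_h_minimal_def by blast
  have fJ: "finite J" and dJ: "set js \<inter> J = {}" unfolding J by auto
  \<comment> \<open>The first part is weaker than adherence of \<open>g\<close> itself, so that the condition depends only on the
    ball around \<open>g\<close> in the fibre.\<close>
  define S where "S l g \<longleftrightarrow> (\<exists>g'\<in>vary J g. (\<forall>i\<in>J. near K l (g' i) (g i)) \<and> adherent n P g') \<and>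
    \<not> (\<exists>h\<in>vary J g. (\<forall>i\<in>J. near K l (h i) (g i)) \<and> P h)" for l g
  define R where "R f l \<longleftrightarrow> l \<noteq> \<zero> \<and> (\<exists>g\<in>vary J f. S l g)" for f l
  have "deffam R" unfolding deffam_def R_def S_def
    by (intro defpred_intros defpred_vary defpred_ball_finite defpred_subst[OF P] defpred_subst[OF defpred_adherent[OF P]]
        simple_tm_intros zero_closed fJ)
  moreover have "R f l \<longleftrightarrow> R f l'"
    if "f \<in> envs" and l: "l \<in> carrier K" "l' \<in> carrier K" and ex: "\<exists>u\<in>vunits K. l' = l \<otimes> u" for f l l'
  proof -
    obtain u where u: "u \<in> vunits K" "l' = l \<otimes> u" using ex by blast
    then have "u \<in> carrier K" "u \<noteq> \<zero>" by (auto simp: vunits_iff)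
    then show ?thesis unfolding R_def S_def u(2) near_unit[OF u(1) l(1)] using l(1) by simp
  qed
  moreover have "big js (\<lambda>f. \<exists>l\<in>carrier K. R f l) z"
  proof (rule big_mono[OF _ z B])
    fix f assume "f \<in> envs" "\<exists>g\<in>vary J f. adherent n P g \<and> \<not> P g"
    then obtain g where g: "g \<in> vary J f" "adherent n P g" "\<not> P g" by blast
    have gE: "g \<in> envs" using g vary_envs by blast
    define A where "A = {h \<in> vary J g. P h}"
    have "\<exists>d. d \<in> carrier K \<and> d \<noteq> \<zero> \<and> (\<exists>i\<in>J. \<not> near K d (h i) (g i))" if h: "h \<in> A" for h
    proof -
      have "h \<noteq> g" using h g unfolding A_def by auto
      moreover have "h i = g i" if "i \<notin> J" for i using h that vary_out unfolding A_def by blast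
      ultimately obtain i where i: "i \<in> J" "h i \<noteq> g i" by (metis ext)
      have "h \<in> envs" using h vary_envs unfolding A_def by blast
      then have "h i \<in> carrier K" by simp
      then show ?thesis using near_separated[OF p, of "h i" "g i"] i gE by auto
    qed
    then obtain D where D: "\<And>h. h \<in> A \<Longrightarrow> D h \<in> carrier K \<and> D h \<noteq> \<zero>"
      "\<And>h. h \<in> A \<Longrightarrow> \<exists>i\<in>J. \<not> near K (D h) (h i) (g i)" by metis
    have "finite A" unfolding A_def by (rule fin[OF gE])
    then obtain l where l: "l \<in> carrier K" "l \<noteq> \<zero>" "\<forall>h\<in>A. \<forall>x y. near K l x y \<longrightarrow> near K (D h) x y"
      using near_min[of A D] D(1) by auto
    have "S l g" unfolding S_def
    proof
      show "\<exists>g'\<in>vary J g. (\<forall>i\<in>J. near K l (g' i) (g i)) \<and> adherent n P g'"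
        using g gE l by (intro bexI[of _ g]) (auto simp: vary_def)
      show "\<not> (\<exists>h\<in>vary J g. (\<forall>i\<in>J. near K l (h i) (g i)) \<and> P h)"
        using D(2) l(3) unfolding A_def by blast
    qed
    then show "\<exists>l\<in>carrier K. R f l" unfolding R_def using g l by blast
  qed
  ultimately have "\<exists>l\<in>carrier K. big js (\<lambda>f. R f l) z"
    by (rule big_select[OF selects_units _ z])
  then obtain l where l: "l \<in> carrier K" and Bl: "big js (\<lambda>f. R f l) z" by blast
  have l0: "l \<noteq> \<zero>" using big_nonempty[OF z Bl] unfolding R_def by blast
  have Sd: "defpred (S l)" unfolding S_def
    by (intro defpred_intros defpred_vary defpred_ball_finite defpred_subst[OF P] defpred_subst[OF defpred_adherent[OF P]]
        simple_tm_intros zero_closed fJ l)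
  have Sinv: "S l (g(j := x)) \<longleftrightarrow> S l g"
    if g: "g \<in> envs" and j: "j \<in> J" and x: "x \<in> carrier K" and nr: "near K l (g j) x" for g j x
  proof -
    have v: "vary J (g(j := x)) = vary J g" using j unfolding vary_def by auto
    have "near K l y (g j) \<longleftrightarrow> near K l y x" if "y \<in> carrier K" for y
      using near_trans[OF l, of _ y] near_trans[OF l envs_closed[OF g]] near_trans[OF l x]
        near_sym[OF l x nr] nr by blast
    then have "(\<forall>i\<in>J. near K l (h i) ((g(j := x)) i)) \<longleftrightarrow> (\<forall>i\<in>J. near K l (h i) (g i))" if "h \<in> envs" for h
      using that by auto
    then show ?thesis unfolding S_def v using vary_envs by blast
  qed
  have "big js (\<lambda>f. \<exists>g\<in>vary J f. S l g) z"
    by (rule big_mono[OF _ z Bl]) (auto simp: R_def)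
  then obtain z' where z': "z' \<in> vary J z" "big js (S l) z'"
    using big_vary[OF fJ dJ Sd z l l0 Sinv] by blast
  obtain f0 d where f0: "f0 \<in> vary (set js) z'" and d: "d \<in> carrier K" "d \<noteq> \<zero>"
    and box: "\<And>g. g \<in> vary (set js) z' \<Longrightarrow> (\<And>i. i \<in> set js \<Longrightarrow> near K d (g i) (f0 i)) \<Longrightarrow> S l g"
    using big_box[OF Sd vary_envs[OF z'(1)] js(1) z'(2)] by blast
  have f0E: "f0 \<in> envs" using f0 vary_envs by blast
  have "S l f0" using box[OF f0] d f0E by simp
  then obtain g' where g': "g' \<in> vary J f0" "\<And>i. i \<in> J \<Longrightarrow> near K l (g' i) (f0 i)" "adherent n P g'"
    unfolding S_def by blast
  obtain b where b: "b \<in> carrier K" "b \<noteq> \<zero>"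
    "\<And>x z. near K b x z \<Longrightarrow> near K d x z" "\<And>x z. near K b x z \<Longrightarrow> near K l x z"
    using near_min2[OF d l l0] by blast
  obtain h where h: "h \<in> vary {..<n} g'" "\<And>i. i < n \<Longrightarrow> near K b (h i) (g' i)" "P h"
    using g'(3) b(1,2) unfolding adherent_def by blast
  define f where "f i = (if i \<in> J then f0 i else h i)" for i
  have hE: "h \<in> envs" using h vary_envs by blast
  have fE: "f \<in> envs" using f0E hE by (simp add: envs_def f_def del: envs_closed)
  have "f \<in> vary (set js) z'"
  proof (rule varyI[OF fE])
    fix i assume i: "i \<notin> set js"
    show "f i = z' i"
    proof (cases "i \<in> J")
      case True
      then show ?thesis using vary_out[OF f0 i] by (simp add: f_def)
    next
      case False
      then have "i \<notin> {..<n}" using i J by auto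
      then show ?thesis using False vary_out[OF h(1)] vary_out[OF g'(1) False] vary_out[OF f0 i]
        by (simp add: f_def)
    qed
  qed
  moreover have "near K d (f i) (f0 i)" if "i \<in> set js" for i
  proof -
    have i: "i \<notin> J" "i < n" using that js J by auto
    then show ?thesis using b(3)[OF h(2)[OF i(2)]] vary_out[OF g'(1) i(1)] by (simp add: f_def)
  qed
  ultimately have "S l f" by (rule box)
  moreover have "h \<in> vary J f" by (rule varyI[OF hE]) (simp add: f_def)
  moreover have "near K l (h i) (f i)" if i: "i \<in> J" for i
  proof -
    have "i < n" using i J by auto
    then have "near K l (h i) (f0 i)"
      using near_trans[OF l envs_closed[OF f0E] b(4)[OF h(2)] g'(2)[OF i]] by blast
    then show ?thesis using i by (simp add: f_def)
  qed
  ultimately show False using h(3) unfolding S_def by blast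
qed

text \<open>
  The predicate does not depend on the coordinates in \<open>J\<close>: it describes a subset of the base.
\<close>

definition indep :: "nat set \<Rightarrow> ((nat \<Rightarrow> 'k) \<Rightarrow> bool) \<Rightarrow> bool" where
  "indep J P \<longleftrightarrow> (\<forall>e\<in>envs. \<forall>f\<in>vary J e. P f \<longleftrightarrow> P e)"

text \<open>
  If the closure of a small set contained a box, then the complement of the set would be large in
  the box and would contain a smaller box, which misses the closure.
\<close>

lemma closure_small:
  assumes D: "defpred D" and js: "distinct js" "set js \<subseteq> {..<n}" and J: "J = {..<n} - set js"
    and ind: "indep J D" and small: "\<And>z. z \<in> envs \<Longrightarrow> \<not> big js D z" and z: "z \<in> envs"
  shows "\<not> big js (adherent n D) z"
proof
  assume B0: "big js (adherent n D) z"
  have "big js (\<lambda>f. D f \<or> adherent n D f \<and> \<not> D f) z" by (rule big_mono[OF _ z B0]) blast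
  then have B: "big js (\<lambda>f. adherent n D f \<and> \<not> D f) z" 
    using big_or[OF z, of js D "\<lambda>f. adherent n D f \<and> \<not> D f"] small[OF z] by blast
  have "defpred (\<lambda>f. adherent n D f \<and> \<not> D f)" by (intro defpred_intros D defpred_adherent)
  then obtain f0 d where f0: "f0 \<in> vary (set js) z" and d: "d \<in> carrier K" "d \<noteq> \<zero>"
    and box: "\<And>g. g \<in> vary (set js) z \<Longrightarrow> (\<And>i. i \<in> set js \<Longrightarrow> near K d (g i) (f0 i)) \<Longrightarrow> adherent n D g \<and> \<not> D g"
    using big_box[OF _ z js(1) B] by blast
  have f0E: "f0 \<in> envs" using f0 vary_envs by blast
  have "adherent n D f0" using box[OF f0] d f0E by simp
  then obtain h where h: "h \<in> vary {..<n} f0" "\<And>i. i < n \<Longrightarrow> near K d (h i) (f0 i)" "D h"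
    using d unfolding adherent_def by blast
  define f where "f i = (if i \<in> set js then h i else z i)" for i
  have hE: "h \<in> envs" using h vary_envs by blast
  have fE: "f \<in> envs" using z hE by (simp add: envs_def f_def del: envs_closed)
  have "f \<in> vary (set js) z" by (rule varyI[OF fE]) (simp add: f_def)
  moreover have "near K d (f i) (f0 i)" if "i \<in> set js" for i
    using h(2)[of i] that js by (auto simp: f_def)
  ultimately have "\<not> D f" using box by blast
  moreover have "f \<in> vary J h"
  proof (rule varyI[OF fE])
    fix i assume "i \<notin> J"
    then show "f i = h i" using J vary_out[OF h(1), of i] vary_out[OF f0, of i] by (auto simp: f_def)
  qed
  ultimately show False using ind hE h(3) unfolding indep_def by blast
qed

lemma indep_adherent:
  assumes "indep J D" "J \<subseteq> {..<n}" shows "indep J (adherent n D)"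
proof -
  have *: "adherent n D f" if e: "e \<in> envs" and f: "f \<in> envs" "\<And>i. i \<notin> J \<Longrightarrow> f i = e i" and c: "adherent n D e" for e f
    unfolding adherent_def
  proof (intro ballI impI)
    fix d assume d: "d \<in> carrier K" "d \<noteq> \<zero>"
    obtain h where h: "h \<in> vary {..<n} e" "\<And>i. i < n \<Longrightarrow> near K d (h i) (e i)" "D h"
      using c d unfolding adherent_def by blast
    define h' where "h' i = (if i \<in> J then f i else h i)" for i
    have hE: "h \<in> envs" using h vary_envs by blast
    have h'envs: "h' \<in> envs" using f hE by (simp add: envs_def h'_def del: envs_closed)
    have "h' \<in> vary J h" by (rule varyI[OF h'envs]) (simp add: h'_def)
    then have "D h'" using assms(1) hE h(3) unfolding indep_def by blast
    moreover have "h' \<in> vary {..<n} f"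
      by (rule varyI[OF h'envs]) (use assms(2) f(2) vary_out[OF h(1)] in \<open>auto simp: h'_def\<close>)
    moreover have "near K d (h' i) (f i)" if "i < n" for i
      using h(2)[OF that] f d by (auto simp: h'_def)
    ultimately show "\<exists>h\<in>vary {..<n} f. (\<forall>i\<in>{..<n}. near K d (h i) (f i)) \<and> D h" by blast
  qed
  show ?thesis unfolding indep_def
  proof (intro ballI)
    fix e f assume e: "e \<in> envs" and f: "f \<in> vary J e"
    show "adherent n D f \<longleftrightarrow> adherent n D e"
      using *[OF e vary_envs[OF f] vary_out[OF f]] *[OF vary_envs[OF f] e vary_out[OF f, symmetric]] by blast
  qed
qed

lemma indep_vary_ex: "indep J (\<lambda>f. \<exists>g\<in>vary J f. Q g)"
  unfolding indep_def
proof (intro ballI)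
  fix e f assume "e \<in> envs" "f \<in> vary J e"
  then have "vary J f = vary J e" unfolding vary_def by auto
  then show "(\<exists>g\<in>vary J f. Q g) \<longleftrightarrow> (\<exists>g\<in>vary J e. Q g)" by simp
qed

lemma indep_inf_many: assumes "indep J P" "j \<notin> J" shows "indep J (inf_many j P)"
  unfolding indep_def
proof (intro ballI)
  fix e f assume e: "e \<in> envs" and f: "f \<in> vary J e"
  have "P (f(j := x)) \<longleftrightarrow> P (e(j := x))" if x: "x \<in> carrier K" for x
  proof -
    have "f(j := x) \<in> vary J (e(j := x))"
      using f vary_out[OF f] by (intro varyI envs_upd[OF vary_envs[OF f] x]) auto
    then show ?thesis using assms(1) envs_upd[OF e x] unfolding indep_def by blast
  qed
  then have "{x \<in> carrier K. P (f(j := x))} = {x \<in> carrier K. P (e(j := x))}" by blast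
  then show "inf_many j P f \<longleftrightarrow> inf_many j P e" unfolding inf_many_def by simp
qed

section \<open>Borel sets\<close>

text \<open>
  Points of \<open>K\<^sup>n\<close> are undefined outside \<open>{..<n}\<close>; as assignments they are continued by zero.
\<close>

definition pad :: "nat \<Rightarrow> (nat \<Rightarrow> 'k) \<Rightarrow> nat \<Rightarrow> 'k" where
  "pad n x i = (if i < n then x i else \<zero>)"

definition pts :: "nat \<Rightarrow> ((nat \<Rightarrow> 'k) \<Rightarrow> bool) \<Rightarrow> (nat \<Rightarrow> 'k) set" where
  "pts n P = {x \<in> {..<n} \<rightarrow>\<^sub>E carrier K. P (pad n x)}"

lemma pad_envs: "x \<in> {..<n} \<rightarrow>\<^sub>E carrier K \<Longrightarrow> pad n x \<in> envs"
  by (auto simp: envs_def pad_def PiE_iff simp del: envs_closed)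

lemma vball_absval:
  assumes "d \<in> carrier K" "d \<noteq> \<zero>" "a \<in> carrier K"
  shows "a \<in> vball K a (absval K d)" "x \<in> vball K a (absval K d) \<Longrightarrow> near K d x a"
proof -
  have a: "a \<ominus> a = \<zero>" using assms by (simp add: r_right_minus_eq)
  have "\<zero> = \<zero> \<otimes> d" using assms by simp
  then have "vless K (absval K \<zero>) (absval K d)"
    unfolding vless_absval[OF zero_closed assms(1,2)] using zero_vmax by blast
  then show "a \<in> vball K a (absval K d)" unfolding vball_def mem_Collect_eq a using assms by blast
  assume x: "x \<in> vball K a (absval K d)"
  then have xc: "x \<in> carrier K" unfolding vball_def by blast
  then obtain c where c: "c \<in> vmax K" "x \<ominus> a = c \<otimes> d"
    using x vless_absval[of "x \<ominus> a" d] assms unfolding vball_def by auto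
  have cv: "c \<in> valring K" using c vmax_valring by blast
  have "x = a \<oplus> (x \<ominus> a)" using xc assms(3) by algebra
  also have "\<dots> = a \<oplus> d \<otimes> c" unfolding c(2) using cv assms by (simp add: m_comm)
  finally show "near K d x a" unfolding near_def using cv by blast
qed

lemma topspace_valuation: "topspace (valuation_topology K) = carrier K"
proof -
  have "absval K \<one> \<in> value_group K" unfolding value_group_def by auto
  then have "a \<in> \<Union> {vball K a \<gamma> |a \<gamma>. a \<in> carrier K \<and> \<gamma> \<in> value_group K}" if "a \<in> carrier K" for a
    using vball_absval(1)[OF one_closed one_not_zero that] that by blast
  moreover have "\<Union> {vball K a \<gamma> |a \<gamma>. a \<in> carrier K \<and> \<gamma> \<in> value_group K} \<subseteq> carrier K"
    unfolding vball_def by auto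
  ultimately show ?thesis unfolding valuation_topology_def topology_generated_by_topspace by blast
qed

lemma topspace_power: "topspace (power_topology K n) = {..<n} \<rightarrow>\<^sub>E carrier K"
  by (simp add: power_topology_def topspace_valuation)

text \<open>
  Every ball contains an open ball with the same centre, whence a set which contains a box around
  each of its points is open.
\<close>

lemma openin_pts:
  assumes "\<And>e. e \<in> envs \<Longrightarrow> P e \<Longrightarrow> \<exists>d\<in>carrier K. d \<noteq> \<zero> \<and>
    (\<forall>h\<in>vary {..<n} e. (\<forall>i\<in>{..<n}. near K d (h i) (e i)) \<longrightarrow> P h)"
  shows "openin (power_topology K n) (pts n P)"
proof (subst openin_subopen, rule ballI)
  fix x assume "x \<in> pts n P"
  then have x: "x \<in> {..<n} \<rightarrow>\<^sub>E carrier K" "P (pad n x)" unfolding pts_def by auto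
  obtain d where d: "d \<in> carrier K" "d \<noteq> \<zero>" and
    box: "\<And>h. h \<in> vary {..<n} (pad n x) \<Longrightarrow> (\<And>i. i < n \<Longrightarrow> near K d (h i) (pad n x i)) \<Longrightarrow> P h"
    using assms[OF pad_envs[OF x(1)] x(2)] by blast
  have xc: "x i \<in> carrier K" if "i < n" for i using x that by auto
  define U where "U = (\<Pi>\<^sub>E i\<in>{..<n}. vball K (x i) (absval K d))"
  have "openin (valuation_topology K) (vball K (x i) (absval K d))" if "i < n" for i
    unfolding valuation_topology_def
    by (rule topology_generated_by_Basis) (use d xc[OF that] in \<open>auto simp: value_group_def\<close>)
  then have "openin (power_topology K n) U"
    unfolding power_topology_def U_def by (subst openin_PiE) auto
  moreover have "x \<in> U" unfolding U_def using x vball_absval(1)[OF d] by (auto simp: PiE_iff)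
  moreover have "U \<subseteq> pts n P"
  proof
    fix y assume y: "y \<in> U"
    have nr: "near K d (y i) (x i)" if "i < n" for i
      using y vball_absval(2)[OF d xc[OF that]] that unfolding U_def by (auto simp: PiE_iff)
    have yc: "y \<in> {..<n} \<rightarrow>\<^sub>E carrier K" using y unfolding U_def vball_def by (auto simp: PiE_iff)
    have "pad n y \<in> vary {..<n} (pad n x)" by (rule varyI[OF pad_envs[OF yc]]) (simp add: pad_def)
    then have "P (pad n y)" using nr by (intro box) (simp_all add: pad_def)
    then show "y \<in> pts n P" using yc unfolding pts_def by blast
  qed
  ultimately show "\<exists>T. openin (power_topology K n) T \<and> x \<in> T \<and> T \<subseteq> pts n P" by blast
qed

abbreviation borel_pred :: "nat \<Rightarrow> ((nat \<Rightarrow> 'k) \<Rightarrow> bool) \<Rightarrow> bool" where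
  "borel_pred n P \<equiv> pts n P \<in> borel_sets (power_topology K n)"

lemma sigma_borel: "sigma_algebra ({..<n} \<rightarrow>\<^sub>E carrier K) (borel_sets (power_topology K n))"
  unfolding borel_sets_def topspace_power[symmetric]
  by (rule sigma_algebra_sigma_sets) (auto dest: openin_subset)

lemma borel_pred_cong: "(\<And>e. e \<in> envs \<Longrightarrow> P e \<longleftrightarrow> Q e) \<Longrightarrow> pts n P = pts n Q"
  unfolding pts_def using pad_envs by blast

lemma borel_pred_or: assumes "borel_pred n P" "borel_pred n Q" shows "borel_pred n (\<lambda>e. P e \<or> Q e)"
proof -
  interpret sigma_algebra "{..<n} \<rightarrow>\<^sub>E carrier K" "borel_sets (power_topology K n)" by (rule sigma_borel)
  have "pts n (\<lambda>e. P e \<or> Q e) = pts n P \<union> pts n Q" unfolding pts_def by auto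
  then show ?thesis using assms by auto
qed

lemma borel_pred_neg: assumes "borel_pred n P" shows "borel_pred n (\<lambda>e. \<not> P e)"
proof -
  interpret sigma_algebra "{..<n} \<rightarrow>\<^sub>E carrier K" "borel_sets (power_topology K n)" by (rule sigma_borel)
  have "pts n (\<lambda>e. \<not> P e) = ({..<n} \<rightarrow>\<^sub>E carrier K) - pts n P" unfolding pts_def by auto
  then show ?thesis using assms by auto
qed

lemma borel_pred_open:
  assumes "\<And>e. e \<in> envs \<Longrightarrow> P e \<Longrightarrow> \<exists>d\<in>carrier K. d \<noteq> \<zero> \<and>
    (\<forall>h\<in>vary {..<n} e. (\<forall>i\<in>{..<n}. near K d (h i) (e i)) \<longrightarrow> P h)"
  shows "borel_pred n P"
  using openin_pts[OF assms] unfolding borel_sets_def by (auto intro: sigma_sets.Basic)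

lemma borel_adherent: "borel_pred n (adherent n P)"
proof -
  have "borel_pred n (\<lambda>e. \<not> adherent n P e)"
  proof (rule borel_pred_open)
    fix e assume e: "e \<in> envs" "\<not> adherent n P e"
    then obtain d where d: "d \<in> carrier K" "d \<noteq> \<zero>"
      and no: "\<And>h. h \<in> vary {..<n} e \<Longrightarrow> (\<And>i. i < n \<Longrightarrow> near K d (h i) (e i)) \<Longrightarrow> \<not> P h"
      unfolding adherent_def by blast
    have "\<not> adherent n P h" if h: "h \<in> vary {..<n} e" "\<forall>i\<in>{..<n}. near K d (h i) (e i)" for h
    proof
      assume "adherent n P h"
      then obtain h' where h': "h' \<in> vary {..<n} h" "\<And>i. i < n \<Longrightarrow> near K d (h' i) (h i)" "P h'"
        using d unfolding adherent_def by blast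
      have "h' \<in> vary {..<n} e" using vary_envs[OF h'(1)] vary_out[OF h'(1)] vary_out[OF h(1)]
        by (intro varyI) auto
      moreover have "near K d (h' i) (e i)" if "i < n" for i
        using near_trans[OF d(1) envs_closed[OF e(1)] h'(2)[OF that]] h(2) that by auto
      ultimately show False using no h'(3) by blast
    qed
    then show "\<exists>d\<in>carrier K. d \<noteq> \<zero> \<and>
      (\<forall>h\<in>vary {..<n} e. (\<forall>i\<in>{..<n}. near K d (h i) (e i)) \<longrightarrow> \<not> adherent n P h)" using d by blast
  qed
  from borel_pred_neg[OF this] show ?thesis by simp
qed

lemma borel_finite: assumes "finite (pts n P)" shows "borel_pred n P"
proof -
  interpret sigma_algebra "{..<n} \<rightarrow>\<^sub>E carrier K" "borel_sets (power_topology K n)" by (rule sigma_borel)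
  obtain p where p: "p \<in> vmax K" "p \<noteq> \<zero>"
    using nonunit_exists hm unfolding one_h_minimal_def by blast
  have "{x} \<in> borel_sets (power_topology K n)" if x: "x \<in> {..<n} \<rightarrow>\<^sub>E carrier K" for x
  proof -
    have "borel_pred n (\<lambda>e. \<exists>i<n. e i \<noteq> x i)"
    proof (rule borel_pred_open)
      fix e assume e: "e \<in> envs" "\<exists>i<n. e i \<noteq> x i"
      then obtain i where i: "i < n" "e i \<noteq> x i" by blast
      have "e i \<in> carrier K" "x i \<in> carrier K" using e x i by auto
      then obtain d where d: "d \<in> carrier K" "d \<noteq> \<zero>" "\<not> near K d (x i) (e i)"
        using near_separated[OF p, of "x i" "e i"] i by auto
      have "h i \<noteq> x i" if "near K d (h i) (e i)" for h :: "nat \<Rightarrow> 'k" using d that by auto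
      then show "\<exists>d\<in>carrier K. d \<noteq> \<zero> \<and> (\<forall>h\<in>vary {..<n} e. (\<forall>i\<in>{..<n}. near K d (h i) (e i)) \<longrightarrow>
          (\<exists>i<n. h i \<noteq> x i))" using d i by (intro bexI[of _ d]) auto
    qed
    from borel_pred_neg[OF this] have "borel_pred n (\<lambda>e. \<forall>i<n. e i = x i)" by simp
    moreover have "pts n (\<lambda>e. \<forall>i<n. e i = x i) = {x}"
      unfolding pts_def pad_def using x by (auto intro: PiE_ext[of _ "{..<n}" "\<lambda>_. carrier K"])
    ultimately show ?thesis by simp
  qed
  then have "(\<Union>x\<in>pts n P. {x}) \<in> borel_sets (power_topology K n)"
    using assms by (intro finite_UN) (auto simp: pts_def)
  then show ?thesis by simp
qed

text \<open>
  A small set \<open>D\<close> decomposes into finitely many definable pieces, each with finite fibres in the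
  direction of one of the coordinates \<open>js\<close>. The piece for the first coordinate \<open>j\<close> consists of the points
  on whose line in direction \<open>j\<close> the set \<open>D\<close> is finite. The remaining points satisfy a condition that is
  small in the other coordinates.
\<close>

lemma borel_pieces:
  assumes "defpred D" "indep J D" "set js \<inter> J = {}" "\<And>z. z \<in> envs \<Longrightarrow> \<not> big js D z"
    and "\<And>j D'. j \<in> set js \<Longrightarrow> defpred D' \<Longrightarrow> indep J D' \<Longrightarrow>
      (\<And>e. e \<in> envs \<Longrightarrow> finite {x \<in> carrier K. D' (e(j := x))}) \<Longrightarrow> borel_pred n (\<lambda>e. P e \<and> D' e)"
  shows "borel_pred n (\<lambda>e. P e \<and> D e)"
  using assms
proof (induction js arbitrary: P D)
  case Nil
  then have "pts n (\<lambda>e. P e \<and> D e) = {}" unfolding pts_def using pad_envs by auto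
  then show ?case by (intro borel_finite) simp
next
  case (Cons j js)
  define D1 where "D1 = inf_many j D"
  have D1: "defpred D1" "indep J D1" unfolding D1_def
    using defpred_inf_many indep_inf_many Cons.prems(1-3) by auto
  have "borel_pred n (\<lambda>e. P e \<and> (D e \<and> \<not> D1 e))"
  proof (rule Cons.prems(5)[of j])
    show "defpred (\<lambda>e. D e \<and> \<not> D1 e)" by (intro defpred_intros Cons.prems D1)
    show "indep J (\<lambda>e. D e \<and> \<not> D1 e)" using Cons.prems(2) D1(2) unfolding indep_def by blast
    fix e assume e: "e \<in> envs"
    have "D1 (e(j := x)) \<longleftrightarrow> D1 e" for x unfolding D1_def inf_many_def by simp
    then show "finite {x \<in> carrier K. D (e(j := x)) \<and> \<not> D1 (e(j := x))}"
      unfolding D1_def by (cases "inf_many j D e") (simp_all add: inf_many_def)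
  qed simp
  moreover have "borel_pred n (\<lambda>e. (P e \<and> D e) \<and> D1 e)"
  proof (rule Cons.IH[OF D1])
    show "set js \<inter> J = {}" using Cons.prems(3) by auto
    show "\<not> big js D1 z" if "z \<in> envs" for z using Cons.prems(4)[OF that] unfolding D1_def by simp
    fix i D' assume i: "i \<in> set js" and D': "defpred D'" "indep J D'"
      "\<And>e. e \<in> envs \<Longrightarrow> finite {x \<in> carrier K. D' (e(i := x))}"
    have "borel_pred n (\<lambda>e. P e \<and> (D e \<and> D' e))"
    proof (rule Cons.prems(5)[of i])
      show "i \<in> set (j # js)" using i by simp
      show "defpred (\<lambda>e. D e \<and> D' e)" by (intro defpred_intros Cons.prems D')
      show "indep J (\<lambda>e. D e \<and> D' e)" using Cons.prems(2) D'(2) unfolding indep_def by blast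
      fix e assume "e \<in> envs"
      from D'(3)[OF this] show "finite {x \<in> carrier K. D (e(i := x)) \<and> D' (e(i := x))}"
        by (rule rev_finite_subset) auto
    qed
    then show "borel_pred n (\<lambda>e. (P e \<and> D e) \<and> D' e)" by (simp add: conj_assoc)
  qed
  ultimately have "borel_pred n (\<lambda>e. (P e \<and> (D e \<and> \<not> D1 e)) \<or> ((P e \<and> D e) \<and> D1 e))"
    by (rule borel_pred_or)
  moreover have "(\<lambda>e. (P e \<and> (D e \<and> \<not> D1 e)) \<or> ((P e \<and> D e) \<and> D1 e)) = (\<lambda>e. P e \<and> D e)" by auto
  ultimately show ?case by simp
qed

text \<open>
  The induction on the number of base coordinates \<open>js\<close>. A point of the closure of \<open>P\<close> that does
  not lie over \<open>D\<close> belongs to \<open>P\<close>, so outside the part over the closure of \<open>D\<close> the set is the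
  difference of two closed sets.
\<close>

lemma borel_finite_fibres:
  assumes "defpred P" "distinct js" "set js \<subseteq> {..<n}"
    "\<And>e. e \<in> envs \<Longrightarrow> finite {f \<in> vary ({..<n} - set js) e. P f}"
  shows "borel_pred n P"
  using assms
proof (induction "length js" arbitrary: js P)
  case 0
  then have fin: "finite {f \<in> vary {..<n} (\<lambda>_. \<zero>). P f}" by (simp add: envs_def del: envs_closed)
  have "pad n ` pts n P \<subseteq> {f \<in> vary {..<n} (\<lambda>_. \<zero>). P f}"
    unfolding pts_def using pad_envs by (auto intro!: varyI simp: pad_def)
  then have "finite (pad n ` pts n P)" using fin finite_subset by blast
  moreover have "inj_on (pad n) (pts n P)"
  proof (rule inj_onI)
    fix x y assume xy: "x \<in> pts n P" "y \<in> pts n P" "pad n x = pad n y"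
    have "x i = y i" if "i < n" for i using fun_cong[OF xy(3), of i] that by (simp add: pad_def)
    then show "x = y" using xy(1,2) unfolding pts_def by (intro PiE_ext[of x "{..<n}" _ y]) auto
  qed
  ultimately show ?case using borel_finite finite_imageD by blast
next
  case (Suc k)
  define J where "J = {..<n} - set js"
  note P = Suc.prems(1)
  have fin: "finite {f \<in> vary J e. P f}" if "e \<in> envs" for e using Suc.prems(4) that unfolding J_def by blast
  have fJ: "finite J" unfolding J_def by simp
  define D where "D f \<longleftrightarrow> (\<exists>g\<in>vary J f. adherent n P g \<and> \<not> P g)" for f
  have D: "defpred D" unfolding D_def
    by (intro defpred_vary1[OF fJ] defpred_intros P defpred_adherent)
  have Dsmall: "\<not> big js D z" if "z \<in> envs" for z
    using boundary_small[OF P Suc.prems(2,3) J_def fin that] unfolding D_def .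
  have Dind: "indep J D" unfolding D_def by (rule indep_vary_ex)
  have C: "defpred (adherent n D)" "indep J (adherent n D)"
    using defpred_adherent[OF D] indep_adherent[OF Dind] unfolding J_def by auto
  have "borel_pred n (\<lambda>e. P e \<and> adherent n D e)"
  proof (rule borel_pieces[OF C])
    show "set js \<inter> J = {}" unfolding J_def by auto
    show "\<not> big js (adherent n D) z" if "z \<in> envs" for z
      by (rule closure_small[OF D Suc.prems(2,3) J_def Dind Dsmall that])
    fix j D' assume j: "j \<in> set js" and D': "defpred D'" "indep J D'"
      "\<And>e. e \<in> envs \<Longrightarrow> finite {x \<in> carrier K. D' (e(j := x))}"
    show "borel_pred n (\<lambda>e. P e \<and> D' e)"
    proof (rule Suc.hyps(1)[of "remove1 j js"])
      show "k = length (remove1 j js)" using Suc.hyps(2) j by (simp add: length_remove1)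
      show "defpred (\<lambda>e. P e \<and> D' e)" by (intro defpred_intros P D')
      show "distinct (remove1 j js)" using Suc.prems(2) by simp
      show "set (remove1 j js) \<subseteq> {..<n}" using Suc.prems(2,3) by auto
      fix e assume e: "e \<in> envs"
      have eq: "{..<n} - set (remove1 j js) = insert j J"
        using Suc.prems(2,3) j unfolding J_def by auto
      have sub: "{f \<in> vary (insert j J) e. P f \<and> D' f} \<subseteq>
        (\<Union>x\<in>{x \<in> carrier K. D' (e(j := x))}. {f \<in> vary J (e(j := x)). P f})"
      proof
        fix f assume "f \<in> {f \<in> vary (insert j J) e. P f \<and> D' f}"
        then have f: "f \<in> vary (insert j J) e" "P f" "D' f" by auto
        have fj: "f j \<in> carrier K" using vary_envs[OF f(1)] by simp
        have v: "f \<in> vary J (e(j := f j))"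
          by (rule varyI[OF vary_envs[OF f(1)]]) (use vary_out[OF f(1)] in auto)
        then have "D' (e(j := f j))" using D'(2) f(3) envs_upd[OF e fj] unfolding indep_def by blast
        then show "f \<in> (\<Union>x\<in>{x \<in> carrier K. D' (e(j := x))}. {f \<in> vary J (e(j := x)). P f})"
          using fj v f(2) by blast
      qed
      have "finite (\<Union>x\<in>{x \<in> carrier K. D' (e(j := x))}. {f \<in> vary J (e(j := x)). P f})"
        using D'(3)[OF e] fin envs_upd[OF e] by blast
      then show "finite {f \<in> vary ({..<n} - set (remove1 j js)) e. P f \<and> D' f}"
        unfolding eq by (rule finite_subset[OF sub])
    qed
  qed
  moreover have "borel_pred n (\<lambda>e. \<not> (\<not> adherent n P e \<or> adherent n D e))"
    by (intro borel_pred_neg borel_pred_or borel_adherent)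
  ultimately have Q: "borel_pred n (\<lambda>e. (P e \<and> adherent n D e) \<or> \<not> (\<not> adherent n P e \<or> adherent n D e))"
    by (rule borel_pred_or)
  have "pts n (\<lambda>e. (P e \<and> adherent n D e) \<or> \<not> (\<not> adherent n P e \<or> adherent n D e)) = pts n P"
  proof (rule borel_pred_cong)
    fix e assume e: "e \<in> envs"
    have "P e \<Longrightarrow> adherent n P e" "D e \<Longrightarrow> adherent n D e" using adherent_superset[OF e] by blast+
    moreover have "adherent n P e \<Longrightarrow> \<not> D e \<Longrightarrow> P e" unfolding D_def using varyI[OF e, of J e] by blast
    ultimately show "(P e \<and> adherent n D e) \<or> \<not> (\<not> adherent n P e \<or> adherent n D e) \<longleftrightarrow> P e" by blast
  qed
  then show ?case using Q by (simp only:)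
qed

text \<open>
  Over all coordinates the fibres are single points.
\<close>

lemma borel_definable: assumes "definable L K (carrier K) n X" shows "X \<in> borel_sets (power_topology K n)"
proof -
  obtain \<phi> as where \<phi>: "wf_fm L \<phi>" "set as \<subseteq> carrier K" "fv \<phi> \<subseteq> {..<n + length as}"
    and X: "X = {x \<in> {..<n} \<rightarrow>\<^sub>E carrier K. sat K ((!) (map x [0..<n] @ as)) \<phi>}"
    using assms unfolding definable_def by blast
  define P where "P e \<longleftrightarrow> sat K ((!) (map e [0..<n] @ as)) \<phi>" for e
  define p where "p i = (if i < length as then as ! i else \<zero>)" for i
  define \<rho> where "\<rho> i = (if i < n then 2 * i else Suc (2 * (i - n)))" for i
  have "defpred P" unfolding defpred_def
  proof (intro exI conjI ballI)
    show "wf_fm L (ren \<phi> \<rho>)" by (rule wf_ren[OF \<phi>(1)])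
    show "p \<in> envs" using \<phi>(2) by (auto simp: envs_def p_def simp del: envs_closed)
    fix e
    show "P e \<longleftrightarrow> sat K (mix e p) (ren \<phi> \<rho>)" unfolding P_def sat_ren
      by (rule sat_cong) (use \<phi>(3) in \<open>auto simp: \<rho>_def p_def nth_append\<close>)
  qed
  moreover have "finite {f \<in> vary ({..<n} - set [0..<n]) e. P f}" if "e \<in> envs" for e
  proof -
    have "{..<n} - set [0..<n] = {}" by auto
    then show ?thesis by (simp only: vary_empty[OF that]) simp
  qed
  ultimately have "borel_pred n P" by (intro borel_finite_fibres[of P "[0..<n]"]) auto
  moreover have "pts n P = X"
  proof -
    have "map (pad n x) [0..<n] = map x [0..<n]" for x by (simp add: pad_def)
    then show ?thesis unfolding X pts_def P_def by (simp only:)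
  qed
  ultimately show ?thesis by simp
qed

end

theorem theorem4p1:
  fixes L :: "('f, 'r) language"
    and K :: "('k, 'f, 'r) vstruct"
    and n :: nat
    and X :: "(nat \<Rightarrow> 'k) set"
  assumes "valued_structure L K"
    and "char_zero K"
    and "one_h_minimal L K"
    and "definable L K (carrier K) n X"
  shows "X \<in> borel_sets (power_topology K n)"
proof -
  interpret hmin L K by unfold_locales (rule assms(1-3))+
  show ?thesis by (rule borel_definable[OF assms(4)])
qed

end
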